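(* Let $m\ge 3$ be odd, and let $G=G(m)\rtimes H$ be an extension of the odd dihedral Artin group $G(m)$ by a finitely generated group $H$ satisfying: (ii) $H$ has solvable conjugacy problem; and (iii) for every $1\neq h\in H$, the subgroup $\langle h\rangle$ has finite index in its centralizer $C_H(h)$, and there is an algorithm which, given $h$, computes a finite set of coset representatives $z_{h,1},\dots,z_{h,t_h}\in H$, i.e. $C_H(h)=\langle h\rangle z_{h,1}\sqcup\cdots\sqcup\langle h\rangle z_{h,t_h}$ (for example, $H$ may be torsion-free hyperbolic). Then $G$ has decidable conjugacy problem.
   Context: For $m\ge 2$ the dihedral Artin group is $G(m)=\langle a,b \mid {}_m(a,b)={}_m(b,a)\rangle$, where ${}_m(a,b)$ is the alternating word $abab\cdots$ of length $m$; it is odd if $m$ is odd. The conjugacy problem for a group $G$ with finite generating set $X$ takes as input two words over $X^{\pm}$ and asks to decide whether they represent conjugate elements of $G$. *)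

theory Defs
  imports "HOL-Library.Nat_Bijection" "HOL-Library.Disjoint_Sets" "HOL-Algebra.Algebra"
begin

section \<open>Partial recursive functions\<close>

datatype recf =
    Zero
  | Succ
  | Proj nat
  | Comp recf "recf list"
  | PrimRec recf recf
  | Minim recf

text \<open>
  \<open>rec_eval f ns = None\<close> means that \<open>f\<close> is undefined (does not halt) on the inputs \<open>ns\<close>, or that
  \<open>ns\<close> is too short. Primitive recursion and minimization run over the first input:
  \<open>PrimRec f g\<close> satisfies \<open>F (0, p) = f p\<close> and \<open>F (k + 1, p) = g (k, F (k, p), p)\<close>, and
  \<open>Minim f\<close> returns the least \<open>n\<close> with \<open>f (n, p) = 0\<close> provided that \<open>f\<close> is defined at all smaller
  arguments.
\<close>

primrec rec_eval :: "recf \<Rightarrow> nat list \<Rightarrow> nat option" where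
  "rec_eval Zero ns = Some 0"
| "rec_eval Succ ns = (case ns of [] \<Rightarrow> None | n # _ \<Rightarrow> Some (Suc n))"
| "rec_eval (Proj i) ns = (if i < length ns then Some (ns ! i) else None)"
| "rec_eval (Comp f gs) ns =
     (let rs = map (\<lambda>g. rec_eval g ns) gs
      in if None \<in> set rs then None else rec_eval f (map the rs))"
| "rec_eval (PrimRec f g) ns =
     (case ns of [] \<Rightarrow> None
      | n # ps \<Rightarrow> rec_nat (rec_eval f ps)
                    (\<lambda>k r. Option.bind r (\<lambda>y. rec_eval g (k # y # ps))) n)"
| "rec_eval (Minim f) ns =
     (if \<exists>n. rec_eval f (n # ns) = Some 0 \<and> (\<forall>k<n. rec_eval f (k # ns) \<noteq> None)
      then Some (LEAST n. rec_eval f (n # ns) = Some 0) else None)"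


section \<open>Words, presentations, and dihedral Artin groups\<close>

text \<open>The letter \<open>(x, True)\<close> stands for the generator \<open>x\<close>, the letter \<open>(x, False)\<close> for its
  formal inverse.\<close>

type_synonym 'x word = "('x \<times> bool) list"

text \<open>A relation \<open>(l, r) \<in> R\<close> stands for \<open>l = r\<close>; the generators are all elements of \<open>'x\<close>.\<close>

inductive pres_eq :: "('x word \<times> 'x word) set \<Rightarrow> 'x word \<Rightarrow> 'x word \<Rightarrow> bool"
  for R where
  refl: "pres_eq R u u"
| sym: "pres_eq R u v \<Longrightarrow> pres_eq R v u"
| trans: "pres_eq R u v \<Longrightarrow> pres_eq R v w \<Longrightarrow> pres_eq R u w"
| cancel: "pres_eq R (u @ [(x, s), (x, \<not> s)] @ v) (u @ v)"
| rel: "(l, r) \<in> R \<Longrightarrow> pres_eq R (u @ l @ v) (u @ r @ v)"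

definition presented_group :: "('x word \<times> 'x word) set \<Rightarrow> 'x word set monoid" where
  "presented_group R =
     \<lparr>carrier = UNIV // {(u, v). pres_eq R u v},
      monoid.mult = (\<lambda>A B. {w. \<exists>u\<in>A. \<exists>v\<in>B. pres_eq R (u @ v) w}),
      one = {w. pres_eq R [] w}\<rparr>"

datatype artin_gen = gen_a | gen_b

fun alt_word :: "nat \<Rightarrow> 'x \<Rightarrow> 'x \<Rightarrow> 'x word" where
  "alt_word 0 x y = []"
| "alt_word (Suc n) x y = (x, True) # alt_word n y x"

definition dihedral_artin :: "nat \<Rightarrow> artin_gen word set monoid" where
  "dihedral_artin m = presented_group {(alt_word m gen_a gen_b, alt_word m gen_b gen_a)}"


section \<open>Semidirect products\<close>

definition semidirect_product ::
  "('a, 'c) monoid_scheme \<Rightarrow> ('b, 'd) monoid_scheme \<Rightarrow> ('b \<Rightarrow> 'a \<Rightarrow> 'a) \<Rightarrow> ('a \<times> 'b) monoid" where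
  "semidirect_product N H \<phi> =
     \<lparr>carrier = carrier N \<times> carrier H,
      monoid.mult = (\<lambda>(n, h) (n', h'). (n \<otimes>\<^bsub>N\<^esub> \<phi> h n', h \<otimes>\<^bsub>H\<^esub> h')),
      one = (\<one>\<^bsub>N\<^esub>, \<one>\<^bsub>H\<^esub>)\<rparr>"


section \<open>The conjugacy problem\<close>

definition generating_tuple :: "('a, 'b) monoid_scheme \<Rightarrow> 'a list \<Rightarrow> bool" where
  "generating_tuple G xs \<longleftrightarrow> set xs \<subseteq> carrier G \<and> generate G (set xs) = carrier G"

text \<open>Words over a generating tuple \<open>xs\<close> are words in the indices \<open>0, \<dots>, length xs - 1\<close>.\<close>

definition words_over :: "'a list \<Rightarrow> nat word set" where
  "words_over xs = lists ({..<length xs} \<times> UNIV)"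

definition word_val :: "('a, 'b) monoid_scheme \<Rightarrow> 'a list \<Rightarrow> nat word \<Rightarrow> 'a" where
  "word_val G xs w =
     foldr (\<lambda>(i, s) g. (if s then xs ! i else inv\<^bsub>G\<^esub> (xs ! i)) \<otimes>\<^bsub>G\<^esub> g) w \<one>\<^bsub>G\<^esub>"

definition word_code :: "nat word \<Rightarrow> nat" where
  "word_code w = list_encode (map (\<lambda>(i, s). 2 * i + (if s then 0 else 1)) w)"

definition conjugate_in :: "('a, 'b) monoid_scheme \<Rightarrow> 'a \<Rightarrow> 'a \<Rightarrow> bool" where
  "conjugate_in G x y \<longleftrightarrow> (\<exists>g\<in>carrier G. y = g \<otimes>\<^bsub>G\<^esub> x \<otimes>\<^bsub>G\<^esub> inv\<^bsub>G\<^esub> g)"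

definition conjugacy_problem_decidable_wrt :: "('a, 'b) monoid_scheme \<Rightarrow> 'a list \<Rightarrow> bool" where
  "conjugacy_problem_decidable_wrt G xs \<longleftrightarrow>
     (\<exists>f. \<forall>u\<in>words_over xs. \<forall>v\<in>words_over xs.
        rec_eval f [word_code u, word_code v] =
          Some (if conjugate_in G (word_val G xs u) (word_val G xs v) then 1 else 0))"

text \<open>Decidability does not depend on the chosen finite generating set, so it is required for all
  of them.\<close>

definition conjugacy_problem_decidable :: "('a, 'b) monoid_scheme \<Rightarrow> bool" where
  "conjugacy_problem_decidable G \<longleftrightarrow>
     (\<exists>xs. generating_tuple G xs) \<and>
     (\<forall>xs. generating_tuple G xs \<longrightarrow> conjugacy_problem_decidable_wrt G xs)"


section \<open>Centralizers and coset representatives\<close>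

definition centralizer :: "('a, 'b) monoid_scheme \<Rightarrow> 'a \<Rightarrow> 'a set" where
  "centralizer G h = {g \<in> carrier G. g \<otimes>\<^bsub>G\<^esub> h = h \<otimes>\<^bsub>G\<^esub> g}"

definition coset_representatives :: "('a, 'b) monoid_scheme \<Rightarrow> 'a set \<Rightarrow> 'a set \<Rightarrow> 'a list \<Rightarrow> bool" where
  "coset_representatives G K C zs \<longleftrightarrow>
     set zs \<subseteq> carrier G \<and>
     C = (\<Union>i<length zs. K #>\<^bsub>G\<^esub> zs ! i) \<and>
     disjoint_family_on (\<lambda>i. K #>\<^bsub>G\<^esub> zs ! i) {..<length zs}"

text \<open>The input \<open>h\<close> is given by any word representing it; nothing is required of the algorithm, not
  even termination, on words representing the identity.\<close>

definition centralizer_cosets_computable_wrt :: "('a, 'b) monoid_scheme \<Rightarrow> 'a list \<Rightarrow> bool" where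
  "centralizer_cosets_computable_wrt G xs \<longleftrightarrow>
     (\<exists>f. \<forall>w\<in>words_over xs. word_val G xs w \<noteq> \<one>\<^bsub>G\<^esub> \<longrightarrow>
        (\<exists>ws. set ws \<subseteq> words_over xs \<and>
              rec_eval f [word_code w] = Some (list_encode (map word_code ws)) \<and>
              coset_representatives G (generate G {word_val G xs w})
                (centralizer G (word_val G xs w)) (map (word_val G xs) ws)))"

end

theory Submission
  imports Defs
begin

text \<open>
  Let \<open>x\<close> be the alternating word \<open>aba\<dots>a\<close> of odd length \<open>m\<close> and let \<open>y = ab\<close>. These elements generate
  the dihedral Artin group \<open>N\<close>, with the single relation \<open>x x = y^m\<close>. The element \<open>z = x x\<close> generates
  the centre, and \<open>N\<close> modulo the centre is the free product of cyclic groups of orders \<open>2\<close> and \<open>m\<close>.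
  The degree of an element is its exponent sum in \<open>a\<close> and \<open>b\<close>; as \<open>z\<close> has degree \<open>2 m \<noteq> 0\<close>, an element
  of \<open>N\<close> is determined by its normal form \<open>l\<close> in the free product and its degree \<open>d\<close>, where \<open>d\<close> and
  the degree of \<open>l\<close> agree modulo \<open>2 m\<close> (\<open>dihedral_artin_iso_NG\<close>).

  The decisive algebraic fact is that modulo inner automorphisms the only nontrivial automorphism of
  \<open>N\<close> is the inversion \<open>t\<close>, sending \<open>x\<close> and \<open>y\<close> to their inverses (\<open>iso_NG_is_conjugation\<close>): elements
  of finite order in the free product are conjugate to syllables, so up to inner automorphisms an
  automorphism fixes \<open>x\<close> modulo the centre and sends \<open>y\<close> to a conjugate of a power of \<open>y\<close>, modulo
  the centre again. Surjectivity forces the conjugating element to be trivial, and comparing degrees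
  determines the power of \<open>y\<close> and the central factors. Consequently
  each automorphism \<open>\<phi> h\<close> is conjugation by an element \<open>e\<close> of \<open>E\<close>, the extension of \<open>N\<close> by \<open>t\<close>,
  and \<open>e\<close> can be computed letter by letter from a word for \<open>h\<close>. An equation
  \<open>k n \<phi>_h(k)^-1 = n'\<close> then says that \<open>n e\<close> and \<open>n' e\<close> are conjugate in \<open>E\<close> by an element of \<open>N\<close>.

  Conjugacy in \<open>E\<close> by elements of \<open>N\<close> is decidable (\<open>NG_conjugate_iff\<close>). When one conjugates by the
  syllables of a reduced word one after the other, a step that increases the length forces all later
  steps to increase it as well. All intermediate normal forms are therefore at most as long as the
  longer of the two ends; there are finitely many of them, together with a degree modulo \<open>2 m\<close>, and
  a conjugating element with a bounded number of syllables exists if there is any.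

  Now let \<open>(a, h)\<close> and \<open>(a', h')\<close> be elements of the semidirect product. If \<open>h\<close> and \<open>h'\<close> are not
  conjugate in \<open>H\<close>, nor are the two elements. If \<open>h = h' = 1\<close>, then \<open>a'\<close> has to be conjugate in \<open>N\<close>
  to an image of \<open>a\<close> under some \<open>\<phi> l\<close>, and up to inner automorphisms such an image is \<open>a\<close> or \<open>t(a)\<close>
  (\<open>conjugate_over_one\<close>). If \<open>h' \<noteq> 1\<close>, some \<open>l\<close> with \<open>l h = h' l\<close> is found by search, and every other
  one is \<open>c z l\<close> with \<open>c\<close> a power of \<open>h'\<close> and \<open>z\<close> one of the coset representatives. The factor \<open>c\<close> is
  irrelevant, because it lifts to an element that commutes with \<open>(a', h')\<close>; so one question about \<open>E\<close>
  for each representative decides the matter (\<open>conjugate_over_nontrivial\<close>).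

  The programs are not written out. Functions between types with a coding into the natural numbers
  are shown to be computable by closure under recursion, folding over lists and minimization.
\<close>

section \<open>Coded types\<close>

text \<open>An injection into the natural numbers is enough: no program ever has to recognise codes.
  Lists are coded by \<open>list_encode\<close>, so that the code of a word is the code of its list of letters.\<close>

class coded =
  fixes code :: "'a \<Rightarrow> nat"
  assumes code_inject: "code x = code y \<Longrightarrow> x = y"

instantiation nat :: coded
begin
definition code_nat :: "nat \<Rightarrow> nat" where "code_nat n = n"
instance by standard (simp add: code_nat_def)
end

instantiation bool :: coded
begin
definition code_bool :: "bool \<Rightarrow> nat" where "code_bool b = (if b then 1 else 0)"
instance by standard (simp add: code_bool_def split: if_splits)
end

instantiation prod :: (coded, coded) coded
begin
definition code_prod :: "'a \<times> 'b \<Rightarrow> nat" where "code_prod p = prod_encode (code (fst p), code (snd p))"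
instance by standard (auto simp: code_prod_def prod_eq_iff dest: code_inject)
end

text \<open>With the positive and the negative part as a pair, conversion from and to natural numbers and
  negation are mere projections and pairings.\<close>

instantiation int :: coded
begin
definition code_int :: "int \<Rightarrow> nat" where "code_int i = code (nat i, nat (- i))"
instance by standard (auto simp: code_int_def dest!: code_inject)
end

instantiation list :: (coded) coded
begin
definition code_list :: "'a list \<Rightarrow> nat" where "code_list l = list_encode (map code l)"
instance
proof
  fix k l :: "'a list"
  assume "code k = code l"
  then have "map code k = map code l" by (simp add: code_list_def list_encode_eq)
  then show "k = l" by (rule map_injective) (auto intro: injI code_inject)
qed
end

lemma code_simps [simp]:
  "code (n :: nat) = n" "code True = 1" "code False = 0"
  "code (x, y) = prod_encode (code x, code y)"
  "code ([] :: 'a::coded list) = 0" "code (z # zs) = Suc (prod_encode (code z, code zs))"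
  by (simp_all add: code_nat_def code_bool_def code_prod_def code_list_def)

section \<open>Programs for arithmetic and pairing\<close>

text \<open>For the inverse of the pairing function: \<open>k + n\<close> is the least \<open>d\<close> such that the code of \<open>(k, n)\<close> is
  less than \<open>triangle (Suc d)\<close>, which \<open>diag_prog\<close> finds by minimization.\<close>

definition "add_prog = PrimRec (Proj 0) (Comp Succ [Proj 1])"
definition "pred_prog = PrimRec Zero (Proj 0)"
definition "sub_prog = PrimRec (Proj 0) (Comp pred_prog [Proj 1])"
definition "tri_prog = PrimRec Zero (Comp add_prog [Comp Succ [Proj 0], Proj 1])"
definition "pair_prog = Comp add_prog [Comp tri_prog [add_prog], Proj 0]"
definition "diag_prog = Minim (Comp sub_prog [Comp tri_prog [Comp Succ [Proj 0]], Comp Succ [Proj 1]])"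
definition "fst_prog = Comp sub_prog [Comp tri_prog [diag_prog], Proj 0]"
definition "snd_prog = Comp sub_prog [fst_prog, diag_prog]"

lemma add_prog [simp]: "rec_eval add_prog (k # n # ns) = Some (k + n)"
  by (induction k) (simp_all add: add_prog_def)

lemma pred_prog [simp]: "rec_eval pred_prog (k # ns) = Some (k - 1)"
  by (induction k) (simp_all add: pred_prog_def)

lemma sub_prog [simp]: "rec_eval sub_prog (k # n # ns) = Some (n - k)"
  by (induction k) (simp_all add: sub_prog_def)

lemma tri_prog [simp]: "rec_eval tri_prog (k # ns) = Some (triangle k)"
  by (induction k) (simp_all add: tri_prog_def)

lemma pair_prog [simp]: "rec_eval pair_prog (k # n # ns) = Some (prod_encode (k, n))"
  by (simp add: pair_prog_def prod_encode_def)

lemma triangle_mono: "k \<le> n \<Longrightarrow> triangle k \<le> triangle n"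
  by (induction rule: dec_induct) simp_all

lemma diag_prog [simp]: "rec_eval diag_prog [prod_encode (k, n)] = Some (k + n)"
proof -
  have "(LEAST d. Suc (prod_encode (k, n)) - triangle (Suc d) = 0) = k + n"
  proof (rule Least_equality)
    show "Suc (prod_encode (k, n)) - triangle (Suc (k + n)) = 0"
      by (simp add: prod_encode_def)
  next
    fix d
    assume "Suc (prod_encode (k, n)) - triangle (Suc d) = 0"
    then have "\<not> Suc d \<le> k + n"
      using triangle_mono[of "Suc d" "k + n"] by (auto simp: prod_encode_def)
    then show "k + n \<le> d" by simp
  qed
  moreover have "Suc (prod_encode (k, n)) - triangle (Suc (k + n)) = 0"
    by (simp add: prod_encode_def)
  ultimately show ?thesis
    by (auto simp: diag_prog_def simp del: triangle_Suc)
qed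

lemma fst_prog [simp]: "rec_eval fst_prog [prod_encode (k, n)] = Some k"
  by (simp add: fst_prog_def) (simp add: prod_encode_def)

lemma snd_prog [simp]: "rec_eval snd_prog [prod_encode (k, n)] = Some n"
  by (simp add: snd_prog_def)

section \<open>Computable functions on coded types\<close>

definition computable_on :: "'a::coded set \<Rightarrow> ('a \<Rightarrow> 'b::coded) \<Rightarrow> bool" where
  "computable_on A f \<longleftrightarrow> (\<exists>r. \<forall>x\<in>A. rec_eval r [code x] = Some (code (f x)))"

abbreviation computable :: "('a::coded \<Rightarrow> 'b::coded) \<Rightarrow> bool" where
  "computable \<equiv> computable_on UNIV"

lemma computable_onI:
  assumes "\<And>x. x \<in> A \<Longrightarrow> rec_eval r [code x] = Some (code (f x))"
  shows "computable_on A f"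
  using assms by (auto simp: computable_on_def)

lemma computable_onE:
  assumes "computable_on A f"
  obtains r where "\<And>x. x \<in> A \<Longrightarrow> rec_eval r [code x] = Some (code (f x))"
  using assms by (auto simp: computable_on_def)

lemma computable_on_compose:
  assumes "computable_on B g" "computable_on A f" "\<And>x. x \<in> A \<Longrightarrow> f x \<in> B"
  shows "computable_on A (\<lambda>x. g (f x))"
proof -
  obtain r s where "\<And>x. x \<in> B \<Longrightarrow> rec_eval r [code x] = Some (code (g x))"
      "\<And>x. x \<in> A \<Longrightarrow> rec_eval s [code x] = Some (code (f x))"
    using assms(1,2) by (metis computable_onE)
  then show ?thesis
    using assms(3) by (intro computable_onI[of _ "Comp r [s]"]) simp
qed

lemma computable_on_subset: "computable_on B f \<Longrightarrow> A \<subseteq> B \<Longrightarrow> computable_on A f"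
  by (auto simp: computable_on_def)

lemma computable_on_cong:
  "computable_on A f \<Longrightarrow> (\<And>x. x \<in> A \<Longrightarrow> f x = g x) \<Longrightarrow> computable_on A g"
  by (auto simp: computable_on_def)

lemma computable_ident: "computable_on A (\<lambda>x. x)"
  by (rule computable_onI[of _ "Proj 0"]) simp

lemma computable_const: "computable_on A (\<lambda>_. c)"
proof -
  have "\<exists>r. \<forall>ns. rec_eval r ns = Some n" for n
  proof (induction n)
    case 0
    show ?case by (rule exI[of _ Zero]) simp
  next
    case (Suc n)
    then obtain r where "\<forall>ns. rec_eval r ns = Some n" by blast
    then show ?case by (intro exI[of _ "Comp Succ [r]"]) simp
  qed
  from this[of "code c"] show ?thesis unfolding computable_on_def by blast
qed

lemma computable_Pair:
  assumes "computable_on A f" "computable_on A g"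
  shows "computable_on A (\<lambda>x. (f x, g x))"
proof -
  obtain r s where "\<And>x. x \<in> A \<Longrightarrow> rec_eval r [code x] = Some (code (f x))"
      "\<And>x. x \<in> A \<Longrightarrow> rec_eval s [code x] = Some (code (g x))"
    using assms by (metis computable_onE)
  then show ?thesis by (intro computable_onI[of _ "Comp pair_prog [r, s]"]) simp
qed

lemma computable_fst: "computable_on A f \<Longrightarrow> computable_on A (\<lambda>x. fst (f x))"
  by (rule computable_on_compose[of UNIV fst])
    (auto intro!: computable_onI[of _ fst_prog] simp: code_prod_def)

lemma computable_snd: "computable_on A f \<Longrightarrow> computable_on A (\<lambda>x. snd (f x))"
  by (rule computable_on_compose[of UNIV snd])
    (auto intro!: computable_onI[of _ snd_prog] simp: code_prod_def)

lemma computable_apply2: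
  assumes "computable (\<lambda>p. h (fst p) (snd p))" "computable_on A f" "computable_on A g"
  shows "computable_on A (\<lambda>x. h (f x) (g x))"
  using computable_on_compose[OF assms(1) computable_Pair[OF assms(2,3)]] by simp

text \<open>The variables bound in the step function become projections of a tuple whose last component is the
  surrounding variable \<open>x\<close>. Rules of this form can be applied to nested terms by mere
  resolution, since the premises are again of the form \<open>computable (\<lambda>p. \<dots>)\<close>.\<close>

lemma computable_rec_nat:
  assumes "computable f" "computable (\<lambda>p. g (fst p) (fst (snd p)) (snd (snd p)))"
    and "computable k"
  shows "computable (\<lambda>x. rec_nat (f x) (\<lambda>n y. g n y x) (k x))"
proof -
  obtain r where r: "\<And>x. rec_eval r [code x] = Some (code (f x))"
    using assms(1) by (auto simp: computable_on_def)
  obtain s where s: "\<And>p. rec_eval s [code p] = Some (code (g (fst p) (fst (snd p)) (snd (snd p))))"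
    using assms(2) unfolding computable_on_def by blast
  obtain t where t: "\<And>x. rec_eval t [code x] = Some (code (k x))"
    using assms(3) by (auto simp: computable_on_def)
  let ?s = "Comp s [Comp pair_prog [Proj 0, Comp pair_prog [Proj 1, Proj 2]]]"
  have "rec_eval (PrimRec r ?s) [n, code x] = Some (code (rec_nat (f x) (\<lambda>n y. g n y x) n))" for n x
  proof (induction n)
    case 0
    show ?case by (simp add: r)
  next
    case (Suc n)
    have "rec_eval s [prod_encode (n, prod_encode (code y, code x))] = Some (code (g n y x))" for y
      using s[of "(n, y, x)"] by simp
    with Suc show ?case by simp
  qed
  then show ?thesis
    by (intro computable_onI[of _ "Comp (PrimRec r ?s) [t, Proj 0]"]) (simp add: t)
qed

lemma computable_Suc: "computable_on A f \<Longrightarrow> computable_on A (\<lambda>x. Suc (f x))"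
  by (rule computable_on_compose[of UNIV Suc]) (auto intro!: computable_onI[of _ Succ])

text \<open>The two branches are only evaluated where they are selected: this is what allows a partial
  program to be called under a guard.\<close>

lemma computable_if:
  assumes "computable_on A b" "computable_on {x \<in> A. b x} f" "computable_on {x \<in> A. \<not> b x} g"
  shows "computable_on A (\<lambda>x. if b x then f x else g x)"
proof -
  obtain q where q: "\<And>x. x \<in> A \<Longrightarrow> rec_eval q [code x] = Some (code (b x))"
    using assms(1) unfolding computable_on_def by blast
  obtain r where r: "\<And>x. x \<in> A \<Longrightarrow> b x \<Longrightarrow> rec_eval r [code x] = Some (code (f x))"
    using assms(2) unfolding computable_on_def by blast
  obtain s where s: "\<And>x. x \<in> A \<Longrightarrow> \<not> b x \<Longrightarrow> rec_eval s [code x] = Some (code (g x))"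
    using assms(3) unfolding computable_on_def by blast
  let ?not = "Comp sub_prog [q, Comp Succ [Zero]]"
  let ?t = "Comp (PrimRec (Comp (PrimRec Zero (Comp s [Proj 2])) [?not, Proj 0]) (Comp r [Proj 2])) [q, Proj 0]"
  show ?thesis
  proof (rule computable_onI[of _ ?t])
    fix x assume "x \<in> A"
    then show "rec_eval ?t [code x] = Some (code (if b x then f x else g x))"
      using q[of x] r[of x] s[of x] by (cases "b x") simp_all
  qed
qed

lemma computable_If:
  "computable_on A b \<Longrightarrow> computable_on A f \<Longrightarrow> computable_on A g
    \<Longrightarrow> computable_on A (\<lambda>x. if b x then f x else g x)"
  by (rule computable_if) (auto elim: computable_on_subset)

lemma computable_Not: "computable_on A b \<Longrightarrow> computable_on A (\<lambda>x. \<not> b x)"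
  by (rule computable_on_cong[OF computable_If[of A b "\<lambda>_. False" "\<lambda>_. True"]])
    (auto intro: computable_const)

lemma computable_conj:
  "computable_on A b \<Longrightarrow> computable_on A c \<Longrightarrow> computable_on A (\<lambda>x. b x \<and> c x)"
  by (rule computable_on_cong[OF computable_If[of A b c "\<lambda>_. False"]])
    (auto intro: computable_const)

lemma computable_disj:
  "computable_on A b \<Longrightarrow> computable_on A c \<Longrightarrow> computable_on A (\<lambda>x. b x \<or> c x)"
  by (rule computable_on_cong[OF computable_If[of A b "\<lambda>_. True" c]])
    (auto intro: computable_const)

lemma computable_Least:
  assumes "computable (\<lambda>p. b (fst p) (snd p))" "\<And>x. \<exists>n. b n x"
  shows "computable (\<lambda>x. LEAST n::nat. b n x)"
proof -
  obtain r where r: "\<And>p. rec_eval r [code p] = Some (code (b (fst p) (snd p)))"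
    using assms(1) unfolding computable_on_def by blast
  let ?r = "Comp sub_prog [Comp r [pair_prog], Comp Succ [Zero]]"
  have ev: "rec_eval ?r [n, code x] = Some (if b n x then 0 else 1)" for n x
    using r[of "(n, x)"] by simp
  have "rec_eval (Minim ?r) [code x] = Some (LEAST n. b n x)" for x
  proof -
    have "(rec_eval ?r (n # [code x]) = Some 0) = b n x" "rec_eval ?r (n # [code x]) \<noteq> None" for n
      by (simp_all only: ev) simp_all
    then show ?thesis using assms(2)[of x] by (simp only: rec_eval.simps(6)) auto
  qed
  then show ?thesis by (intro computable_onI[of _ "Minim ?r"]) (simp only: code_simps)
qed

section \<open>Computability of arithmetic\<close>

lemma computable_add:
  fixes f g :: "'a::coded \<Rightarrow> nat"
  shows "computable_on A f \<Longrightarrow> computable_on A g \<Longrightarrow> computable_on A (\<lambda>x. f x + g x)"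
  by (rule computable_apply2[where h = "(+)"])
    (auto intro!: computable_onI[of _ "Comp add_prog [fst_prog, snd_prog]"] simp: code_prod_def)

lemma computable_diff:
  fixes f g :: "'a::coded \<Rightarrow> nat"
  shows "computable_on A f \<Longrightarrow> computable_on A g \<Longrightarrow> computable_on A (\<lambda>x. f x - g x)"
  by (rule computable_apply2[where h = "(-)"])
    (auto intro!: computable_onI[of _ "Comp sub_prog [snd_prog, fst_prog]"] simp: code_prod_def)

lemma computable_code: "computable_on A f \<Longrightarrow> computable_on A (\<lambda>x. code (f x))"
  unfolding computable_on_def code_simps .

lemma computable_eq:
  assumes "computable_on A f" "computable_on A g"
  shows "computable_on A (\<lambda>x. f x = g x)"
proof -
  have "computable (\<lambda>n::nat. n = 0)"
    by (rule computable_onI[of _ "Comp sub_prog [Proj 0, Comp Succ [Zero]]"]) (simp add: code_bool_def)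
  from computable_on_compose[OF this computable_add[OF computable_diff computable_diff],
      OF computable_code computable_code computable_code computable_code, OF assms assms(2,1)]
  show ?thesis by (rule computable_on_cong) (auto dest: code_inject)
qed

lemma computable_le:
  fixes f g :: "'a::coded \<Rightarrow> nat"
  assumes "computable_on A f" "computable_on A g"
  shows "computable_on A (\<lambda>x. f x \<le> g x)"
  by (rule computable_on_cong[OF computable_eq[OF computable_diff[OF assms] computable_const[of _ 0]]])
    simp

lemma computable_less:
  fixes f g :: "'a::coded \<Rightarrow> nat"
  assumes "computable_on A f" "computable_on A g"
  shows "computable_on A (\<lambda>x. f x < g x)"
  by (rule computable_on_cong[OF computable_Not[OF computable_le[OF assms(2,1)]]]) auto

lemmas computable_basic = computable_const computable_ident computable_Pair computable_fst
  computable_snd computable_Suc computable_If computable_Not computable_conj computable_disj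
  computable_add computable_diff computable_eq computable_le computable_less computable_code
  computable_rec_nat

lemma computable_mult:
  fixes f g :: "'a::coded \<Rightarrow> nat"
  assumes "computable_on A f" "computable_on A g"
  shows "computable_on A (\<lambda>x. f x * g x)"
proof -
  have "computable (\<lambda>p. rec_nat (0::nat) (\<lambda>_ y. y + snd p) (fst p))"
    by (intro computable_basic)
  moreover have "rec_nat 0 (\<lambda>_ y. y + b) a = a * b" for a b :: nat by (induction a) simp_all
  ultimately show ?thesis using assms by (auto intro!: computable_apply2[where h = "(*)", OF _ assms])
qed

lemma computable_power:
  fixes f g :: "'a::coded \<Rightarrow> nat"
  assumes "computable_on A f" "computable_on A g"
  shows "computable_on A (\<lambda>x. f x ^ g x)"
proof -
  have "computable (\<lambda>p. rec_nat (1::nat) (\<lambda>_ y. fst p * y) (snd p))"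
    by (intro computable_basic computable_mult)
  moreover have "rec_nat 1 (\<lambda>_ y. b * y) a = b ^ a" for a b :: nat by (induction a) simp_all
  ultimately show ?thesis using assms by (auto intro!: computable_apply2[where h = "(^)", OF _ assms])
qed

lemma computable_mod:
  fixes f g :: "'a::coded \<Rightarrow> nat"
  assumes "computable_on A f" "computable_on A g"
  shows "computable_on A (\<lambda>x. f x mod g x)"
proof -
  have "computable (\<lambda>p. rec_nat (0::nat) (\<lambda>_ y. if Suc y = snd p then 0 else Suc y) (fst p))"
    by (intro computable_basic)
  moreover have "rec_nat 0 (\<lambda>_ y. if Suc y = b then 0 else Suc y) a = a mod b" for a b :: nat
    by (induction a) (simp_all add: mod_Suc)
  ultimately show ?thesis using assms by (auto intro!: computable_apply2[where h = "(mod)", OF _ assms])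
qed

lemma computable_max:
  fixes f g :: "'a::coded \<Rightarrow> nat"
  assumes "computable_on A f" "computable_on A g"
  shows "computable_on A (\<lambda>x. max (f x) (g x))"
  unfolding max_def using assms by (intro computable_basic)

section \<open>Computability of integer operations\<close>

lemma computable_nat: "computable_on A f \<Longrightarrow> computable_on A (\<lambda>x. nat (f x))"
  by (rule computable_on_compose[of UNIV nat])
    (auto intro!: computable_onI[of _ fst_prog] simp: code_int_def)

lemma computable_int: "computable_on A f \<Longrightarrow> computable_on A (\<lambda>x. int (f x))"
  by (rule computable_on_compose[of UNIV int])
    (auto intro!: computable_onI[of _ "Comp pair_prog [Proj 0, Zero]"] simp: code_int_def)

lemma computable_uminus: "computable_on A f \<Longrightarrow> computable_on A (\<lambda>x. - f x :: int)"
  by (rule computable_on_compose[of UNIV uminus])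
    (auto intro!: computable_onI[of _ "Comp pair_prog [snd_prog, fst_prog]"] simp: code_int_def)

lemma computable_int_add:
  fixes f g :: "'a::coded \<Rightarrow> int"
  assumes "computable_on A f" "computable_on A g"
  shows "computable_on A (\<lambda>x. f x + g x)"
proof -
  let ?p = "\<lambda>x. nat (f x) + nat (g x)" and ?n = "\<lambda>x. nat (- f x) + nat (- g x)"
  have "computable_on A (\<lambda>x. if ?n x \<le> ?p x then int (?p x - ?n x) else - int (?n x - ?p x))"
    using assms by (intro computable_basic computable_nat computable_int computable_uminus)
  then show ?thesis by (rule computable_on_cong) auto
qed

lemma computable_int_diff:
  fixes f g :: "'a::coded \<Rightarrow> int"
  assumes "computable_on A f" "computable_on A g"
  shows "computable_on A (\<lambda>x. f x - g x)"
  using computable_int_add[OF assms(1) computable_uminus[OF assms(2)]] by simp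

lemma computable_dvd_int:
  fixes f :: "'a::coded \<Rightarrow> int"
  assumes "computable_on A f"
  shows "computable_on A (\<lambda>x. int n dvd f x)"
proof -
  have "computable_on A (\<lambda>x. (nat (f x) + nat (- f x)) mod n = 0)"
    using assms by (intro computable_basic computable_nat computable_uminus computable_mod)
  moreover have "(nat i + nat (- i)) mod n = 0 \<longleftrightarrow> int n dvd i" for i
  proof -
    have "nat i + nat (- i) = nat \<bar>i\<bar>" by auto
    then show ?thesis using nat_abs_dvd_iff[of i n]
      by (simp add: mod_eq_0_iff_dvd)
  qed
  ultimately show ?thesis by simp
qed

section \<open>Computability of list operations\<close>

lemma computable_Cons:
  "computable_on A f \<Longrightarrow> computable_on A g \<Longrightarrow> computable_on A (\<lambda>x. f x # g x)"
  by (rule computable_apply2[where h = "(#)"])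
    (auto intro!: computable_onI[of _ "Comp Succ [Proj 0]"] simp: code_prod_def)

lemma computable_case_list:
  assumes "computable_on A k" "computable_on A f"
    and "computable (\<lambda>p. g (fst p) (fst (snd p)) (snd (snd p)))"
  shows "computable_on A (\<lambda>x. case k x of [] \<Rightarrow> f x | a # l \<Rightarrow> g a l x)"
proof -
  have hd: "computable_on {l. l \<noteq> []} hd"
    by (rule computable_onI[of _ "Comp fst_prog [pred_prog]"]) (auto simp: neq_Nil_conv)
  have tl: "computable_on {l. l \<noteq> []} tl"
    by (rule computable_onI[of _ "Comp snd_prog [pred_prog]"]) (auto simp: neq_Nil_conv)
  have "computable_on A (\<lambda>x. if k x = [] then f x else
      (\<lambda>p. g (fst p) (fst (snd p)) (snd (snd p))) (hd (k x), tl (k x), x))"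
  proof (rule computable_if, intro computable_basic assms)
    show "computable_on {x \<in> A. k x = []} f" using assms(2) by (rule computable_on_subset) auto
    show "computable_on {x \<in> A. k x \<noteq> []}
        (\<lambda>x. (\<lambda>p. g (fst p) (fst (snd p)) (snd (snd p))) (hd (k x), tl (k x), x))"
    proof (rule computable_on_compose[OF assms(3)])
      show "computable_on {x \<in> A. k x \<noteq> []} (\<lambda>x. (hd (k x), tl (k x), x))"
        by (intro computable_Pair computable_ident computable_on_compose[OF hd, of _ k]
            computable_on_compose[OF tl, of _ k] computable_on_subset[OF assms(1)]) auto
    qed simp
  qed
  then show ?thesis by (rule computable_on_cong) (auto split: list.split)
qed

lemma length_le_code: "length l \<le> code l"
proof (induction l)
  case (Cons a l)
  then show ?case
    using le_prod_encode_2[of "code l" "code a"] by simp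
qed simp

text \<open>A list is consumed by iterating a step that has no effect on the empty list. The code of the list
  serves as the number of iterations, because it is at least the length.\<close>

lemma computable_fold:
  assumes "computable k" "computable f"
    and "computable (\<lambda>p. g (fst p) (fst (snd p)) (snd (snd p)))"
  shows "computable (\<lambda>x. fold (\<lambda>a s. g a s x) (k x) (f x))"
proof -
  let ?step = "\<lambda>x p. case fst p of [] \<Rightarrow> p | a # l \<Rightarrow> (l, g a (snd p) x)"
  let ?it = "\<lambda>x. rec_nat (k x, f x) (\<lambda>_. ?step x) (code (k x))"
  have "computable (\<lambda>p. (\<lambda>q. g (fst q) (fst (snd q)) (snd (snd q)))
     (fst p, snd (fst (snd (snd (snd p)))), snd (snd (snd (snd p)))))"
    by (rule computable_on_compose[OF assms(3)]) (auto intro!: computable_basic)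
  then have "computable (\<lambda>p. g (fst p) (snd (fst (snd (snd (snd p))))) (snd (snd (snd (snd p)))))"
    by simp
  then have "computable ?it"
    by (intro computable_basic computable_case_list assms)
  then have "computable (\<lambda>x. snd (?it x))" by (rule computable_snd)
  moreover have it: "snd (rec_nat (l, s) (\<lambda>_. ?step x) (n + length l)) = fold (\<lambda>a s. g a s x) l s"
    for l s x n
  proof (induction l arbitrary: s)
    case Nil
    have "rec_nat ([], s) (\<lambda>_. ?step x) n = ([], s)" by (induction n) simp_all
    then show ?case by simp
  next
    case (Cons a l)
    have "rec_nat (?step x p) (\<lambda>_. ?step x) n = rec_nat p (\<lambda>_. ?step x) (Suc n)" for p n
      by (induction n) simp_all
    from this[of "(a # l, s)"] show ?case using Cons[of "g a s x"] by simp
  qed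
  have "snd (?it x) = fold (\<lambda>a s. g a s x) (k x) (f x)" for x
  proof -
    have "code (k x) = (code (k x) - length (k x)) + length (k x)"
      using length_le_code[of "k x"] by simp
    then show ?thesis using it by (rule ssubst)
  qed
  ultimately show ?thesis by simp
qed

lemma computable_rev: "computable f \<Longrightarrow> computable (\<lambda>x. rev (f x))"
proof -
  assume "computable f"
  then have "computable (\<lambda>x. fold (\<lambda>a s. a # s) (f x) [])"
    by (intro computable_basic computable_fold computable_Cons)
  moreover have "fold (\<lambda>a s. a # s) l [] = rev l" for l :: "'b list"
    by (simp add: fold_Cons_rev)
  ultimately show ?thesis by simp
qed

lemma computable_foldr:
  assumes "computable k" "computable f"
    and "computable (\<lambda>p. g (fst p) (fst (snd p)) (snd (snd p)))"
  shows "computable (\<lambda>x. foldr (\<lambda>a s. g a s x) (k x) (f x))"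
  unfolding foldr_conv_fold using assms by (intro computable_fold computable_rev)

lemma computable_map:
  assumes "computable k" "computable (\<lambda>p. g (fst p) (snd p))"
  shows "computable (\<lambda>x. map (\<lambda>a. g a x) (k x))"
proof -
  have "computable (\<lambda>p. (\<lambda>q. g (fst q) (snd q)) (fst p, snd (snd p)))"
    by (rule computable_on_compose[OF assms(2)]) (auto intro!: computable_basic)
  then have "computable (\<lambda>p. g (fst p) (snd (snd p)))" by simp
  then have "computable (\<lambda>x. foldr (\<lambda>a s. g a x # s) (k x) [])"
    by (intro computable_foldr computable_Cons computable_basic assms)
  moreover have "foldr (\<lambda>a s. g a x # s) l [] = map (\<lambda>a. g a x) l" for l x
    by (induction l) simp_all
  ultimately show ?thesis by simp
qed

lemma computable_append:
  assumes "computable k" "computable l"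
  shows "computable (\<lambda>x. k x @ l x)"
proof -
  have "computable (\<lambda>x. foldr (\<lambda>a s. a # s) (k x) (l x))"
    by (intro computable_foldr computable_Cons computable_basic assms)
  moreover have "foldr (\<lambda>a s. a # s) k l = k @ l" for k l :: "'b list"
    by (induction k) simp_all
  ultimately show ?thesis by simp
qed

lemma computable_list_ex:
  assumes "computable k" "computable (\<lambda>p. b (fst p) (snd p))"
  shows "computable (\<lambda>x. \<exists>a\<in>set (k x). b a x)"
proof -
  have "computable (\<lambda>x. foldr (\<lambda>c s. c \<or> s) (map (\<lambda>a. b a x) (k x)) False)"
    by (intro computable_foldr computable_basic computable_map assms)
  moreover have "foldr (\<lambda>c s. c \<or> s) l False \<longleftrightarrow> True \<in> set l" for l
    by (induction l) auto
  ultimately have "computable (\<lambda>x. True \<in> set (map (\<lambda>a. b a x) (k x)))"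
    by (simp only:)
  then show ?thesis by (rule computable_on_cong) (auto simp: image_iff)
qed

lemma computable_list_all:
  assumes "computable k" "computable (\<lambda>p. b (fst p) (snd p))"
  shows "computable (\<lambda>x. \<forall>a\<in>set (k x). b a x)"
  using computable_Not[OF computable_list_ex[OF assms(1) computable_Not[OF assms(2)]]] by simp

lemma computable_length: "computable k \<Longrightarrow> computable (\<lambda>x. length (k x))"
proof -
  assume "computable k"
  then have "computable (\<lambda>x. foldr (\<lambda>_ s. Suc s) (k x) 0)"
    by (intro computable_foldr computable_basic)
  moreover have "foldr (\<lambda>_ s. Suc s) l 0 = length l" for l :: "'b list"
    by (induction l) simp_all
  ultimately show ?thesis by simp
qed

lemma computable_list_decode: "computable_on A f \<Longrightarrow> computable_on A (\<lambda>x. list_decode (f x))"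
  by (rule computable_on_compose[of UNIV list_decode])
    (auto intro!: computable_onI[of _ "Proj 0"] simp: code_list_def code_nat_def[abs_def])

lemma computable_bounded_ex:
  assumes "computable k" "computable (\<lambda>p. b (fst p) (snd p))"
  shows "computable (\<lambda>x. \<exists>n::nat. n < k x \<and> b n x)"
proof -
  have "computable (\<lambda>p. (\<lambda>q. b (fst q) (snd q)) (fst p, snd (snd p)))"
    by (rule computable_on_compose[OF assms(2)]) (auto intro!: computable_basic)
  then have "computable (\<lambda>p. b (fst p) (snd (snd p)))" by simp
  then have "computable (\<lambda>x. rec_nat False (\<lambda>n y. y \<or> b n x) (k x))"
    by (intro computable_basic assms)
  moreover have "rec_nat False (\<lambda>n y. y \<or> b n x) j \<longleftrightarrow> (\<exists>n<j. b n x)" for j x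
    by (induction j) (auto simp: less_Suc_eq)
  ultimately show ?thesis by simp
qed

text \<open>A finite table is computable whatever its entries are; this is how group elements without any
  effective description enter a program.\<close>

lemma computable_table: "computable (\<lambda>n. if n < length l then l ! n else c)"
proof (induction l rule: rev_induct)
  case Nil
  show ?case by (simp add: computable_const)
next
  case (snoc a l)
  then have "computable (\<lambda>n. if n = length l then a else if n < length l then l ! n else c)"
    by (rule computable_If[OF computable_eq[OF computable_ident computable_const] computable_const])
  then show ?case by (rule computable_on_cong) (auto simp: nth_append)
qed

lemmas computable_intros = computable_basic computable_mult computable_power computable_mod
  computable_max computable_nat computable_int computable_uminus computable_int_add
  computable_int_diff computable_dvd_int computable_Cons computable_case_list computable_foldr
  computable_rev computable_map computable_append computable_list_ex computable_list_all
  computable_length computable_list_decode computable_bounded_ex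

locale odd_dihedral =
  fixes m :: nat
  assumes m_ge: "m \<ge> 3" and odd_m: "odd m"
begin

section \<open>The free product of cyclic groups of orders two and m\<close>

text \<open>The syllable \<open>0\<close> stands for \<open>x\<close> and the syllable \<open>s\<close> with \<open>0 < s < m\<close> for \<open>y^s\<close>; the factor to which
  a syllable belongs is read off from the test \<open>s = 0\<close>.\<close>

definition reduced :: "nat list \<Rightarrow> bool" where
  "reduced l \<longleftrightarrow> (\<forall>s\<in>set l. s < m) \<and> successively (\<lambda>s t. (s = 0) \<noteq> (t = 0)) l"

text \<open>Left multiplication by a syllable. Addition modulo \<open>m\<close> is correct in both factors, since \<open>0 + 0 = 0\<close>
  expresses \<open>x x = 1\<close>.\<close>

definition push :: "nat \<Rightarrow> nat list \<Rightarrow> nat list" where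
  "push s l = (case l of [] \<Rightarrow> [s]
     | k # t \<Rightarrow> if (s = 0) \<noteq> (k = 0) then s # k # t
       else if (s + k) mod m = 0 then t else ((s + k) mod m) # t)"

definition mul :: "nat list \<Rightarrow> nat list \<Rightarrow> nat list" where
  "mul l k = foldr push l k"

definition neg :: "nat \<Rightarrow> nat" where
  "neg s = (if s = 0 then 0 else m - s)"

lemma reduced_Nil [simp]: "reduced []"
  by (simp add: reduced_def)

lemma reduced_Cons: "reduced (s # l) \<longleftrightarrow> s < m \<and> reduced l \<and> (l \<noteq> [] \<longrightarrow> (s = 0) \<noteq> (hd l = 0))"
  by (cases l) (auto simp: reduced_def)

lemma reduced_append:
  "reduced (k @ l) \<longleftrightarrow> reduced k \<and> reduced l \<and> (k \<noteq> [] \<longrightarrow> l \<noteq> [] \<longrightarrow> (last k = 0) \<noteq> (hd l = 0))"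
  by (auto simp: reduced_def successively_append_iff)

lemma reduced_rev [simp]: "reduced (rev l) \<longleftrightarrow> reduced l"
proof -
  have "(\<lambda>x y. (y = 0) \<noteq> (x = 0)) = (\<lambda>s t. (s = (0::nat)) \<noteq> (t = (0::nat)))" by (intro ext) auto
  then show ?thesis by (simp only: reduced_def successively_rev set_rev)
qed

lemma m_pos [simp]: "0 < m" "m \<noteq> 0" "1 < m"
  using m_ge by auto

lemma mod_m_less [simp]: "a mod m < m"
  by simp

lemma neg_less [simp]: "s < m \<Longrightarrow> neg s < m"
  by (auto simp: neg_def)

lemma neg_eq_0 [simp]: "s < m \<Longrightarrow> neg s = 0 \<longleftrightarrow> s = 0"
  by (auto simp: neg_def)

lemma neg_neg [simp]: "s < m \<Longrightarrow> neg (neg s) = s"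
  by (auto simp: neg_def)

lemma neg_add [simp]: "s < m \<Longrightarrow> (neg s + s) mod m = 0" "s < m \<Longrightarrow> (s + neg s) mod m = 0"
  by (auto simp: neg_def)

lemma neg_0 [simp]: "neg 0 = 0"
  by (simp add: neg_def)

lemma reduced_hd_less: "reduced l \<Longrightarrow> l \<noteq> [] \<Longrightarrow> hd l < m"
  by (cases l) (auto simp: reduced_Cons)

lemma reduced_map_neg [simp]: "reduced l \<Longrightarrow> reduced (map neg l)"
  by (induction l) (auto simp: reduced_Cons hd_map reduced_hd_less)

lemma map_neg_neg [simp]: "reduced l \<Longrightarrow> map neg (map neg l) = l"
  by (induction l) (auto simp: reduced_Cons)

lemma push_Nil [simp]: "push s [] = [s]"
  by (simp add: push_def)

lemma push_Cons:
  "push s (k # t) = (if (s = 0) \<noteq> (k = 0) then s # k # t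
       else if (s + k) mod m = 0 then t else ((s + k) mod m) # t)"
  by (simp add: push_def)

lemma push_reduced_Cons: "reduced (s # l) \<Longrightarrow> push s l = s # l"
  by (cases l) (auto simp: reduced_Cons push_Cons)

lemma reduced_push [simp]: "s < m \<Longrightarrow> reduced l \<Longrightarrow> reduced (push s l)"
  by (cases l) (auto simp: push_Cons reduced_Cons)

lemma push_push:
  assumes "s < m" "k < m" "reduced l" "(s = 0) = (k = 0)"
  shows "push s (push k l) = (if (s + k) mod m = 0 then l else push ((s + k) mod m) l)"
proof (cases l)
  case Nil
  then show ?thesis using assms by (simp add: push_Cons)
next
  case (Cons f t)
  show ?thesis
  proof (cases "(k = 0) = (f = 0)")
    case False
    then show ?thesis using Cons assms by (auto simp: push_Cons)
  next
    case same: True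
    have f: "f < m" "reduced t" "t \<noteq> [] \<Longrightarrow> (f = 0) \<noteq> (hd t = 0)"
      using Cons assms by (auto simp: reduced_Cons)
    have st: "push s t = s # t"
      using f same assms by (intro push_reduced_Cons) (auto simp: reduced_Cons)
    show ?thesis
    proof (cases "k = 0")
      case True
      then show ?thesis using Cons assms same st by (simp add: push_Cons)
    next
      case False
      then have pos: "s \<noteq> 0" "f \<noteq> 0" using assms same by auto
      have assoc: "((s + k) mod m + f) mod m = (s + (k + f) mod m) mod m"
        by (simp add: mod_simps add.assoc)
      show ?thesis
      proof (cases "(k + f) mod m = 0")
        case True
        then have "((s + k) mod m + f) mod m = s" using assoc assms by simp
        moreover have "s = f" if "(s + k) mod m = 0" using that calculation f by simp
        ultimately show ?thesis using Cons True same False pos st by (auto simp: push_Cons)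
      next
        case kf: False
        have *: "(s + (k + f) mod m) mod m = f" if "(s + k) mod m = 0"
          using that assoc f by simp
        show ?thesis using Cons kf same False pos assoc * by (auto simp: push_Cons)
      qed
    qed
  qed
qed

lemma push_neg [simp]: "s < m \<Longrightarrow> reduced l \<Longrightarrow> push (neg s) (push s l) = l"
  "s < m \<Longrightarrow> reduced l \<Longrightarrow> push s (push (neg s) l) = l"
  by (simp_all add: push_push)

lemma mul_simps [simp]: "mul [] l = l" "mul (s # k) l = push s (mul k l)"
  by (simp_all add: mul_def)

lemma mul_append: "mul (k @ k') l = mul k (mul k' l)"
  by (simp add: mul_def)

lemma reduced_mul': "(\<forall>s\<in>set k. s < m) \<Longrightarrow> reduced l \<Longrightarrow> reduced (mul k l)"
  by (induction k) auto

lemma reduced_mul [simp]: "reduced k \<Longrightarrow> reduced l \<Longrightarrow> reduced (mul k l)"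
  by (rule reduced_mul') (simp_all add: reduced_def)

text \<open>Associativity without comparing normal forms: by \<open>push_push\<close> the syllables act on normal forms as in
  their cyclic factors, and therefore left multiplication by a syllable commutes with right
  multiplication by a normal form.\<close>

lemma mul_push: "s < m \<Longrightarrow> reduced k \<Longrightarrow> reduced l \<Longrightarrow> mul (push s k) l = push s (mul k l)"
  by (cases k) (auto simp: push_Cons push_push reduced_Cons)

lemma mul_assoc: "reduced j \<Longrightarrow> reduced k \<Longrightarrow> reduced l \<Longrightarrow> mul (mul j k) l = mul j (mul k l)"
  by (induction j) (auto simp: reduced_Cons mul_push)

lemma mul_reduced_append: "reduced (k @ l) \<Longrightarrow> mul k l = k @ l"
  by (induction k) (auto simp: reduced_Cons push_reduced_Cons)

lemma mul_Nil [simp]: "reduced k \<Longrightarrow> mul k [] = k"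
  using mul_reduced_append[of k "[]"] by simp

lemma mul_inverse_left [simp]: "reduced l \<Longrightarrow> mul (rev (map neg l)) l = []"
proof (induction l)
  case (Cons s l)
  then have "push (neg s) (s # l) = l" by (simp add: reduced_Cons push_Cons)
  with Cons show ?case by (simp add: reduced_Cons mul_append)
qed simp

lemma map_neg_push:
  assumes "s < m" "reduced l"
  shows "map neg (push s l) = push (neg s) (map neg l)"
proof (cases l)
  case (Cons k t)
  then have k: "k < m" using assms by (simp add: reduced_Cons)
  show ?thesis
  proof (cases "s \<noteq> 0 \<and> k \<noteq> 0")
    case False
    then show ?thesis using Cons k assms by (auto simp: push_Cons neg_def)
  next
    case True
    then consider "s + k < m" | "s + k = m" | "s + k > m" by linarith
    then show ?thesis
    proof cases
      case 1
      have "(m - s + (m - k)) mod m = (m - (s + k) + m) mod m" using 1 by simp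
      also have "\<dots> = (m - (s + k)) mod m" by (rule mod_add_self2)
      also have "\<dots> = m - (s + k)" using True 1 by (intro mod_less) simp
      finally show ?thesis using Cons True 1 k assms by (auto simp: push_Cons neg_def)
    next
      case 2
      then have "m - s + (m - k) = m" by simp
      then show ?thesis using Cons True 2 k assms by (auto simp: push_Cons neg_def)
    next
      case 3
      have "(s + k) mod m = (s + k - m) mod m" using 3 by (simp add: le_mod_geq)
      then have "(s + k) mod m = s + k - m" "s + k - m \<noteq> 0" using k assms 3 by auto
      moreover have "m - s + (m - k) < m" using 3 k assms by linarith
      moreover have "m - (s + k - m) = m - s + (m - k)" using 3 k assms by linarith
      ultimately show ?thesis using Cons True 3 k assms by (auto simp: push_Cons neg_def)
    qed
  qed
qed simp

lemma map_neg_mul: "reduced k \<Longrightarrow> reduced l \<Longrightarrow> map neg (mul k l) = mul (map neg k) (map neg l)"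
  by (induction k) (auto simp: reduced_Cons map_neg_push)

text \<open>The degree of a normal form, with degree \<open>m\<close> for \<open>x\<close> and \<open>2\<close> for \<open>y\<close>. It is additive
  only modulo \<open>2 m\<close>.\<close>

definition dg :: "nat list \<Rightarrow> int" where
  "dg l = (\<Sum>s\<leftarrow>l. if s = 0 then int m else 2 * int s)"

lemma dg_simps [simp]: "dg [] = 0" "dg (s # l) = (if s = 0 then int m else 2 * int s) + dg l"
  "dg (k @ l) = dg k + dg l"
  by (simp_all add: dg_def)

lemma dg_push:
  assumes "s < m" "reduced l"
  shows "2 * int m dvd dg (push s l) - dg (s # l)"
proof (cases l)
  case (Cons k t)
  then have k: "k < m" using assms by (simp add: reduced_Cons)
  show ?thesis
  proof (cases "s \<noteq> 0 \<and> k \<noteq> 0")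
    case False
    then show ?thesis using Cons by (auto simp: push_Cons)
  next
    case True
    show ?thesis
    proof (cases "s + k < m")
      case True
      then show ?thesis using Cons \<open>s \<noteq> 0 \<and> k \<noteq> 0\<close> by (auto simp: push_Cons)
    next
      case False
      then have "(s + k) mod m = s + k - m" using assms k by (simp add: le_mod_geq)
      then have "dg (push s l) - dg (s # l) = - (2 * int m)"
        using Cons True False by (auto simp: push_Cons of_nat_diff)
      then show ?thesis by simp
    qed
  qed
qed simp

lemma dg_mul: "reduced k \<Longrightarrow> reduced l \<Longrightarrow> 2 * int m dvd dg (mul k l) - (dg k + dg l)"
proof (induction k)
  case (Cons s k)
  then have "2 * int m dvd dg (push s (mul k l)) - dg (s # mul k l)"
    by (intro dg_push) (auto simp: reduced_Cons)
  from dvd_add[OF this Cons.IH] Cons.prems show ?case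
    by (simp add: reduced_Cons algebra_simps)
qed simp

lemma dg_map_neg: "reduced l \<Longrightarrow> 2 * int m dvd dg (map neg l) + dg l"
proof (induction l)
  case (Cons s l)
  have "2 * int m dvd dg [neg s] + dg [s]"
    using Cons.prems by (auto simp: neg_def of_nat_diff reduced_Cons)
  from dvd_add[OF this Cons.IH] Cons.prems show ?case
    by (simp add: reduced_Cons algebra_simps)
qed simp

lemma dg_rev [simp]: "dg (rev l) = dg l"
  by (induction l) simp_all

section \<open>The central extension and its inversion\<close>

text \<open>A triple \<open>(l, d, e)\<close> consists of a normal form, an integral degree, and a flag that records the factor
  \<open>t\<close>. Moving \<open>t\<close> to the right past an element of \<open>N\<close> inverts all syllables and the degree.\<close>

type_synonym elt = "nat list \<times> int \<times> bool"

definition flip :: "bool \<Rightarrow> nat list \<Rightarrow> nat list" where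
  "flip e l = (if e then map neg l else l)"

definition sg :: "bool \<Rightarrow> int" where "sg e = (if e then - 1 else 1)"

definition emul :: "elt \<Rightarrow> elt \<Rightarrow> elt" where
  "emul p q = (mul (fst p) (flip (snd (snd p)) (fst q)),
     fst (snd p) + sg (snd (snd p)) * fst (snd q), snd (snd p) \<noteq> snd (snd q))"

definition einv :: "elt \<Rightarrow> elt" where
  "einv p = (flip (snd (snd p)) (rev (map neg (fst p))),
     - sg (snd (snd p)) * fst (snd p), snd (snd p))"

text \<open>In the product of the free product with the integers, extended by \<open>t\<close>, the congruence singles out
  the extension of \<open>N\<close>: the quotient of \<open>d - dg l\<close> by \<open>2 m\<close> is the exponent of \<open>z\<close>.\<close>

definition EG :: "elt monoid" where
  "EG = \<lparr>carrier = {(l, d, e). reduced l \<and> 2 * int m dvd d - dg l},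
         monoid.mult = emul, one = ([], 0, False)\<rparr>"

lemma EG_simps [simp]:
  "(l, d, e) \<in> carrier EG \<longleftrightarrow> reduced l \<and> 2 * int m dvd d - dg l"
  "p \<otimes>\<^bsub>EG\<^esub> q = emul p q" "\<one>\<^bsub>EG\<^esub> = ([], 0, False)"
  by (auto simp: EG_def)

lemma reduced_flip [simp]: "reduced l \<Longrightarrow> reduced (flip e l)"
  by (simp add: flip_def)

lemma flip_flip [simp]: "reduced l \<Longrightarrow> flip e (flip f l) = flip (e \<noteq> f) l"
  by (auto simp: flip_def simp del: map_map)

lemma flip_mul: "reduced k \<Longrightarrow> reduced l \<Longrightarrow> flip e (mul k l) = mul (flip e k) (flip e l)"
  by (simp add: flip_def map_neg_mul)

lemma flip_Nil [simp]: "flip e [] = []"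
  by (simp add: flip_def)

lemma flip_False [simp]: "flip False l = l"
  by (simp add: flip_def)

lemma dg_flip: "reduced l \<Longrightarrow> 2 * int m dvd dg (flip e l) - sg e * dg l"
  using dg_map_neg[of l] by (auto simp: flip_def sg_def)

lemma emul_closed: "p \<in> carrier EG \<Longrightarrow> q \<in> carrier EG \<Longrightarrow> emul p q \<in> carrier EG"
proof -
  assume "p \<in> carrier EG" "q \<in> carrier EG"
  then obtain l d e l' d' e' where p: "p = (l, d, e)" "reduced l" "2 * int m dvd d - dg l"
      and q: "q = (l', d', e')" "reduced l'" "2 * int m dvd d' - dg l'"
    by (cases p; cases q) auto
  have "2 * int m dvd sg e * (d' - dg l')" using q(3) by (rule dvd_mult)
  from dvd_diff[OF this dg_flip[OF q(2), of e]]
  have "2 * int m dvd sg e * (d' - dg l') - (dg (flip e l') - sg e * dg l')" .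
  from dvd_diff[OF dvd_add[OF p(3) this] dg_mul[OF p(2) reduced_flip[OF q(2)], of e]]
  have "2 * int m dvd (d - dg l) + (sg e * (d' - dg l') - (dg (flip e l') - sg e * dg l'))
      - (dg (mul l (flip e l')) - (dg l + dg (flip e l')))"
    .
  then show ?thesis using p q by (simp add: emul_def algebra_simps)
qed

lemma emul_assoc: "p \<in> carrier EG \<Longrightarrow> q \<in> carrier EG \<Longrightarrow> r \<in> carrier EG
    \<Longrightarrow> emul (emul p q) r = emul p (emul q r)"
  by (auto simp: emul_def EG_def mul_assoc flip_mul sg_def algebra_simps)

lemma einv_closed:
  assumes "p \<in> carrier EG"
  shows "einv p \<in> carrier EG"
proof -
  obtain l d e where p: "p = (l, d, e)" "reduced l" "2 * int m dvd d - dg l"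
    using assms by (cases p) auto
  let ?k = "rev (map neg l)"
  have k: "reduced ?k" using p by (simp del: map_map)
  have 1: "2 * int m dvd sg e * (dg ?k + dg l)"
    using dg_map_neg[OF p(2)] by (simp del: map_map)
  have 2: "2 * int m dvd sg e * (d - dg l)" using p(3) by (rule dvd_mult)
  have "2 * int m dvd 0 - (sg e * (d - dg l)) - (dg (flip e ?k) - sg e * dg ?k)
      - sg e * (dg ?k + dg l)"
    by (rule dvd_diff[OF dvd_diff[OF dvd_diff[OF dvd_0_right 2] dg_flip[OF k]] 1])
  then show ?thesis using p k by (simp add: einv_def algebra_simps)
qed

lemma einv_left: "p \<in> carrier EG \<Longrightarrow> emul (einv p) p = ([], 0, False)"
  by (auto simp: einv_def emul_def EG_def sg_def flip_mul[symmetric])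

lemma group_EG: "group EG"
proof (rule groupI)
  show "\<exists>q\<in>carrier EG. q \<otimes>\<^bsub>EG\<^esub> p = \<one>\<^bsub>EG\<^esub>" if "p \<in> carrier EG" for p
    using that by (intro bexI[of _ "einv p"]) (auto simp: einv_left einv_closed)
qed (auto simp: emul_closed emul_assoc, auto simp: emul_def sg_def)

sublocale EG: group EG
  by (rule group_EG)

lemma inv_EG [simp]: "p \<in> carrier EG \<Longrightarrow> inv\<^bsub>EG\<^esub> p = einv p"
  using EG.inv_equality[of "einv p" p] by (simp add: einv_left einv_closed)

definition NG :: "elt monoid" where
  "NG = EG\<lparr>carrier := {p \<in> carrier EG. \<not> snd (snd p)}\<rparr>"

lemma NG_simps [simp]:
  "carrier NG = {p \<in> carrier EG. \<not> snd (snd p)}" "p \<otimes>\<^bsub>NG\<^esub> q = emul p q" "\<one>\<^bsub>NG\<^esub> = ([], 0, False)"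
  by (auto simp: NG_def EG_def)

lemma subgroup_NG: "subgroup (carrier NG) EG"
proof (rule EG.subgroupI)
  show "carrier NG \<noteq> {}" by (auto intro!: exI[of _ "[]"] exI[of _ 0])
qed (auto simp: emul_closed einv_closed, auto simp: emul_def einv_def)

lemma group_NG: "group NG"
  using EG.subgroup_imp_group[OF subgroup_NG] by (simp add: NG_def)

sublocale NG: group NG
  by (rule group_NG)

lemma inv_NG [simp]: "p \<in> carrier NG \<Longrightarrow> inv\<^bsub>NG\<^esub> p = einv p"
  using EG.m_inv_consistent[OF subgroup_NG] by (simp add: NG_def)

lemma NG_conjugate_closed:
  "e \<in> carrier EG \<Longrightarrow> k \<in> carrier NG \<Longrightarrow> emul (emul e k) (einv e) \<in> carrier NG"
  by (simp add: emul_closed einv_closed) (simp add: emul_def einv_def)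

text \<open>The two case analyses for multiplication from the left and from the right. Multiplication by a
  syllable affects the adjacent syllable only, and only if both belong to the same factor.\<close>

lemma push_cases:
  assumes "s < m" "reduced l"
  obtains "l = [] \<or> (hd l = 0) \<noteq> (s = 0)" "push s l = s # l"
  | f t where "l = f # t" "(f = 0) = (s = 0)" "push s l = t"
  | f f' t where "l = f # t" "(f = 0) = (s = 0)" "(f' = 0) = (s = 0)" "push s l = f' # t"
proof (cases l)
  case Nil
  then show ?thesis using that(1) by simp
next
  case (Cons f t)
  then have f: "f < m" using assms by (simp add: reduced_Cons)
  show ?thesis
  proof (cases "(f = 0) = (s = 0)")
    case True
    have "s \<noteq> 0" if "(s + f) mod m \<noteq> 0" using that True by (cases "s = 0") simp_all
    then show ?thesis using that Cons True by (cases "(s + f) mod m = 0") (auto simp: push_Cons)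
  next
    case False
    then show ?thesis using that Cons by (auto simp: push_Cons)
  qed
qed

lemma mul_singleton_cases:
  assumes "s < m" "reduced l"
  obtains "l = [] \<or> (last l = 0) \<noteq> (s = 0)" "mul l [s] = l @ [s]"
  | f u where "l = u @ [f]" "(f = 0) = (s = 0)" "mul l [s] = u"
  | f f' u where "l = u @ [f]" "(f = 0) = (s = 0)" "(f' = 0) = (s = 0)" "mul l [s] = u @ [f']"
proof (cases l rule: rev_cases)
  case Nil
  then show ?thesis using that(1) by simp
next
  case (snoc u f)
  then have f: "f < m" and u: "reduced u" using assms by (simp_all add: reduced_append reduced_Cons)
  have *: "mul l [s] = mul u (push f [s])" using snoc by (simp add: mul_append)
  show ?thesis
  proof (cases "(f = 0) = (s = 0)")
    case False
    then have "reduced (l @ [s])" using assms snoc by (simp add: reduced_append reduced_Cons)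
    then have "mul l [s] = l @ [s]" by (rule mul_reduced_append)
    then show ?thesis using that(1) False snoc by simp
  next
    case True
    show ?thesis
    proof (cases "(f + s) mod m = 0")
      case 0: True
      then show ?thesis using that(2)[OF snoc True] * True u by (simp add: push_Cons)
    next
      case False
      then have type: "((f + s) mod m = 0) = (s = 0)" "((f + s) mod m = 0) = (f = 0)"
        using True by (cases "s = 0", simp_all)+
      have "reduced (u @ [(f + s) mod m])"
        using assms snoc type by (auto simp: reduced_append reduced_Cons)
      then have "mul l [s] = u @ [(f + s) mod m]"
        using * False True by (simp add: push_Cons mul_reduced_append)
      then show ?thesis by (rule that(3)[OF snoc True type(1)])
    qed
  qed
qed

section \<open>Twisted conjugation by syllables\<close>

text \<open>This is \<open>s n \<psi>(s)^-1\<close>, where \<open>\<psi>\<close> is the inversion if \<open>e\<close> holds and the identity otherwise.\<close>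

definition cstep :: "bool \<Rightarrow> nat \<Rightarrow> nat list \<Rightarrow> nat list" where
  "cstep e s n = mul (push s n) [if e then s else neg s]"

lemma reduced_singleton [simp]: "reduced [s] \<longleftrightarrow> s < m"
  by (simp add: reduced_Cons)

lemma reduced_cstep [simp]: "s < m \<Longrightarrow> reduced n \<Longrightarrow> reduced (cstep e s n)"
  by (simp add: cstep_def)

text \<open>A cancellation on one side would offset the gain on the other. So on either side the syllable is
  attached to \<open>n\<close> or merges with a syllable of its own factor, and in both cases that end of the
  result lies in the factor of \<open>s\<close>.\<close>

lemma cstep_peak:
  assumes "s < m" "reduced n" "length n < length (cstep e s n)"
  shows "cstep e s n \<noteq> []" "(hd (cstep e s n) = 0) = (s = 0)" "(last (cstep e s n) = 0) = (s = 0)"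
proof -
  define t where "t = (if e then s else neg s)"
  have t: "t < m" "(t = 0) = (s = 0)" using assms by (auto simp: t_def)
  define p where "p = push s n"
  define q where "q = mul p [t]"
  have c: "cstep e s n = q" by (simp add: cstep_def t_def q_def p_def)
  have "reduced p" using assms by (simp add: p_def)
  note right = mul_singleton_cases[OF t(1) this, folded q_def]
  note left = push_cases[OF assms(1,2), folded p_def]
  have "q \<noteq> [] \<and> (hd q = 0) = (s = 0) \<and> (last q = 0) = (s = 0)"
    by (insert assms(3)[unfolded c], rule left; rule right)
      (auto simp: t(2) hd_append Cons_eq_append_conv append_eq_Cons_conv)
  then show "cstep e s n \<noteq> []" "(hd (cstep e s n) = 0) = (s = 0)" "(last (cstep e s n) = 0) = (s = 0)"
    by (auto simp: c)
qed

lemma cstep_grows: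
  assumes "s < m" "reduced n" "n \<noteq> []" "(hd n = 0) \<noteq> (s = 0)" "(last n = 0) \<noteq> (s = 0)"
  shows "length n < length (cstep e s n)"
proof -
  define t where "t = (if e then s else neg s)"
  have t: "t < m" "(t = 0) = (s = 0)" using assms by (auto simp: t_def)
  have "push s n = s # n" using assms by (cases n) (auto simp: push_Cons)
  moreover have "reduced (s # n @ [t])"
    using assms t by (auto simp: reduced_Cons reduced_append)
  ultimately have "cstep e s n = s # n @ [t]"
    using mul_reduced_append[of "s # n" "[t]"] by (simp add: cstep_def t_def)
  then show ?thesis by simp
qed

lemma foldr_cstep_reduced [simp]:
  "(\<forall>s\<in>set ks. s < m) \<Longrightarrow> reduced n \<Longrightarrow> reduced (foldr (cstep e) ks n)"
  by (induction ks) auto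

text \<open>The last letter of \<open>ks\<close> acts first. By \<open>cstep_peak\<close> and \<open>cstep_grows\<close>, once a step increases the
  length all later steps do, because consecutive syllables of \<open>ks\<close> lie in different factors. The
  induction records in which of the two phases the walk is.\<close>

lemma conjugation_no_peak':
  assumes "reduced ks" "reduced n"
  shows "(\<forall>i\<le>length ks. length (foldr (cstep e) (drop i ks) n) \<le> length n) \<or>
    (\<exists>s k. ks = s # k \<and> length (foldr (cstep e) k n) < length (foldr (cstep e) ks n) \<and>
      (\<forall>i\<le>length ks. length (foldr (cstep e) (drop i ks) n)
         \<le> max (length n) (length (foldr (cstep e) ks n))))"
  using assms(1)
proof (induction ks)
  case (Cons t k)
  let ?f = "\<lambda>k. foldr (cstep e) k n"
  have k: "reduced k" "t < m" and sk: "\<forall>s\<in>set k. s < m"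
    using Cons.prems by (auto simp: reduced_Cons) (auto simp: reduced_def)
  have split: "(\<forall>i\<le>length (t # k). P (drop i (t # k))) \<longleftrightarrow> P (t # k) \<and> (\<forall>i\<le>length k. P (drop i k))"
    for P :: "nat list \<Rightarrow> bool"
    by (auto simp: All_less_Suc2 simp flip: less_Suc_eq_le)
  from Cons.IH[OF k(1)] show ?case
  proof (elim disjE exE conjE)
    assume *: "\<forall>i\<le>length k. length (?f (drop i k)) \<le> length n"
    then have "length (?f k) \<le> length n" by (metis drop0 le0)
    show ?thesis
    proof (cases "length (?f (t # k)) \<le> length n")
      case True
      then show ?thesis using * unfolding split[where P = "\<lambda>k. length (?f k) \<le> length n"] by blast
    next
      case False
      then have "length (?f k) < length (?f (t # k))" using \<open>length (?f k) \<le> length n\<close> by linarith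
      moreover have "\<forall>i\<le>length (t # k). length (?f (drop i (t # k)))
          \<le> max (length n) (length (?f (t # k)))"
        unfolding split[where P = "\<lambda>l. length (?f l) \<le> max (length n) (length (?f (t # k)))"]
        using * by (meson le_max_iff_disj order_refl)
      ultimately show ?thesis by blast
    qed
  next
    fix s k' assume k': "k = s # k'" and less: "length (?f k') < length (?f k)"
      and *: "\<forall>i\<le>length k. length (?f (drop i k)) \<le> max (length n) (length (?f k))"
    have s: "s < m" "(s = 0) \<noteq> (t = 0)" and red: "reduced (?f k')"
      using Cons.prems k' sk assms by (auto simp: reduced_Cons)
    have fk: "?f k = cstep e s (?f k')" using k' by simp
    note peak = cstep_peak[OF s(1) red less[unfolded fk], folded fk]
    have "reduced (?f k)" using sk assms by simp
    have "length (?f k) < length (cstep e t (?f k))"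
      using s(2) peak by (intro cstep_grows[OF k(2) \<open>reduced (?f k)\<close>]) auto
    then have less': "length (?f k) < length (?f (t # k))" by simp
    moreover have "\<forall>i\<le>length (t # k). length (?f (drop i (t # k)))
          \<le> max (length n) (length (?f (t # k)))"
      unfolding split[where P = "\<lambda>l. length (?f l) \<le> max (length n) (length (?f (t # k)))"]
    proof safe
      fix i assume "i \<le> length k"
      then have "length (?f (drop i k)) \<le> max (length n) (length (?f k))" using * by blast
      then show "length (?f (drop i k)) \<le> max (length n) (length (?f (t # k)))"
        using less' by linarith
    qed simp
    ultimately show ?thesis by blast
  qed
qed simp

lemma conjugation_no_peak:
  assumes "reduced ks" "reduced n" "i \<le> length ks"
  shows "length (foldr (cstep e) (drop i ks) n) \<le> max (length n) (length (foldr (cstep e) ks n))"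
  using conjugation_no_peak'[OF assms(1,2), of e] assms(3)
  by (meson le_max_iff_disj)

section \<open>Short conjugators\<close>

text \<open>The square of a bound for the number of pairs of a normal form of length at most \<open>L\<close> and a degree
  modulo \<open>2 m\<close>, hence a bound for the number of edges of any graph on these pairs.\<close>

definition conjugator_bound :: "nat \<Rightarrow> nat" where
  "conjugator_bound L = (Suc L * m ^ L * (2 * m)) ^ 2"

text \<open>The walk from \<open>n\<close> under the suffixes of \<open>ks\<close> stays in a finite graph by \<open>conjugation_no_peak\<close>. A
  walk with the same ends and at most as many steps as there are edges yields \<open>js\<close>. The degree modulo
  \<open>2 m\<close> is part of a vertex because conjugating an element that involves \<open>t\<close> by \<open>k\<close> changes its degree
  by twice the degree of \<open>k\<close>.\<close>

lemma short_conjugator: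
  fixes e :: bool
  assumes n: "reduced n" and ks: "reduced ks"
  defines "L \<equiv> max (length n) (length (foldr (cstep e) ks n))"
  obtains js where "length js \<le> conjugator_bound L" "\<forall>s\<in>set js. s < m"
    "foldr (cstep e) js n = foldr (cstep e) ks n" "2 * int m dvd dg js - dg ks"
proof -
  define S where "S = {l. set l \<subseteq> {..<m} \<and> length l \<le> L} \<times> {0..<2 * int m}"
  define R where "R = {((l, c), (cstep e s l, (dg [s] + c) mod (2 * int m))) | l c s. s < m} \<inter> S \<times> S"
  have "card S \<le> Suc L * m ^ L * (2 * m)"
  proof -
    have "card {l. set l \<subseteq> {..<m} \<and> length l \<le> L} = (\<Sum>i\<le>L. m ^ i)"
      by (subst card_lists_length_le) auto
    also have "\<dots> \<le> (\<Sum>i\<le>L. m ^ L)" by (intro sum_mono power_increasing) (auto simp: Suc_le_eq)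
    finally show ?thesis unfolding S_def card_cartesian_product by (intro mult_mono) auto
  qed
  moreover have "finite S" unfolding S_def by (intro finite_cartesian_product finite_lists_length_le) auto
  then have fin: "finite R" and "card R \<le> card S * card S"
    unfolding R_def by (auto intro!: card_mono[of "S \<times> S", unfolded card_cartesian_product])
  ultimately have card: "card R \<le> conjugator_bound L"
    unfolding conjugator_bound_def power2_eq_square by (meson mult_le_mono order_trans)
  define st where "st k = (foldr (cstep e) k n, dg k mod (2 * int m))" for k
  have ks_less: "\<forall>s\<in>set ks. s < m" using ks by (simp add: reduced_def)
  have st_Cons: "st (s # k) = (cstep e s (fst (st k)), (dg [s] + snd (st k)) mod (2 * int m))" for s k
    by (simp add: st_def mod_add_right_eq)
  have suffix: "(st [], st (drop (length ks - i) ks)) \<in> R\<^sup>*" if "i \<le> length ks" for i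
    using that
  proof (induction i)
    case (Suc i)
    define j where "j = length ks - Suc i"
    have j: "j < length ks" "length ks - i = Suc j" using Suc.prems by (auto simp: j_def)
    have drop: "drop j ks = ks ! j # drop (Suc j) ks" using j by (simp add: Cons_nth_drop_Suc)
    have inS: "st (drop i' ks) \<in> S" if "i' \<le> length ks" for i'
    proof -
      have "\<forall>s\<in>set (drop i' ks). s < m" using ks_less by (meson in_set_dropD)
      then have "reduced (foldr (cstep e) (drop i' ks) n)" using n by simp
      then show ?thesis
        using conjugation_no_peak[OF ks n that, of e] by (auto simp: st_def S_def L_def reduced_def)
    qed
    have "ks ! j < m" using ks_less j by simp
    then have "(st (drop (Suc j) ks), st (drop j ks)) \<in>
        {((l, c), (cstep e s l, (dg [s] + c) mod (2 * int m))) | l c s. s < m}"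
      unfolding drop st_Cons
      by (intro CollectI exI[of _ "fst (st (drop (Suc j) ks))"] exI[of _ "snd (st (drop (Suc j) ks))"]
          exI[of _ "ks ! j"]) simp
    then have "(st (drop (Suc j) ks), st (drop j ks)) \<in> R"
      using inS[of j] inS[of "Suc j"] j by (simp add: R_def)
    with Suc.IH Suc.prems j show ?case by (simp add: j_def)
  qed (simp add: st_def)
  from this[of "length ks"] have "(st [], st ks) \<in> R\<^sup>*" by simp
  then obtain i where i: "i \<le> card R" "(st [], st ks) \<in> R ^^ i"
    using rtrancl_finite_eq_relpow[OF fin] by auto
  have "\<exists>js. length js = i \<and> (\<forall>s\<in>set js. s < m) \<and> st js = q" if "(st [], q) \<in> R ^^ i" for q
    using that
  proof (induction i arbitrary: q)
    case (Suc i)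
    then obtain q' where q': "(st [], q') \<in> R ^^ i" "(q', q) \<in> R" by auto
    from Suc.IH[OF q'(1)] obtain js where js: "length js = i" "\<forall>s\<in>set js. s < m" "st js = q'" by auto
    from q'(2) obtain s where "s < m" "q = (cstep e s (fst q'), (dg [s] + snd q') mod (2 * int m))"
      by (auto simp: R_def)
    with js show ?case by (intro exI[of _ "s # js"]) (simp only: st_Cons list.size set_simps, auto)
  qed auto
  from this[OF i(2)] obtain js where js: "length js = i" "\<forall>s\<in>set js. s < m" "st js = st ks" by blast
  moreover have "2 * int m dvd dg js - dg ks"
    using js(3) by (simp add: st_def mod_eq_dvd_iff)
  ultimately show thesis using that[of js] i(1) card by (simp add: st_def)
qed

section \<open>Conjugation by elements of the central extension\<close>

definition syl :: "nat \<Rightarrow> elt" where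
  "syl s = ([s], dg [s], False)"

definition conj_by :: "elt \<Rightarrow> elt \<Rightarrow> elt" where
  "conj_by k p = emul (emul k p) (einv k)"

definition NG_conjugate :: "elt \<Rightarrow> elt \<Rightarrow> bool" where
  "NG_conjugate p q \<longleftrightarrow> (\<exists>k\<in>carrier NG. q = conj_by k p)"

lemma syl_closed: "s < m \<Longrightarrow> syl s \<in> carrier NG"
  by (simp add: syl_def)

lemma conj_by_NG:
  "reduced n \<Longrightarrow> reduced l \<Longrightarrow>
   conj_by (l, c, False) (n, d, e)
     = (mul (mul l n) (flip e (rev (map neg l))), d + (1 - sg e) * c, e)"
  by (auto simp: conj_by_def emul_def einv_def sg_def)

lemma conj_by_mult: "k \<in> carrier EG \<Longrightarrow> l \<in> carrier EG \<Longrightarrow> p \<in> carrier EG \<Longrightarrow>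
   conj_by (emul k l) p = conj_by k (conj_by l p)"
  using EG.inv_mult_group[of k l]
  by (simp add: conj_by_def emul_assoc emul_closed einv_closed)

lemma conj_by_closed: "k \<in> carrier EG \<Longrightarrow> p \<in> carrier EG \<Longrightarrow> conj_by k p \<in> carrier EG"
  by (simp add: conj_by_def emul_closed einv_closed)

lemma conj_by_syl: "s < m \<Longrightarrow> reduced n \<Longrightarrow>
    conj_by (syl s) (n, d, e) = (cstep e s n, d + (1 - sg e) * dg [s], e)"
  by (simp add: syl_def conj_by_NG cstep_def) (simp add: flip_def)

text \<open>The iterated steps are conjugation by an actual element of \<open>N\<close>, the product of the syllables;
  for a reduced list this product is the list itself.\<close>

lemma conj_by_syllables:
  assumes "\<forall>s\<in>set ks. s < m" "(n, d, e) \<in> carrier EG"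
  obtains k where "k \<in> carrier NG" "conj_by k (n, d, e) = (foldr (cstep e) ks n, d + (1 - sg e) * dg ks, e)"
    and "reduced ks \<Longrightarrow> k = (ks, dg ks, False)"
proof -
  have "\<exists>k\<in>carrier NG. conj_by k (n, d, e) = (foldr (cstep e) ks n, d + (1 - sg e) * dg ks, e)
      \<and> (reduced ks \<longrightarrow> k = (ks, dg ks, False))"
    using assms(1)
  proof (induction ks)
    case Nil
    show ?case
      using assms by (intro bexI[of _ "([], 0, False)"]) (auto simp: conj_by_NG)
  next
    case (Cons s ks)
    then obtain k where k: "k \<in> carrier NG" "reduced ks \<longrightarrow> k = (ks, dg ks, False)"
        "conj_by k (n, d, e) = (foldr (cstep e) ks n, d + (1 - sg e) * dg ks, e)"
      by auto
    have s: "syl s \<in> carrier NG" using Cons.prems by (intro syl_closed) simp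
    have red: "reduced (foldr (cstep e) ks n)" using Cons.prems assms by simp
    have "conj_by (emul (syl s) k) (n, d, e) =
        (foldr (cstep e) (s # ks) n, d + (1 - sg e) * dg (s # ks), e)"
      using s k assms Cons.prems red
      by (simp add: conj_by_mult conj_by_syl algebra_simps del: dg_simps(2))
        (simp add: algebra_simps)
    moreover have "emul (syl s) k \<in> carrier NG" using s k(1) NG.m_closed by simp
    moreover have "emul (syl s) k = (s # ks, dg (s # ks), False)" if "reduced (s # ks)"
      using that k(2) by (auto simp: syl_def emul_def sg_def reduced_Cons push_reduced_Cons)
    ultimately show ?case by blast
  qed
  then show thesis using that by blast
qed

lemma central_NG: "([], 2 * int m * j, False) \<in> carrier NG"
  by simp

text \<open>The degree of the conjugating element can be corrected by a power of the centre. If \<open>e\<close> holds,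
  conjugation by \<open>z^j\<close> changes the degree by \<open>4 m j\<close> and nothing else.\<close>

lemma NG_conjugateI:
  assumes "(n, d, e) \<in> carrier EG" "\<forall>s\<in>set ks. s < m" "foldr (cstep e) ks n = n'"
    and "if e then 4 * int m dvd d' - d - 2 * dg ks else d = d'"
  shows "NG_conjugate (n, d, e) (n', d', e)"
proof -
  obtain k where k: "k \<in> carrier NG" "conj_by k (n, d, e) = (n', d + (1 - sg e) * dg ks, e)"
    using conj_by_syllables[OF assms(2,1)] assms(3) by metis
  obtain j where j: "d' = d + (1 - sg e) * (dg ks + 2 * int m * j)"
  proof (cases e)
    case True
    then obtain j where "d' - d - 2 * dg ks = 4 * int m * j" using assms(4) by (auto simp: dvd_def)
    then show thesis using True by (intro that[of j]) (simp add: sg_def algebra_simps)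
  next
    case False
    then show thesis using assms(4) by (intro that[of 0]) (simp add: sg_def)
  qed
  have "reduced n'" using assms by auto
  then have "conj_by (emul ([], 2 * int m * j, False) k) (n, d, e) = (n', d', e)"
    using k assms(1) central_NG[of j] j
    by (simp add: conj_by_mult conj_by_NG) (simp add: algebra_simps)
  moreover have "emul ([], 2 * int m * j, False) k \<in> carrier NG"
    using NG.m_closed[OF central_NG k(1)] by simp
  ultimately show ?thesis unfolding NG_conjugate_def by metis
qed

lemma NG_conjugate_iff:
  assumes "(n, d, e) \<in> carrier EG" "(n', d', e') \<in> carrier EG"
  shows "NG_conjugate (n, d, e) (n', d', e') \<longleftrightarrow> e = e' \<and>
    (\<exists>ks. length ks \<le> conjugator_bound (max (length n) (length n')) \<and> (\<forall>s\<in>set ks. s < m) \<and>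
       foldr (cstep e) ks n = n' \<and>
       (if e then 4 * int m dvd d' - d - 2 * dg ks else d = d'))"
    (is "?L \<longleftrightarrow> e = e' \<and> (\<exists>ks. ?B ks)")
proof
  have n: "reduced n" "reduced n'" using assms by simp_all
  {
    assume ?L
    then obtain l c where k: "(l, c, False) \<in> carrier NG"
        and eq: "(n', d', e') = conj_by (l, c, False) (n, d, e)"
      unfolding NG_conjugate_def by auto
    have l: "reduced l" "\<forall>s\<in>set l. s < m" "2 * int m dvd c - dg l"
      using k by (simp_all, auto simp: reduced_def)
    obtain k' where "conj_by k' (n, d, e) = (foldr (cstep e) l n, d + (1 - sg e) * dg l, e)"
        "k' = (l, dg l, False)"
      using conj_by_syllables[OF l(2) assms(1)] l(1) by metis
    then have fold: "n' = foldr (cstep e) l n" and d': "d' = d + (1 - sg e) * c" and e: "e = e'"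
      using eq l n by (simp_all add: conj_by_NG)
    obtain ks where ks: "length ks \<le> conjugator_bound (max (length n) (length n'))" "\<forall>s\<in>set ks. s < m"
        "foldr (cstep e) ks n = n'" "2 * int m dvd dg ks - dg l"
      using short_conjugator[OF n(1) l(1), of e] unfolding fold by blast
    have "4 * int m dvd d' - d - 2 * dg ks" if e
    proof -
      have "d' - d - 2 * dg ks = 2 * ((c - dg l) - (dg ks - dg l))"
        using d' that by (simp add: sg_def)
      moreover have "2 * int m dvd (c - dg l) - (dg ks - dg l)"
        using l(3) ks(4) by (rule dvd_diff)
      then have "2 * (2 * int m) dvd 2 * ((c - dg l) - (dg ks - dg l))"
        by (rule mult_dvd_mono[OF dvd_refl])
      ultimately show ?thesis by simp
    qed
    then show "e = e' \<and> (\<exists>ks. ?B ks)" using e d' ks by (auto simp: sg_def)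
  next
    assume "e = e' \<and> (\<exists>ks. ?B ks)"
    then obtain ks where e: "e = e'" and ks: "\<forall>s\<in>set ks. s < m" "foldr (cstep e) ks n = n'"
        "if e then 4 * int m dvd d' - d - 2 * dg ks else d = d'" by auto
    then show ?L using NG_conjugateI[OF assms(1) ks] by simp
  }
qed

end

section \<open>A program for conjugation in the extended group\<close>

lemma computable_2_mult:
  fixes f :: "'a::coded \<Rightarrow> int"
  shows "computable_on A f \<Longrightarrow> computable_on A (\<lambda>x. 2 * f x)"
  using computable_int_add[of A f f] by (simp flip: mult_2)

lemma computable_apply: "computable h \<Longrightarrow> computable_on A f \<Longrightarrow> computable_on A (\<lambda>x. h (f x))"
  by (rule computable_on_compose) auto

text \<open>Turns the bound on the number of syllables into a bound on codes, so that the search for a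
  conjugating element becomes a bounded quantifier over natural numbers.\<close>

definition list_code_bound :: "nat \<Rightarrow> nat \<Rightarrow> nat" where
  "list_code_bound b n = rec_nat 1 (\<lambda>_ y. Suc (prod_encode (b, y))) n"

lemma prod_encode_strict_mono: "a \<le> a' \<Longrightarrow> b < b' \<Longrightarrow> prod_encode (a, b) < prod_encode (a', b')"
proof -
  assume "a \<le> a'" "b < b'"
  then have "Suc (a + b) \<le> a' + b'" by simp
  then have "triangle (Suc (a + b)) \<le> triangle (a' + b')" by (rule triangle_mono)
  then show ?thesis by (simp add: prod_encode_def)
qed

lemma list_encode_less:
  "(\<forall>s\<in>set l. s < b) \<Longrightarrow> length l \<le> n \<Longrightarrow> list_encode l < list_code_bound b n"
proof (induction n arbitrary: l)
  case (Suc n)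
  show ?case
  proof (cases l)
    case Nil
    then show ?thesis by (simp add: list_code_bound_def)
  next
    case (Cons s k)
    then have "s \<le> b" "list_encode k < list_code_bound b n"
      using Suc.prems Suc.IH[of k] by auto
    then have "prod_encode (s, list_encode k) < prod_encode (b, list_code_bound b n)"
      by (rule prod_encode_strict_mono)
    then show ?thesis using Cons by (simp add: list_code_bound_def)
  qed
qed (simp add: list_code_bound_def)

lemma computable_prod_encode:
  "computable_on A f \<Longrightarrow> computable_on A g \<Longrightarrow> computable_on A (\<lambda>x. prod_encode (f x, g x))"
  using computable_code[OF computable_Pair[of A f g]] by simp

lemma computable_list_code_bound:
  "computable f \<Longrightarrow> computable (\<lambda>x. list_code_bound b (f x))"
  unfolding list_code_bound_def by (intro computable_intros computable_prod_encode)

context odd_dihedral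
begin

lemma computable_push:
  assumes "computable f" "computable g"
  shows "computable (\<lambda>x. push (f x) (g x))"
  unfolding push_def
  by (intro computable_intros computable_apply[OF assms(1)] computable_apply[OF assms(2)])

lemma computable_neg: "computable f \<Longrightarrow> computable (\<lambda>x. neg (f x))"
  unfolding neg_def by (intro computable_intros)

lemma computable_mul:
  assumes "computable f" "computable g"
  shows "computable (\<lambda>x. mul (f x) (g x))"
  unfolding mul_def using assms by (intro computable_intros computable_push)

lemma computable_dg: "computable f \<Longrightarrow> computable (\<lambda>x. dg (f x))"
  unfolding dg_def sum_list.eq_foldr foldr_map comp_def
  by (intro computable_intros computable_2_mult)

lemma computable_flip: "computable f \<Longrightarrow> computable g \<Longrightarrow> computable (\<lambda>x. flip (f x) (g x))"
  unfolding flip_def by (intro computable_intros computable_neg)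

lemma computable_sg_mult:
  "computable f \<Longrightarrow> computable g \<Longrightarrow> computable (\<lambda>x. sg (f x) * g x)"
proof -
  assume "computable f" "computable g"
  then have "computable (\<lambda>x. if f x then - g x else g x)" by (intro computable_intros)
  then show ?thesis by (rule computable_on_cong) (simp add: sg_def)
qed

lemma computable_emul:
  "computable f \<Longrightarrow> computable g \<Longrightarrow> computable (\<lambda>x. emul (f x) (g x))"
  unfolding emul_def by (intro computable_intros computable_mul computable_flip computable_sg_mult)

lemma computable_einv: "computable f \<Longrightarrow> computable (\<lambda>x. einv (f x))"
  unfolding einv_def minus_mult_left[symmetric]
  by (intro computable_intros computable_flip computable_neg computable_sg_mult)

lemma computable_cstep:
  "computable f \<Longrightarrow> computable g \<Longrightarrow> computable h \<Longrightarrow> computable (\<lambda>x. cstep (f x) (g x) (h x))"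
  unfolding cstep_def by (intro computable_intros computable_mul computable_push computable_neg)

definition NG_conjugate_test :: "elt \<Rightarrow> elt \<Rightarrow> bool" where
  "NG_conjugate_test p q \<longleftrightarrow> snd (snd p) = snd (snd q) \<and>
     (\<exists>c. c < list_code_bound m (conjugator_bound (max (length (fst p)) (length (fst q)))) \<and>
       (\<forall>s\<in>set (list_decode c). s < m) \<and>
       foldr (\<lambda>s n. cstep (snd (snd p)) s n) (list_decode c) (fst p) = fst q \<and>
       (if snd (snd p)
        then int (4 * m) dvd fst (snd q) - fst (snd p) - 2 * dg (list_decode c)
        else fst (snd p) = fst (snd q)))"

lemma NG_conjugate_test:
  assumes "p \<in> carrier EG" "q \<in> carrier EG"
  shows "NG_conjugate_test p q \<longleftrightarrow> NG_conjugate p q"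
proof -
  obtain n d e n' d' e' where pq: "p = (n, d, e)" "q = (n', d', e')"
    by (cases p; cases q) auto
  let ?b = "conjugator_bound (max (length n) (length n'))"
  let ?B = "\<lambda>ks. (\<forall>s\<in>set ks. s < m) \<and> foldr (cstep e) ks n = n' \<and>
       (if e then 4 * int m dvd d' - d - 2 * dg ks else d = d')"
  have "NG_conjugate p q" if "NG_conjugate_test p q"
  proof -
    from that obtain c where e: "e = e'" and c: "?B (list_decode c)"
      unfolding NG_conjugate_test_def pq by auto
    define ks where "ks = list_decode c"
    then have ks: "\<forall>s\<in>set ks. s < m" "foldr (cstep e) ks n = n'"
       "if e then 4 * int m dvd d' - d - 2 * dg ks else d = d'" using c by auto
    show ?thesis using NG_conjugateI assms ks e unfolding pq by blast
  qed
  moreover have "NG_conjugate_test p q" if "NG_conjugate p q"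
  proof -
    from that obtain ks where e: "e = e'" and ks: "length ks \<le> ?b" "?B ks"
      using assms NG_conjugate_iff unfolding pq by blast
    show ?thesis
      unfolding NG_conjugate_test_def pq
      using e ks list_encode_less[of ks m ?b] by (auto intro!: exI[of _ "list_encode ks"])
  qed
  ultimately show ?thesis by blast
qed

lemma computable_NG_conjugate_test:
  assumes "computable f" "computable g"
  shows "computable (\<lambda>x. NG_conjugate_test (f x) (g x))"
  unfolding NG_conjugate_test_def conjugator_bound_def
  by (intro computable_intros computable_list_code_bound computable_cstep computable_2_mult
      computable_dg computable_apply[OF assms(1)] computable_apply[OF assms(2)])

section \<open>Induction over the generators\<close>

lemma Suc_0_less_m [simp]: "Suc 0 < m"
  using m_pos(3) by simp

lemma einv_NG: "p \<in> carrier NG \<Longrightarrow> einv p \<in> carrier NG"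
  by (simp add: einv_closed) (simp add: einv_def)

definition xN :: elt where "xN = ([0], int m, False)"
definition yN :: elt where "yN = ([1], 2, False)"

lemma xN_closed [simp]: "xN \<in> carrier NG" and yN_closed [simp]: "yN \<in> carrier NG"
  by (simp_all add: xN_def yN_def)

lemma emul_NG: "emul (l, d, False) (k, c, e) = (mul l k, d + c, e)"
  by (simp add: emul_def sg_def)

lemma fst_emul_NG: "p \<in> carrier NG \<Longrightarrow> fst (emul p q) = mul (fst p) (fst q)"
  by (simp add: emul_def)

lemma NG_carrierE:
  assumes "p \<in> carrier NG"
  obtains l d where "p = (l, d, False)" "reduced l" "2 * int m dvd d - dg l"
  using assms by (cases p) auto

lemma yN_shift: "0 < s \<Longrightarrow> Suc s < m \<Longrightarrow> reduced (Suc s # l) \<Longrightarrow>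
  (Suc s # l, d, False) = emul yN (s # l, d - 2, False)"
  by (auto simp: yN_def emul_NG reduced_Cons push_Cons)

text \<open>The inverse of \<open>x\<close> is needed to reach the negative powers of \<open>z\<close>; the inverse of \<open>y\<close> is not, since
  a syllable in the second factor is a positive power of \<open>y\<close>.\<close>

lemma NG_induct [consumes 1, case_names one x inv_x y]:
  assumes "n \<in> carrier NG" "P ([], 0, False)"
    and x: "\<And>n. n \<in> carrier NG \<Longrightarrow> P n \<Longrightarrow> P (emul xN n)"
    and ix: "\<And>n. n \<in> carrier NG \<Longrightarrow> P n \<Longrightarrow> P (emul (einv xN) n)"
    and y: "\<And>n. n \<in> carrier NG \<Longrightarrow> P n \<Longrightarrow> P (emul yN n)"
  shows "P n"
proof -
  have center: "P ([], 2 * int m * j, False)" for j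
  proof (induction j rule: int_induct[where k = 0])
    case base
    show ?case using assms(2) by simp
  next
    case (step1 j)
    have "emul xN ([], 2 * int m * j, False) \<in> carrier NG"
      using NG.m_closed[OF xN_closed central_NG] by simp
    then have "P (emul xN (emul xN ([], 2 * int m * j, False)))"
      using step1 by (intro x central_NG)
    then show ?case by (simp add: xN_def emul_NG push_Cons algebra_simps)
  next
    case (step2 j)
    have "einv xN \<in> carrier NG" using xN_closed by (rule einv_NG)
    then have "emul (einv xN) ([], 2 * int m * j, False) \<in> carrier NG"
      using NG.m_closed[OF _ central_NG] by simp
    then have "P (emul (einv xN) (emul (einv xN) ([], 2 * int m * j, False)))"
      using step2 by (intro ix central_NG)
    then show ?case by (simp add: xN_def einv_def emul_NG push_Cons sg_def algebra_simps)
  qed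
  have "P (l, d, False)" if "reduced l" "2 * int m dvd d - dg l" for l d
    using that
  proof (induction l arbitrary: d)
    case Nil
    then show ?case using center by (auto simp: dvd_def)
  next
    case (Cons s l)
    have l: "reduced l" "s < m" using Cons.prems by (auto simp: reduced_Cons)
    show ?case
    proof (cases "s = 0")
      case True
      have "2 * int m dvd (d - int m) - dg l" using Cons.prems True by (simp add: algebra_simps)
      then have "P (emul xN (l, d - int m, False))" using Cons.IH l by (intro x) auto
      then show ?thesis using True Cons.prems by (simp add: xN_def emul_NG push_reduced_Cons)
    next
      case False
      then have "0 < s" by simp
      from this Cons.prems show ?thesis
      proof (induction s arbitrary: d rule: nat_induct_non_zero)
        case 1
        have "2 * int m dvd (d - 2) - dg l" using 1 by (simp add: algebra_simps)
        then have "P (emul yN (l, d - 2, False))" using Cons.IH l by (intro y) auto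
        then show ?case using 1 by (simp add: yN_def emul_NG push_reduced_Cons)
      next
        case (Suc s)
        have r: "reduced (s # l)" using Suc by (auto simp: reduced_Cons)
        have "2 * int m dvd (d - 2) - dg (s # l)" using Suc by (simp add: algebra_simps)
        then have "P (emul yN (s # l, d - 2, False))" using Suc r by (intro y) auto
        then show ?case using yN_shift[of s l d] Suc by (simp add: reduced_Cons)
      qed
    qed
  qed
  then show ?thesis using assms(1) by (metis NG_carrierE)
qed

section \<open>The centre of the central extension\<close>

lemma central_commutes: "p \<in> carrier NG \<Longrightarrow> fst p = [] \<Longrightarrow> q \<in> carrier NG \<Longrightarrow> emul p q = emul q p"
  by (elim NG_carrierE) (auto simp: emul_NG)

text \<open>A nonempty normal form commutes with only one of \<open>x\<close> and \<open>y\<close> at best. Take the generator of the factor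
  that does not contain the first syllable: multiplied from the left it becomes the first syllable,
  multiplied from the right it leaves the first syllable in place.\<close>

lemma central_iff:
  assumes "p \<in> carrier NG"
  shows "fst p = [] \<longleftrightarrow> (\<forall>q\<in>carrier NG. emul p q = emul q p)"
proof
  assume "fst p = []"
  then show "\<forall>q\<in>carrier NG. emul p q = emul q p" using central_commutes assms by blast
next
  assume *: "\<forall>q\<in>carrier NG. emul p q = emul q p"
  obtain l d where p: "p = (l, d, False)" "reduced l" using assms by (rule NG_carrierE)
  have "emul p xN = emul xN p" "emul p yN = emul yN p" using * xN_closed yN_closed by blast+
  then have comm: "mul l [0] = push 0 l" "mul l [1] = push 1 l"
    by (simp_all add: p xN_def yN_def emul_NG)
  show "fst p = []"
  proof (rule ccontr)
    assume "fst p \<noteq> []"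
    then have ne: "l \<noteq> []" by (simp add: p)
    show False
    proof (cases "hd l = 0")
      case True
      then have "mul l [1] = 1 # l" using comm ne by (cases l) (simp_all add: push_Cons)
      then show False
        by - (rule mul_singleton_cases[OF m_pos(3) p(2)]; use True ne in \<open>auto simp: Cons_eq_append_conv\<close>)
    next
      case False
      then have "mul l [0] = 0 # l" using comm ne by (cases l) (simp_all add: push_Cons)
      then show False
        by - (rule mul_singleton_cases[OF m_pos(1) p(2)]; use False ne in \<open>auto simp: Cons_eq_append_conv append_eq_Cons_conv\<close>)
    qed
  qed
qed

section \<open>Torsion in the free product\<close>

lemma fst_pow: "p \<in> carrier NG \<Longrightarrow> fst (p [^]\<^bsub>NG\<^esub> (k::nat)) = (mul (fst p) ^^ k) []"
proof (induction k)
  case (Suc k)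
  then have "p [^]\<^bsub>NG\<^esub> Suc k = emul p (p [^]\<^bsub>NG\<^esub> k)" by (metis NG.nat_pow_Suc2 NG_simps(2))
  then show ?case using Suc fst_emul_NG by simp
qed simp

text \<open>As long as the first and the last syllable lie in the same factor, conjugation moves the first one
  to the end, where it merges or cancels.\<close>

lemma cyclic_reduction:
  assumes "p \<in> carrier NG"
  obtains g where "g \<in> carrier NG" "length (fst (conj_by g p)) \<le> 1 \<or>
    (hd (fst (conj_by g p)) = 0) \<noteq> (last (fst (conj_by g p)) = 0)"
proof -
  have "\<exists>g\<in>carrier NG. length (fst (conj_by g p)) \<le> 1 \<or>
    (hd (fst (conj_by g p)) = 0) \<noteq> (last (fst (conj_by g p)) = 0)"
    using assms
  proof (induction "length (fst p)" arbitrary: p rule: less_induct)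
    case less
    obtain l d where p: "p = (l, d, False)" "reduced l" "2 * int m dvd d - dg l"
      using less.prems by (rule NG_carrierE)
    show ?case
    proof (cases "length l \<le> 1 \<or> (hd l = 0) \<noteq> (last l = 0)")
      case True
      then show ?thesis using less.prems NG.one_closed p
        by (intro bexI[of _ "([], 0, False)"]) (auto simp: conj_by_NG)
    next
      case False
      then obtain f t where l: "l = f # t" "t \<noteq> []" "(f = 0) = (last t = 0)"
        by (cases l) (auto split: if_splits simp: Suc_le_eq)
      then have f: "f < m" "reduced t" using p by (simp_all add: reduced_Cons)
      define q where "q = conj_by (syl (neg f)) p"
      have syl: "syl (neg f) \<in> carrier NG" using f by (intro syl_closed) simp
      have fst_q: "fst q = mul t [f]"
        using f p l by (simp add: q_def conj_by_syl cstep_def push_Cons)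
      have "length (mul t [f]) \<le> length t"
        by (rule mul_singleton_cases[OF f]) (use l in auto)
      then have "length (fst q) < length (fst p)" using fst_q l p by simp
      moreover have "q \<in> carrier NG"
        using NG_conjugate_closed[of "syl (neg f)" p] syl less.prems by (simp add: q_def conj_by_def)
      ultimately obtain g where g: "g \<in> carrier NG" "length (fst (conj_by g q)) \<le> 1 \<or>
          (hd (fst (conj_by g q)) = 0) \<noteq> (last (fst (conj_by g q)) = 0)"
        using less.hyps by blast
      have "conj_by g q = conj_by (emul g (syl (neg f))) p"
        using g(1) syl less.prems by (simp add: q_def conj_by_mult)
      moreover have "emul g (syl (neg f)) \<in> carrier NG"
        using NG.m_closed[OF g(1) syl] by simp
      ultimately show ?thesis using g(2) by metis
    qed
  qed
  then show thesis using that by blast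
qed

lemma cyclically_reduced_power:
  assumes "reduced c" "c \<noteq> []" "(hd c = 0) \<noteq> (last c = 0)"
  shows "(mul c ^^ k) [] = concat (replicate k c)"
proof -
  have "(mul c ^^ k) [] = concat (replicate k c) \<and> reduced (concat (replicate k c))
      \<and> (k > 0 \<longrightarrow> concat (replicate k c) \<noteq> [] \<and> hd (concat (replicate k c)) = hd c)"
  proof (induction k)
    case (Suc k)
    have "reduced (c @ concat (replicate k c))"
      using assms Suc by (cases "k = 0") (auto simp: reduced_append)
    then show ?case using Suc assms by (simp add: mul_reduced_append)
  qed simp
  then show ?thesis by simp
qed

lemma emul_cancel [simp]:
  "p \<in> carrier EG \<Longrightarrow> q \<in> carrier EG \<Longrightarrow> emul (einv p) (emul p q) = q"
  "p \<in> carrier EG \<Longrightarrow> q \<in> carrier EG \<Longrightarrow> emul p (emul (einv p) q) = q"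
  "p \<in> carrier EG \<Longrightarrow> emul (einv p) p = ([], 0, False)"
  "p \<in> carrier EG \<Longrightarrow> emul p (einv p) = ([], 0, False)"
  using EG.inv_solve_left[of p q] EG.l_inv[of p] EG.r_inv[of p]
  by (simp_all add: einv_closed emul_closed flip: emul_assoc, simp_all add: emul_def sg_def)

lemma emul_one [simp]: "emul ([], 0, False) p = p" "p \<in> carrier EG \<Longrightarrow> emul p ([], 0, False) = p"
  by (cases p; auto simp: emul_def sg_def)+

lemma conj_by_emul:
  "g \<in> carrier EG \<Longrightarrow> p \<in> carrier EG \<Longrightarrow> q \<in> carrier EG
    \<Longrightarrow> conj_by g (emul p q) = emul (conj_by g p) (conj_by g q)"
  by (simp add: conj_by_def emul_assoc emul_closed einv_closed)

lemma conj_by_one [simp]: "p \<in> carrier EG \<Longrightarrow> conj_by ([], 0, False) p = p"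
  "g \<in> carrier EG \<Longrightarrow> conj_by g ([], 0, False) = ([], 0, False)"
  by (simp_all add: conj_by_def) (simp add: einv_def)

lemma conj_by_inverse [simp]:
  "g \<in> carrier EG \<Longrightarrow> p \<in> carrier EG \<Longrightarrow> conj_by (einv g) (conj_by g p) = p"
  by (simp flip: conj_by_mult add: einv_closed)

lemma conj_by_pow:
  "g \<in> carrier EG \<Longrightarrow> p \<in> carrier NG \<Longrightarrow> conj_by g (p [^]\<^bsub>NG\<^esub> k) = conj_by g p [^]\<^bsub>NG\<^esub> (k::nat)"
proof (induction k)
  case (Suc k)
  have "p [^]\<^bsub>NG\<^esub> k \<in> carrier NG" using Suc.prems by (intro NG.nat_pow_closed)
  then show ?case using Suc by (simp add: conj_by_emul)
qed simp

lemma conj_by_NG_closed: "g \<in> carrier EG \<Longrightarrow> p \<in> carrier NG \<Longrightarrow> conj_by g p \<in> carrier NG"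
  unfolding conj_by_def by (rule NG_conjugate_closed)

lemma fst_conj_by_central:
  assumes "g \<in> carrier NG" "p \<in> carrier NG" "fst p = []"
  shows "conj_by g p = p"
proof -
  have "emul g p = emul p g" using central_commutes[OF assms(2,3,1)] by simp
  then show ?thesis using assms by (simp add: conj_by_def emul_assoc einv_closed)
qed

text \<open>A cyclically reduced normal form of length at least two has no power equal to \<open>1\<close>, because its
  powers are concatenations of copies of it.\<close>

lemma torsion_conjugate_to_syllable:
  assumes "p \<in> carrier NG" "fst (p [^]\<^bsub>NG\<^esub> k) = []" "0 < (k::nat)" "fst p \<noteq> []"
  obtains g s d where "g \<in> carrier NG" "conj_by g p = ([s], d, False)" "s < m" "(push s ^^ k) [] = []"
proof -
  obtain g where g: "g \<in> carrier NG" and red: "length (fst (conj_by g p)) \<le> 1 \<or>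
    (hd (fst (conj_by g p)) = 0) \<noteq> (last (fst (conj_by g p)) = 0)"
    using cyclic_reduction assms(1) by blast
  have gE: "g \<in> carrier EG" and pE: "p \<in> carrier EG" using g assms(1) by simp_all
  have gp: "conj_by g p \<in> carrier NG" using gE assms(1) by (rule conj_by_NG_closed)
  then obtain c d where c: "conj_by g p = (c, d, False)" "reduced c" by (rule NG_carrierE)
  have pk: "p [^]\<^bsub>NG\<^esub> k \<in> carrier NG" using assms(1) by (intro NG.nat_pow_closed)
  have "fst (conj_by g p [^]\<^bsub>NG\<^esub> k) = []"
    using fst_conj_by_central[OF g pk assms(2)] conj_by_pow[OF gE assms(1)] assms(2) by simp
  then have pow: "(mul c ^^ k) [] = []" using fst_pow[OF gp] c by simp
  have ne: "c \<noteq> []"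
  proof
    assume "c = []"
    then have "conj_by (einv g) (conj_by g p) = conj_by g p"
      using c by (intro fst_conj_by_central einv_NG g gp) simp
    moreover have "conj_by (einv g) (conj_by g p) = p" using gE pE by (rule conj_by_inverse)
    ultimately show False using assms(4) c \<open>c = []\<close> by (metis fst_conv)
  qed
  have "\<not> (hd c = 0) \<noteq> (last c = 0)"
  proof
    assume "(hd c = 0) \<noteq> (last c = 0)"
    from cyclically_reduced_power[OF c(2) ne this, of k] pow ne assms(3)
    show False by (cases k) simp_all
  qed
  then obtain s where s: "c = [s]" using red c ne by (cases c) auto
  have "mul [s] = push s" by (rule ext) simp
  then show thesis using that g c s pow by simp
qed

section \<open>Automorphisms of the central extension\<close>

lemma conj_by_iso:
  assumes "g \<in> carrier EG"
  shows "conj_by g \<in> iso NG NG"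
proof -
  have inv: "einv (einv g) = g" using EG.inv_inv[OF assms] assms by (simp add: einv_closed)
  have 1: "\<forall>p\<in>carrier NG. conj_by (einv g) (conj_by g p) = p" using assms by simp
  have 2: "\<forall>p\<in>carrier NG. conj_by g (conj_by (einv g) p) = p"
    using conj_by_inverse[of "einv g"] assms by (simp add: einv_closed inv)
  have "bij_betw (conj_by g) (carrier NG) (carrier NG)"
    by (rule bij_betw_byWitness[OF 1 2])
      (use conj_by_NG_closed assms einv_closed in blast)+
  then show ?thesis
    using conj_by_NG_closed[OF assms] assms by (auto simp: iso_def hom_def conj_by_emul)
qed

lemma iso_NG_compose: "\<alpha> \<in> iso NG NG \<Longrightarrow> \<beta> \<in> iso NG NG \<Longrightarrow> (\<lambda>p. \<beta> (\<alpha> p)) \<in> iso NG NG"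
  using iso_set_trans[of \<alpha> NG NG \<beta> NG] by (simp add: comp_def)

lemma iso_NG_D:
  assumes "\<alpha> \<in> iso NG NG"
  shows "p \<in> carrier NG \<Longrightarrow> \<alpha> p \<in> carrier NG"
    "p \<in> carrier NG \<Longrightarrow> q \<in> carrier NG \<Longrightarrow> \<alpha> (emul p q) = emul (\<alpha> p) (\<alpha> q)"
    "\<alpha> ([], 0, False) = ([], 0, False)"
    "p \<in> carrier NG \<Longrightarrow> \<alpha> (einv p) = einv (\<alpha> p)"
    "p \<in> carrier NG \<Longrightarrow> \<alpha> (p [^]\<^bsub>NG\<^esub> (k::nat)) = \<alpha> p [^]\<^bsub>NG\<^esub> k"
    "inj_on \<alpha> (carrier NG)" "\<alpha> ` carrier NG = carrier NG"
proof -
  have hom: "\<alpha> \<in> hom NG NG" using assms by (simp add: iso_def)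
  then interpret group_hom NG NG \<alpha> by unfold_locales
  show closed: "\<alpha> p \<in> carrier NG" if "p \<in> carrier NG" using that by (rule hom_closed)
  show "\<alpha> (emul p q) = emul (\<alpha> p) (\<alpha> q)" if "p \<in> carrier NG" "q \<in> carrier NG"
    using hom_mult[OF that] by simp
  show "\<alpha> ([], 0, False) = ([], 0, False)" using hom_one by simp
  show "\<alpha> (einv p) = einv (\<alpha> p)" if "p \<in> carrier NG"
    using hom_inv[OF that] inv_NG[OF that] inv_NG[OF closed[OF that]] by simp
  show "\<alpha> (p [^]\<^bsub>NG\<^esub> (k::nat)) = \<alpha> p [^]\<^bsub>NG\<^esub> k" if "p \<in> carrier NG"
    using hom_nat_pow[OF that] .
  show "inj_on \<alpha> (carrier NG)" "\<alpha> ` carrier NG = carrier NG"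
    using assms by (simp_all add: iso_def bij_betw_def)
qed

lemma iso_NG_central:
  assumes \<alpha>: "\<alpha> \<in> iso NG NG" and p: "p \<in> carrier NG"
  shows "fst (\<alpha> p) = [] \<longleftrightarrow> fst p = []"
proof -
  note \<alpha>D = iso_NG_D[OF \<alpha>]
  have "fst (\<alpha> p) = [] \<longleftrightarrow> (\<forall>q\<in>carrier NG. emul (\<alpha> p) (\<alpha> q) = emul (\<alpha> q) (\<alpha> p))"
    unfolding central_iff[OF \<alpha>D(1)[OF p]] by (subst \<alpha>D(7)[symmetric]) blast
  also have "\<dots> \<longleftrightarrow> (\<forall>q\<in>carrier NG. \<alpha> (emul p q) = \<alpha> (emul q p))"
    using \<alpha>D(2) p by simp
  also have "\<dots> \<longleftrightarrow> (\<forall>q\<in>carrier NG. emul p q = emul q p)"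
    using inj_on_eq_iff[OF \<alpha>D(6)] NG.m_closed p by (metis NG_simps(2))
  finally show ?thesis using central_iff[OF p] by simp
qed

lemma push_zero_pow: "(push 0 ^^ k) [] = (if even k then [] else [0])"
  by (induction k) (auto simp: push_Cons)

lemma push_pow: "0 < s \<Longrightarrow> s < m \<Longrightarrow>
    (push s ^^ k) [] = (if (k * s) mod m = 0 then [] else [(k * s) mod m])"
proof (induction k)
  case (Suc k)
  have "(s + k * s mod m) mod m = (s + k * s) mod m" by (simp add: mod_simps)
  moreover have "(s + k * s) mod m = s" if "k * s mod m = 0"
    using that Suc.prems calculation by simp
  ultimately show ?case using Suc by (auto simp: push_Cons)
qed simp

text \<open>The images of \<open>x\<close> and \<open>y\<close> have finite order modulo the centre, dividing \<open>2\<close> and \<open>m\<close>. As \<open>m\<close> is odd,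
  the order tells the two factors apart.\<close>

lemma iso_NG_generators:
  assumes \<alpha>: "\<alpha> \<in> iso NG NG"
  obtains g h d d' j where "g \<in> carrier NG" "h \<in> carrier NG" "0 < j" "j < m"
    "conj_by g (\<alpha> xN) = ([0], d, False)" "conj_by h (\<alpha> yN) = ([j], d', False)"
proof -
  note \<alpha>D = iso_NG_D[OF \<alpha>]
  have "mul [s] = push s" for s by (rule ext) simp
  then have pow: "fst (xN [^]\<^bsub>NG\<^esub> (2::nat)) = []" "fst (yN [^]\<^bsub>NG\<^esub> m) = []"
    unfolding fst_pow[OF xN_closed] fst_pow[OF yN_closed]
    by (simp_all add: xN_def yN_def push_zero_pow push_pow)
  have xk: "xN [^]\<^bsub>NG\<^esub> k \<in> carrier NG" and yk: "yN [^]\<^bsub>NG\<^esub> k \<in> carrier NG" for k :: nat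
    by (rule NG.nat_pow_closed[OF xN_closed], rule NG.nat_pow_closed[OF yN_closed])
  have x2: "fst (\<alpha> xN [^]\<^bsub>NG\<^esub> (2::nat)) = []"
    using pow(1) iso_NG_central[OF \<alpha> xk] \<alpha>D(5)[OF xN_closed] by metis
  have ym: "fst (\<alpha> yN [^]\<^bsub>NG\<^esub> m) = []"
    using pow(2) iso_NG_central[OF \<alpha> yk] \<alpha>D(5)[OF yN_closed] by metis
  have ne: "fst (\<alpha> xN) \<noteq> []" "fst (\<alpha> yN) \<noteq> []"
    using iso_NG_central[OF \<alpha> xN_closed] iso_NG_central[OF \<alpha> yN_closed] by (simp_all add: xN_def yN_def)
  obtain g s d where g: "g \<in> carrier NG" "conj_by g (\<alpha> xN) = ([s], d, False)" "s < m"
      "(push s ^^ 2) [] = []"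
    using torsion_conjugate_to_syllable[OF \<alpha>D(1)[OF xN_closed] x2 zero_less_numeral ne(1)] by blast
  obtain h j d' where h: "h \<in> carrier NG" "conj_by h (\<alpha> yN) = ([j], d', False)" "j < m"
      "(push j ^^ m) [] = []"
    using torsion_conjugate_to_syllable[OF \<alpha>D(1)[OF yN_closed] ym m_pos(1) ne(2)] by blast
  have "s = 0"
  proof (rule ccontr)
    assume "s \<noteq> 0"
    then have "2 * s mod m = 0" using push_pow[of s 2] g by (auto split: if_splits)
    then have "m dvd s" using odd_m by (simp add: mod_eq_0_iff_dvd coprime_dvd_mult_right_iff)
    then show False using g(3) \<open>s \<noteq> 0\<close> by (auto dest: dvd_imp_le)
  qed
  moreover have "j \<noteq> 0" using h(4) push_zero_pow[of m] odd_m by (cases "j = 0") auto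
  ultimately show thesis using that g h by blast
qed

text \<open>The normal forms of the products of \<open>x\<close> and conjugates \<open>l y^i l^-1\<close>, provided that \<open>l\<close> neither begins
  with \<open>x\<close> nor ends with a power of \<open>y\<close>: then no cancellation takes place between the factors.\<close>

inductive alternating_product :: "nat list \<Rightarrow> nat list \<Rightarrow> bool" for l where
  Nil: "alternating_product l []"
| zero: "alternating_product l u \<Longrightarrow> u \<noteq> [] \<longrightarrow> hd u \<noteq> 0 \<Longrightarrow> alternating_product l (0 # u)"
| turn: "alternating_product l u \<Longrightarrow> u \<noteq> [] \<longrightarrow> hd u = 0 \<Longrightarrow> 0 < i \<Longrightarrow> i < m
    \<Longrightarrow> alternating_product l (l @ [i] @ rev (map neg l) @ u)"

lemma alternating_product_closed:
  assumes l: "reduced l" "l \<noteq> []" "hd l \<noteq> 0" "last l = 0" and v: "alternating_product l v"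
  shows "reduced v" "alternating_product l (push 0 v)"
    "0 < j \<Longrightarrow> j < m \<Longrightarrow> alternating_product l (mul (l @ [j] @ rev (map neg l)) v)"
proof -
  define l' where "l' = rev (map neg l)"
  have l': "reduced l'" "l' \<noteq> []" "hd l' = 0" "last l' \<noteq> 0"
    using l by (simp_all add: l'_def hd_rev last_rev last_map hd_map reduced_hd_less del: map_map)
  have red: "reduced (l @ [i] @ l' @ u)" if "0 < i" "i < m" "reduced u" "u \<noteq> [] \<longrightarrow> hd u = 0" for i u
    using that l l' by (auto simp: reduced_append reduced_Cons)
  show v_red: "reduced v"
    using v by induction (use red in \<open>auto simp: reduced_Cons l'_def\<close>)
  show "alternating_product l (push 0 v)"
    using v
  proof cases
    case Nil
    then show ?thesis using alternating_product.zero[OF alternating_product.Nil] by simp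
  next
    case (zero u)
    then show ?thesis by (simp add: push_Cons)
  next
    case (turn u i)
    then have "push 0 v = 0 # v" using l by (cases l) (simp_all add: push_Cons)
    then show ?thesis using alternating_product.zero[OF v] turn l by simp
  qed
  show "alternating_product l (mul (l @ [j] @ rev (map neg l)) v)" if j: "0 < j" "j < m"
  proof -
    have short: "alternating_product l (mul (l @ [j] @ l') v)" if "v \<noteq> [] \<longrightarrow> hd v = 0"
    proof -
      have "mul (l @ [j] @ l') v = l @ [j] @ l' @ v"
        using red[OF j v_red that] mul_reduced_append[of "l @ [j] @ l'" v] by simp
      then show ?thesis using alternating_product.turn[OF v that j] by (simp add: l'_def)
    qed
    from v have "alternating_product l (mul (l @ [j] @ l') v)"
    proof cases
      case Nil
      then show ?thesis using short by simp
    next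
      case (zero u)
      then show ?thesis using short by simp
    next
      case (turn u i)
      have u: "reduced u" using v_red turn by (simp add: reduced_append reduced_Cons)
      have iu: "reduced (i # l' @ u)" using v_red turn by (simp add: reduced_append l'_def)
      have lu: "reduced (l' @ u)" using iu by (simp add: reduced_Cons)
      have "mul l (mul l' u) = mul (mul l l') u" using l l' u by (simp add: mul_assoc)
      also have "mul l l' = []"
        using mul_inverse_left[of l'] l l' by (simp add: l'_def rev_map del: map_map)
      finally have ll': "mul l (mul l' u) = u" by simp
      have l'v: "mul l' v = i # l' @ u"
      proof -
        have "v = mul l (i # l' @ u)" using v_red turn by (simp add: mul_reduced_append l'_def)
        then have "mul l' v = mul (mul l' l) (i # l' @ u)"
          using l l' iu by (simp add: mul_assoc)
        then show ?thesis using l by (simp add: l'_def)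
      qed
      have *: "mul (l @ [j] @ l') v = mul l (push j (i # l' @ u))"
        by (simp add: mul_append l'v)
      show ?thesis
      proof (cases "(j + i) mod m = 0")
        case True
        then show ?thesis
          using * turn j ll' mul_reduced_append[OF lu] by (simp add: push_Cons)
      next
        case False
        define i' where "i' = (j + i) mod m"
        have i': "0 < i'" "i' < m" using False by (simp_all add: i'_def)
        have "mul (l @ [j] @ l') v = mul l (i' # l' @ u)"
          using * turn j False by (simp add: push_Cons i'_def)
        also have "\<dots> = l @ [i'] @ l' @ u"
          using red[OF i' u] turn by (simp add: mul_reduced_append)
        finally show ?thesis using alternating_product.turn[OF _ _ i'] turn by (simp add: l'_def)
      qed
    qed
    then show ?thesis by (simp add: l'_def)
  qed
qed

text \<open>The image of the automorphism consists of alternating products. If \<open>l\<close> is not empty, these are \<open>1\<close>,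
  \<open>x\<close> and words with at least three syllables, so that \<open>y\<close> is not in the image.\<close>

lemma iso_NG_trivial_conjugator:
  assumes \<beta>: "\<beta> \<in> iso NG NG" and x: "fst (\<beta> xN) = [0]"
    and y: "fst (\<beta> yN) = l @ [j] @ rev (map neg l)" and j: "0 < j" "j < m"
    and l: "reduced l" "l \<noteq> [] \<Longrightarrow> hd l \<noteq> 0 \<and> last l = 0"
  shows "l = []"
proof (rule ccontr)
  assume ne: "l \<noteq> []"
  note \<beta>D = iso_NG_D[OF \<beta>]
  note closed = alternating_product_closed[OF l(1) ne conjunct1[OF l(2)[OF ne]] conjunct2[OF l(2)[OF ne]]]
  have "fst (einv (\<beta> xN)) = [0]"
    using x \<beta>D(1)[OF xN_closed] by (auto simp: einv_def)
  note ix = this[folded \<beta>D(4)[OF xN_closed]]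
  have mult: "fst (\<beta> (emul p n)) = mul (fst (\<beta> p)) (fst (\<beta> n))"
    if "p \<in> carrier NG" "n \<in> carrier NG" for p n
    using \<beta>D(2)[OF that] fst_emul_NG[OF \<beta>D(1)[OF that(1)]] by simp
  have all: "alternating_product l (fst (\<beta> n))" if "n \<in> carrier NG" for n
    using that
  proof (induction rule: NG_induct)
    case one
    show ?case using \<beta>D(3) by (simp add: alternating_product.Nil)
  next
    case (x n)
    then show ?case using closed(2) mult[OF xN_closed] assms(2) by simp
  next
    case (inv_x n)
    then show ?case using closed(2) mult[OF einv_NG[OF xN_closed]] ix by simp
  next
    case (y n)
    then show ?case using closed(3)[OF _ j] mult[OF yN_closed] assms(3) by simp
  qed
  obtain n where "n \<in> carrier NG" "\<beta> n = yN" using \<beta>D(7) yN_closed by (metis imageE)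
  with all[of n] have "alternating_product l [1]" by (simp add: yN_def)
  then show False using ne by cases (auto simp: Cons_eq_append_conv)
qed

lemma iso_NG_eqI:
  assumes "\<alpha> \<in> iso NG NG" "\<beta> \<in> iso NG NG" "\<alpha> xN = \<beta> xN" "\<alpha> yN = \<beta> yN" "n \<in> carrier NG"
  shows "\<alpha> n = \<beta> n"
  using assms(5)
proof (induction rule: NG_induct)
  case one
  show ?case by (simp only: iso_NG_D(3)[OF assms(1)] iso_NG_D(3)[OF assms(2)])
next
  case (x n)
  then show ?case
    by (simp only: iso_NG_D(2)[OF assms(1)] iso_NG_D(2)[OF assms(2)] xN_closed assms)
next
  case (inv_x n)
  then show ?case
    by (simp only: iso_NG_D(2,4)[OF assms(1)] iso_NG_D(2,4)[OF assms(2)] xN_closed einv_NG assms)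
next
  case (y n)
  then show ?case
    by (simp only: iso_NG_D(2)[OF assms(1)] iso_NG_D(2)[OF assms(2)] yN_closed assms)
qed

lemma fst_snd_pow: "p \<in> carrier NG \<Longrightarrow> fst (snd (p [^]\<^bsub>NG\<^esub> (k::nat))) = int k * fst (snd p)"
proof (induction k)
  case (Suc k)
  have "p [^]\<^bsub>NG\<^esub> Suc k = emul p (p [^]\<^bsub>NG\<^esub> k)" using Suc.prems by (metis NG.nat_pow_Suc2 NG_simps(2))
  then show ?case using Suc by (simp add: emul_def sg_def algebra_simps)
qed simp

text \<open>The automorphism maps \<open>z\<close> to a generator of the centre, which leaves only \<open>z\<close> and its inverse. Comparing
  degrees in \<open>x x = z = y^m\<close> then determines the degrees of the images of \<open>x\<close> and \<open>y\<close>, and the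
  degree of the image of \<open>y\<close> determines \<open>j\<close> modulo \<open>m\<close>.\<close>

lemma iso_NG_standard:
  assumes \<beta>: "\<beta> \<in> iso NG NG" and x: "\<beta> xN = ([0], d, False)" and y: "\<beta> yN = ([j], d', False)"
    and j: "0 < j" "j < m"
  obtains e where "\<And>n. n \<in> carrier NG \<Longrightarrow> \<beta> n = conj_by ([], 0, e) n"
proof -
  note \<beta>D = iso_NG_D[OF \<beta>]
  define z where "z i = ([] :: nat list, 2 * int m * i, False)" for i
  have z_closed: "z i \<in> carrier NG" for i unfolding z_def by (rule central_NG)
  have z_mult: "emul (z i) (z i') = z (i + i')" for i i'
    by (simp add: z_def emul_NG algebra_simps)
  have xx: "emul xN xN = z 1" by (simp add: xN_def emul_NG push_Cons z_def)
  have z1: "\<beta> (z 1) = ([], 2 * d, False)"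
    unfolding xx[symmetric] \<beta>D(2)[OF xN_closed xN_closed] x by (simp add: emul_NG push_Cons)
  have iz: "einv (z 1) = z (- 1)" by (simp add: z_def einv_def sg_def)
  have zi: "\<beta> (z i) = ([], 2 * d * i, False)" for i
  proof (induction i rule: int_induct[where k = 0])
    case base
    show ?case using \<beta>D(3) by (simp add: z_def)
  next
    case (step1 i)
    have "\<beta> (z (i + 1)) = emul (\<beta> (z i)) (\<beta> (z 1))"
      using \<beta>D(2)[OF z_closed z_closed] z_mult by metis
    then show ?case using step1 z1 by (simp add: emul_NG algebra_simps)
  next
    case (step2 i)
    have "\<beta> (z (i + - 1)) = emul (\<beta> (z i)) (\<beta> (z (- 1)))"
      using \<beta>D(2)[OF z_closed z_closed] z_mult by metis
    then have "\<beta> (z (i - 1)) = emul (\<beta> (z i)) (einv (\<beta> (z 1)))"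
      using \<beta>D(4)[OF z_closed[of 1]] iz by simp
    then show ?case using step2 z1 by (simp add: emul_NG einv_def sg_def algebra_simps)
  qed
  obtain n where n: "n \<in> carrier NG" "\<beta> n = z 1" using \<beta>D(7) z_closed by (metis imageE)
  then have "fst n = []" using iso_NG_central[OF \<beta> n(1)] by (simp add: z_def)
  moreover obtain l c where "n = (l, c, False)" "2 * int m dvd c - dg l"
    using n(1) by (rule NG_carrierE)
  ultimately obtain i where "n = z i" by (auto simp: z_def dvd_def)
  then have di: "d * i = int m" using n(2) zi[of i] by (simp add: z_def)
  have "\<beta> xN \<in> carrier NG" "\<beta> yN \<in> carrier NG" using \<beta>D(1) xN_closed yN_closed by blast+
  then have dvd: "2 * int m dvd d - int m" "2 * int m dvd d' - 2 * int j"
    using x y j by simp_all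
  have "int m dvd d"
    using dvd_mult_right[OF dvd(1)] by (simp add: dvd_diff_left_iff)
  then obtain q where q: "d = int m * q" by (auto simp: dvd_def)
  then have "q * i = 1" using di by simp
  then have q1: "q = 1 \<or> q = - 1" using zmult_eq_1_iff by blast
  have ypow: "yN [^]\<^bsub>NG\<^esub> m = z 1"
  proof -
    have "mul [1] = push 1" by (rule ext) simp
    then have "fst (yN [^]\<^bsub>NG\<^esub> m) = []"
      unfolding fst_pow[OF yN_closed] by (simp add: yN_def push_pow)
    moreover have "fst (snd (yN [^]\<^bsub>NG\<^esub> m)) = 2 * int m"
      unfolding fst_snd_pow[OF yN_closed] by (simp add: yN_def)
    moreover have "yN [^]\<^bsub>NG\<^esub> m \<in> carrier NG" using yN_closed by (rule NG.nat_pow_closed)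
    ultimately show ?thesis by (elim NG_carrierE) (simp add: z_def)
  qed
  have "fst (snd (\<beta> yN [^]\<^bsub>NG\<^esub> m)) = int m * d'"
    unfolding fst_snd_pow[OF \<beta>D(1)[OF yN_closed]] by (simp add: y)
  then have "2 * d = int m * d'"
    using \<beta>D(5)[OF yN_closed, of m] ypow z1 by (metis fst_conv snd_conv)
  then have d': "d' = 2 * q" using q by simp
  have mj: "int m dvd q - int j"
  proof -
    have "2 * int m dvd 2 * (q - int j)" using dvd(2) d' by (simp add: algebra_simps)
    then show ?thesis by (metis dvd_times_left_cancel_iff zero_neq_numeral)
  qed
  have key: "\<beta> n = conj_by ([], 0, e) n"
    if "\<beta> xN = conj_by ([], 0, e) xN" "\<beta> yN = conj_by ([], 0, e) yN" "n \<in> carrier NG" for e n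
    by (rule iso_NG_eqI[OF \<beta> conj_by_iso that]) simp
  show thesis
  proof (cases "q = 1")
    case True
    then have dvd_j: "int m dvd int j - 1" using mj by (simp add: dvd_diff_commute)
    have "int j = 1"
    proof (rule ccontr)
      assume "int j \<noteq> 1"
      then have "int m \<le> int j - 1" using j dvd_j by (intro zdvd_imp_le) auto
      then show False using j by simp
    qed
    then have "\<beta> xN = conj_by ([], 0, False) xN" "\<beta> yN = conj_by ([], 0, False) yN"
      using x y q d' True by (simp_all add: xN_def yN_def)
    then show thesis using key by (intro that)
  next
    case False
    then have q': "q = - 1" using q1 by simp
    have "- 1 - int j = - (int j + 1)" by simp
    then have "int m dvd int j + 1" using mj unfolding q' by (simp only: dvd_minus_iff)
    then have "int m \<le> int j + 1" by (rule zdvd_imp_le) simp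
    then have "j = m - 1" using j by simp
    then have eq: "\<beta> xN = conj_by ([], 0, True) xN" "\<beta> yN = conj_by ([], 0, True) yN"
      using x y q d' q' by (simp_all add: xN_def yN_def conj_by_def emul_def einv_def flip_def sg_def neg_def)
    then show thesis using key by (intro that)
  qed
qed

lemma conj_by_commuting:
  "g \<in> carrier EG \<Longrightarrow> p \<in> carrier EG \<Longrightarrow> emul g p = emul p g \<Longrightarrow> conj_by g p = p"
  by (simp add: conj_by_def emul_assoc einv_closed)

text \<open>The image of \<open>x\<close> is normalised to a central multiple of \<open>x\<close>, and that of \<open>y\<close> to a conjugate of a
  power of \<open>y\<close> by \<open>l\<close>. A shortest such \<open>l\<close> does not begin with \<open>x\<close>, as \<open>x\<close> could be moved into the
  inner automorphism, nor does it end with a power of \<open>y\<close>, as that would commute with the image.\<close>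

theorem iso_NG_is_conjugation:
  assumes \<alpha>: "\<alpha> \<in> iso NG NG"
  obtains e where "e \<in> carrier EG" "\<And>n. n \<in> carrier NG \<Longrightarrow> \<alpha> n = conj_by e n"
proof -
  note \<alpha>D = iso_NG_D[OF \<alpha>]
  have \<alpha>x: "\<alpha> xN \<in> carrier EG" and \<alpha>y: "\<alpha> yN \<in> carrier EG"
    using \<alpha>D(1)[OF xN_closed] \<alpha>D(1)[OF yN_closed] by simp_all
  \<comment> \<open>Some inner automorphism brings the images of \<open>x\<close> and \<open>y\<close> into the normalised shape with
  conjugating normal form \<open>l\<close>.\<close>
  define Q where "Q l \<longleftrightarrow> reduced l \<and> (\<exists>g d d' j. g \<in> carrier NG \<and> 0 < j \<and> j < m \<and>
     ([j], d', False) \<in> carrier EG \<and> conj_by g (\<alpha> xN) = ([0], d, False) \<and>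
     conj_by g (\<alpha> yN) = conj_by (l, dg l, False) ([j], d', False))" for l
  have QI: "Q l" if "reduced l" "g \<in> carrier NG" "0 < j" "j < m" "([j], d', False) \<in> carrier EG"
      "conj_by g (\<alpha> xN) = ([0], d, False)"
      "conj_by g (\<alpha> yN) = conj_by (l, dg l, False) ([j], d', False)" for l g d d' j
    using that unfolding Q_def by blast
  have "\<exists>l. Q l"
  proof -
    obtain g h d d' j where *: "g \<in> carrier NG" "h \<in> carrier NG" "0 < j" "j < m"
      "conj_by g (\<alpha> xN) = ([0], d, False)" "conj_by h (\<alpha> yN) = ([j], d', False)"
      by (rule iso_NG_generators[OF \<alpha>])
    have "emul g (einv h) \<in> carrier NG"
      using NG.m_closed[OF *(1) einv_NG[OF *(2)]] by simp
    then obtain l c where l: "emul g (einv h) = (l, c, False)" "reduced l" by (rule NG_carrierE)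
    have "g = emul (emul g (einv h)) h" using *(1,2) by (simp add: emul_assoc einv_closed)
    moreover have "emul g (einv h) \<in> carrier EG" "h \<in> carrier EG"
      using *(1,2) by (simp_all add: emul_closed einv_closed)
    ultimately have "conj_by g (\<alpha> yN) = conj_by (emul g (einv h)) (conj_by h (\<alpha> yN))"
      using \<alpha>y conj_by_mult by metis
    also have "\<dots> = conj_by (l, dg l, False) ([j], d', False)"
      using *(4,6) l by (simp add: conj_by_NG sg_def)
    finally have "conj_by g (\<alpha> yN) = conj_by (l, dg l, False) ([j], d', False)" .
    moreover have "([j], d', False) \<in> carrier EG"
      using conj_by_closed[of h "\<alpha> yN"] *(2,6) \<alpha>y by simp
    ultimately show ?thesis using QI[OF l(2) *(1,3,4) _ *(5)] by blast
  qed
  then obtain l where l: "Q l" and least: "\<And>k. Q k \<Longrightarrow> length l \<le> length k"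
    using ex_has_least_nat[of Q _ length] by blast
  then obtain g d d' j where red: "reduced l" and g: "g \<in> carrier NG" and j: "0 < j" "j < m"
      and yE: "([j], d', False) \<in> carrier EG"
      and x: "conj_by g (\<alpha> xN) = ([0], d, False)"
      and y: "conj_by g (\<alpha> yN) = conj_by (l, dg l, False) ([j], d', False)"
    unfolding Q_def by blast
  have gE: "g \<in> carrier EG" using g by simp
  have xE: "([0], d, False) \<in> carrier EG" "conj_by (l, dg l, False) ([j], d', False) \<in> carrier EG"
    using conj_by_closed[OF gE \<alpha>x] conj_by_closed[OF gE \<alpha>y] x y by simp_all
  have hd: "hd l \<noteq> 0" if ne: "l \<noteq> []"
  proof
    assume "hd l = 0"
    then obtain k where k: "l = 0 # k" using ne by (cases l) auto
    define s where "s = syl 0"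
    have s: "s \<in> carrier EG" "einv s \<in> carrier NG"
      using syl_closed[OF m_pos(1)] einv_NG by (simp_all add: s_def)
    have kE: "(k, dg k, False) \<in> carrier EG" using red k by (simp add: reduced_Cons)
    have ls: "(l, dg l, False) = emul s (k, dg k, False)"
      using red k by (simp add: s_def syl_def emul_NG push_reduced_Cons)
    have "conj_by (emul (einv s) g) (\<alpha> xN) = conj_by (einv s) ([0], d, False)"
      using s gE \<alpha>x x by (simp add: conj_by_mult einv_closed)
    also have "([0], d, False) = conj_by s ([0], d, False)"
      using s xE by (intro conj_by_commuting[symmetric]) (auto simp: s_def syl_def emul_NG)
    finally have 1: "conj_by (emul (einv s) g) (\<alpha> xN) = ([0], d, False)"
      using s xE by simp
    have "conj_by (emul (einv s) g) (\<alpha> yN) = conj_by (einv s) (conj_by s (conj_by (k, dg k, False) ([j], d', False)))"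
      using s gE \<alpha>y y yE kE ls by (simp add: conj_by_mult einv_closed)
    then have 2: "conj_by (emul (einv s) g) (\<alpha> yN) = conj_by (k, dg k, False) ([j], d', False)"
      using s yE kE by (simp add: conj_by_closed)
    have "emul (einv s) g \<in> carrier NG" using NG.m_closed[OF s(2) g] by simp
    moreover have "reduced k" using kE by simp
    ultimately have "Q k" using QI[OF _ _ j yE 1 2] by blast
    then show False using least k by fastforce
  qed
  have last: "last l = 0" if ne: "l \<noteq> []"
  proof (rule ccontr)
    assume "last l \<noteq> 0"
    then obtain k i where k: "l = k @ [i]" "i \<noteq> 0" using ne by (cases l rule: rev_cases) auto
    then have i: "i < m" and kr: "reduced k" using red by (simp_all add: reduced_append)
    have s: "syl i \<in> carrier EG" using syl_closed[OF i] by simp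
    have kE: "(k, dg k, False) \<in> carrier EG" using kr by simp
    have ls: "(l, dg l, False) = emul (k, dg k, False) (syl i)"
      using red k by (simp add: syl_def emul_NG mul_reduced_append)
    have "conj_by (syl i) ([j], d', False) = ([j], d', False)"
      using s yE k j by (intro conj_by_commuting) (auto simp: syl_def emul_NG push_Cons add.commute)
    then have "conj_by (l, dg l, False) ([j], d', False) = conj_by (k, dg k, False) ([j], d', False)"
      using ls s kE yE by (simp add: conj_by_mult)
    then have "conj_by g (\<alpha> yN) = conj_by (k, dg k, False) ([j], d', False)" using y by simp
    then have "Q k" by (rule QI[OF kr g j yE x])
    then show False using least k by fastforce
  qed
  define \<beta> where "\<beta> = (\<lambda>p. conj_by g (\<alpha> p))"
  have \<beta>: "\<beta> \<in> iso NG NG" unfolding \<beta>_def using \<alpha> conj_by_iso[OF gE] by (rule iso_NG_compose)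
  have "reduced (l @ [j])" using red last j by (auto simp: reduced_append)
  moreover have "reduced (l @ [j] @ rev (map neg l))"
    using red last j by (auto simp: reduced_append hd_rev last_map reduced_Cons simp del: map_map)
  ultimately have "fst (\<beta> yN) = l @ [j] @ rev (map neg l)"
    using y red j mul_reduced_append[of "l @ [j]" "rev (map neg l)"]
    by (simp add: \<beta>_def conj_by_NG mul_reduced_append flip_def)
  then have "l = []"
    using iso_NG_trivial_conjugator[OF \<beta> _ _ j red] x hd last by (simp add: \<beta>_def)
  then have "\<beta> xN = ([0], d, False)" "\<beta> yN = ([j], d', False)"
    using x y yE by (simp_all add: \<beta>_def)
  then obtain e where e: "\<And>n. n \<in> carrier NG \<Longrightarrow> \<beta> n = conj_by ([], 0, e) n"
    using iso_NG_standard[OF \<beta> _ _ j] by blast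
  have "\<alpha> n = conj_by (emul (einv g) ([], 0, e)) n" if "n \<in> carrier NG" for n
  proof -
    have "\<alpha> n = conj_by (einv g) (\<beta> n)"
      using \<alpha>D(1)[OF that] gE by (simp add: \<beta>_def)
    then show ?thesis using e[OF that] that gE by (simp add: conj_by_mult einv_closed)
  qed
  moreover have "emul (einv g) ([], 0, e) \<in> carrier EG"
    using gE by (intro emul_closed einv_closed) auto
  ultimately show thesis using that by blast
qed

end

section \<open>Presented groups\<close>

definition pres_class :: "('x word \<times> 'x word) set \<Rightarrow> 'x word \<Rightarrow> 'x word set" where
  "pres_class R u = {w. pres_eq R u w}"

definition inv_word :: "'x word \<Rightarrow> 'x word" where
  "inv_word u = rev (map (\<lambda>(x, s). (x, \<not> s)) u)"

lemma inv_word_simps [simp]: "inv_word [] = []" "inv_word ((x, s) # u) = inv_word u @ [(x, \<not> s)]"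
  "inv_word (u @ v) = inv_word v @ inv_word u"
  by (simp_all add: inv_word_def)

lemma pres_eq_context: "pres_eq R u v \<Longrightarrow> pres_eq R (a @ u @ b) (a @ v @ b)"
proof (induction rule: pres_eq.induct)
  case (cancel u x s v)
  show ?case using pres_eq.cancel[of R "a @ u" x s "v @ b"] by simp
next
  case (rel l r u v)
  then show ?case using pres_eq.rel[of l r R "a @ u" "v @ b"] by simp
qed (auto intro: pres_eq.intros)

lemma pres_eq_append: "pres_eq R u u' \<Longrightarrow> pres_eq R v v' \<Longrightarrow> pres_eq R (u @ v) (u' @ v')"
  using pres_eq_context[of R u u' "[]" v] pres_eq_context[of R v v' u' "[]"]
  by (auto intro: pres_eq.trans)

lemma pres_eq_inv_word: "pres_eq R (inv_word u @ u) []"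
proof (induction u)
  case (Cons a u)
  obtain x s where a: "a = (x, s)" by (cases a)
  have "pres_eq R (inv_word u @ [(x, \<not> s), (x, \<not> \<not> s)] @ u) (inv_word u @ u)"
    by (rule pres_eq.cancel)
  with Cons show ?case by (auto simp: a intro: pres_eq.trans)
qed (simp add: pres_eq.refl)

lemma pres_class_eq_iff: "pres_class R u = pres_class R v \<longleftrightarrow> pres_eq R u v"
  by (auto simp: pres_class_def intro: pres_eq.intros)

lemma carrier_presented_group: "carrier (presented_group R) = range (pres_class R)"
  by (auto simp: presented_group_def quotient_def pres_class_def)

lemma one_presented_group: "\<one>\<^bsub>presented_group R\<^esub> = pres_class R []"
  by (simp add: presented_group_def pres_class_def)

lemma mult_presented_group: "pres_class R u \<otimes>\<^bsub>presented_group R\<^esub> pres_class R v = pres_class R (u @ v)"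
  by (auto simp: presented_group_def pres_class_def intro: pres_eq.refl
      dest: pres_eq_append intro: pres_eq.trans pres_eq.sym)

lemma group_presented_group: "group (presented_group R)"
proof (rule groupI)
  fix x assume "x \<in> carrier (presented_group R)"
  then obtain u where "x = pres_class R u" by (auto simp: carrier_presented_group)
  then have "pres_class R (inv_word u) \<otimes>\<^bsub>presented_group R\<^esub> x = \<one>\<^bsub>presented_group R\<^esub>"
    by (simp add: mult_presented_group one_presented_group pres_class_eq_iff pres_eq_inv_word)
  then show "\<exists>y\<in>carrier (presented_group R). y \<otimes>\<^bsub>presented_group R\<^esub> x = \<one>\<^bsub>presented_group R\<^esub>"
    by (auto simp: carrier_presented_group)
qed (auto simp: carrier_presented_group mult_presented_group one_presented_group)

section \<open>Evaluation in a group with two generators\<close>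

context odd_dihedral
begin

definition syl_val :: "('k, 'z) monoid_scheme \<Rightarrow> 'k \<Rightarrow> 'k \<Rightarrow> nat \<Rightarrow> 'k" where
  "syl_val K x y s = (if s = 0 then x else y [^]\<^bsub>K\<^esub> s)"

text \<open>The value of an element of \<open>N\<close> in a group \<open>K\<close> with given images of \<open>x\<close> and \<open>y\<close>: a power of \<open>z\<close> times
  the product of the syllables.\<close>

definition NG_val :: "('k, 'z) monoid_scheme \<Rightarrow> 'k \<Rightarrow> 'k \<Rightarrow> elt \<Rightarrow> 'k" where
  "NG_val K x y p = (x \<otimes>\<^bsub>K\<^esub> x) [^]\<^bsub>K\<^esub> ((fst (snd p) - dg (fst p)) div (2 * int m)) \<otimes>\<^bsub>K\<^esub>
     foldr (\<lambda>s k. syl_val K x y s \<otimes>\<^bsub>K\<^esub> k) (fst p) \<one>\<^bsub>K\<^esub>"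

text \<open>Evaluation commutes with left multiplication by the generators; this is all that is
  needed in order to see that it is a homomorphism, since the normal form of a word is built by such
  multiplications. When a syllable cancels, the relation \<open>x x = y^m\<close> in \<open>K\<close> provides the factor
  \<open>z\<close> that the change of the degree requires.\<close>

lemma NG_val_generators:
  fixes K :: "('k, 'z) monoid_scheme" (structure)
  assumes K: "group K" and x: "x \<in> carrier K" and y: "y \<in> carrier K"
    and rel: "x \<otimes> x = y [^] m" and n: "n \<in> carrier NG"
  shows "NG_val K x y n \<in> carrier K"
    "NG_val K x y (emul xN n) = x \<otimes> NG_val K x y n"
    "NG_val K x y (emul yN n) = y \<otimes> NG_val K x y n"
proof -
  interpret K: group K by (rule K)
  define z where "z = x \<otimes> x"
  let ?P = "foldr (\<lambda>s k. syl_val K x y s \<otimes> k)"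
  have z: "z \<in> carrier K" using x by (simp add: z_def)
  have sv: "syl_val K x y s \<in> carrier K" for s using x y by (simp add: syl_val_def)
  have P: "?P l \<one> \<in> carrier K" for l by (induction l) (simp_all add: sv)
  have comm: "z [^] (i::int) \<otimes> c = c \<otimes> z [^] i"
    if c: "c \<in> carrier K" "z \<otimes> c = c \<otimes> z" for c i
  proof -
    have pow: "z [^] (k::nat) \<otimes> c = c \<otimes> z [^] k" for k
      using K.group_commutes_pow[OF c(2) z c(1)] .
    have "inv p \<otimes> c = c \<otimes> inv p" if "p \<in> carrier K" "p \<otimes> c = c \<otimes> p" for p
    proof -
      have "inv p \<otimes> c = inv p \<otimes> (c \<otimes> p) \<otimes> inv p"
        using that(1) c(1) by (simp add: K.m_assoc)
      also have "\<dots> = c \<otimes> inv p"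
        unfolding that(2)[symmetric] using that(1) c(1) by (simp flip: K.m_assoc)
      finally show ?thesis .
    qed
    from this[OF K.nat_pow_closed[OF z] pow] pow show ?thesis
      by (cases "i < 0") (simp_all only: int_pow_def2 if_True if_False)
  qed
  have zx: "z \<otimes> x = x \<otimes> z" using x by (simp add: z_def K.m_assoc)
  have zy: "z \<otimes> y = y \<otimes> z"
    unfolding z_def rel using K.group_commutes_pow[OF HOL.refl y y] .
  have shift: "c \<otimes> (z [^] (i::int) \<otimes> p) = z [^] i \<otimes> (c \<otimes> p)"
    if "c = x \<or> c = y" "p \<in> carrier K" for c i p
    using that x y z comm[of c i] zx zy by (auto simp flip: K.m_assoc)
  have zz: "z [^] (i::int) \<otimes> (z \<otimes> p) = z [^] (i + 1) \<otimes> p" if "p \<in> carrier K" for i p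
    using that z by (simp add: K.int_pow_mult K.m_assoc)
  obtain l d where l: "n = (l, d, False)" "reduced l" "2 * int m dvd d - dg l"
    using n by (rule NG_carrierE)
  obtain i where i: "d - dg l = 2 * int m * i" using l(3) by (auto simp: dvd_def)
  have val: "NG_val K x y (k, c, e) = z [^] i' \<otimes> ?P k \<one>"
    if "c - dg k = 2 * int m * i'" for k c e i'
    by (simp add: NG_val_def z_def[symmetric] that)
  note n_val = val[OF i, of False, folded l(1)]
  show "NG_val K x y n \<in> carrier K" using n_val P z by simp
  show "NG_val K x y (emul xN n) = x \<otimes> NG_val K x y n"
  proof (cases "l \<noteq> [] \<and> hd l = 0")
    case True
    then obtain t where t: "l = 0 # t" by (cases l) auto
    have "int m + d - dg t = 2 * int m * (i + 1)" using i t by (simp add: algebra_simps)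
    from val[OF this] have "NG_val K x y (emul xN n) = z [^] (i + 1) \<otimes> ?P t \<one>"
      by (simp add: l xN_def emul_NG push_Cons t)
    moreover have "x \<otimes> (x \<otimes> ?P t \<one>) = z \<otimes> ?P t \<one>"
      using x P by (simp add: z_def K.m_assoc)
    ultimately show ?thesis using n_val t P x z zz by (simp add: shift syl_val_def)
  next
    case False
    then have "push 0 l = 0 # l" by (cases l) (simp_all add: push_Cons)
    moreover have "int m + d - dg (0 # l) = 2 * int m * i" using i by simp
    note val[OF this]
    ultimately show ?thesis using n_val P x z
      by (simp add: l xN_def emul_NG shift) (simp add: syl_val_def)
  qed
  show "NG_val K x y (emul yN n) = y \<otimes> NG_val K x y n"
  proof (cases "l \<noteq> [] \<and> hd l \<noteq> 0")
    case True
    then obtain k t where t: "l = k # t" "k \<noteq> 0" by (cases l) auto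
    have k: "k < m" using l(2) t by (simp add: reduced_Cons)
    have yk: "y \<otimes> (y [^] k \<otimes> ?P t \<one>) = y [^] Suc k \<otimes> ?P t \<one>"
      using y P K.nat_pow_Suc2[OF y, of k] by (simp flip: K.m_assoc)
    show ?thesis
    proof (cases "Suc k = m")
      case True
      have "2 + d - dg t = 2 * int m * (i + 1)" using i t True by (simp add: algebra_simps)
      from val[OF this] have "NG_val K x y (emul yN n) = z [^] (i + 1) \<otimes> ?P t \<one>"
        using t True by (simp add: l yN_def emul_NG push_Cons)
      moreover have "y \<otimes> (y [^] k \<otimes> ?P t \<one>) = z \<otimes> ?P t \<one>"
        unfolding yk True z_def rel ..
      ultimately show ?thesis using n_val t P y z zz by (simp add: shift syl_val_def)
    next
      case False
      then have "push 1 l = Suc k # t" using t k by (simp add: push_Cons)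
      moreover have "2 + d - dg (Suc k # t) = 2 * int m * i" using i t by simp
      note val[OF this]
      moreover have "y \<otimes> (z [^] i \<otimes> (y [^] k \<otimes> ?P t \<one>))
          = z [^] i \<otimes> (y [^] Suc k \<otimes> ?P t \<one>)"
        unfolding yk[symmetric] using P y by (intro shift) auto
      moreover have "syl_val K x y k = y [^] k" "syl_val K x y (Suc k) = y [^] Suc k"
        using t by (simp_all add: syl_val_def)
      ultimately show ?thesis using n_val t
        by (simp add: l yN_def emul_NG del: nat_pow_Suc)
    qed
  next
    case False
    then have "push 1 l = 1 # l" by (cases l) (simp_all add: push_Cons)
    moreover have "2 + d - dg (1 # l) = 2 * int m * i" using i by simp
    note val[OF this]
    ultimately show ?thesis using n_val P y z
      by (simp add: l yN_def emul_NG shift) (simp add: syl_val_def)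
  qed
qed

text \<open>The pairs \<open>(p, k)\<close> for which evaluation turns multiplication by \<open>p\<close> into multiplication by \<open>k\<close> are
  closed under products and inverses; so it suffices to know them for \<open>x\<close> and \<open>y\<close>.\<close>

definition acts_as :: "('k, 'z) monoid_scheme \<Rightarrow> 'k \<Rightarrow> 'k \<Rightarrow> elt \<Rightarrow> 'k \<Rightarrow> bool" where
  "acts_as K x y p k \<longleftrightarrow> p \<in> carrier NG \<and> k \<in> carrier K \<and>
     (\<forall>n\<in>carrier NG. NG_val K x y (emul p n) = k \<otimes>\<^bsub>K\<^esub> NG_val K x y n)"

lemma acts_as_mult:
  fixes K :: "('k, 'z) monoid_scheme" (structure)
  assumes K: "group K" "x \<in> carrier K" "y \<in> carrier K" "x \<otimes> x = y [^] m"
    and p: "acts_as K x y p k" and q: "acts_as K x y q l"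
  shows "acts_as K x y (emul p q) (k \<otimes> l)"
proof -
  interpret K: group K by (rule K)
  have pq: "p \<in> carrier NG" "q \<in> carrier NG" "k \<in> carrier K" "l \<in> carrier K"
    using p q by (simp_all add: acts_as_def)
  have "NG_val K x y (emul (emul p q) n) = k \<otimes> l \<otimes> NG_val K x y n" if n: "n \<in> carrier NG" for n
  proof -
    have "emul q n \<in> carrier NG" using NG.m_closed[OF pq(2) n] by simp
    then have "NG_val K x y (emul p (emul q n)) = k \<otimes> (l \<otimes> NG_val K x y n)"
      using p q n unfolding acts_as_def by metis
    moreover have "emul (emul p q) n = emul p (emul q n)" using pq n by (simp add: emul_assoc)
    ultimately show ?thesis using NG_val_generators(1)[OF K n] pq by (simp add: K.m_assoc)
  qed
  moreover have "emul p q \<in> carrier NG" using NG.m_closed[OF pq(1,2)] by simp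
  ultimately show ?thesis using pq by (simp add: acts_as_def)
qed

lemma acts_as_inv:
  fixes K :: "('k, 'z) monoid_scheme" (structure)
  assumes K: "group K" "x \<in> carrier K" "y \<in> carrier K" "x \<otimes> x = y [^] m"
    and p: "acts_as K x y p k"
  shows "acts_as K x y (einv p) (inv k)"
proof -
  interpret K: group K by (rule K)
  have pk: "p \<in> carrier NG" "k \<in> carrier K" using p by (simp_all add: acts_as_def)
  have "NG_val K x y (emul (einv p) n) = inv k \<otimes> NG_val K x y n" if n: "n \<in> carrier NG" for n
  proof -
    have c: "emul (einv p) n \<in> carrier NG" using NG.m_closed[OF einv_NG[OF pk(1)] n] by simp
    then have "NG_val K x y (emul p (emul (einv p) n)) = k \<otimes> NG_val K x y (emul (einv p) n)"
      using p unfolding acts_as_def by blast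
    moreover have "emul p (emul (einv p) n) = n" using pk n by simp
    ultimately show ?thesis
      using NG_val_generators(1)[OF K c] pk by (simp add: K.inv_solve_left K.m_assoc[symmetric])
  qed
  then show ?thesis using pk einv_NG by (simp add: acts_as_def)
qed

lemma acts_as_pow:
  fixes K :: "('k, 'z) monoid_scheme" (structure)
  assumes K: "group K" "x \<in> carrier K" "y \<in> carrier K" "x \<otimes> x = y [^] m"
    and p: "acts_as K x y p k"
  shows "acts_as K x y (p [^]\<^bsub>NG\<^esub> i) (k [^] (i::nat))"
proof (induction i)
  case 0
  interpret K: group K by (rule K)
  show ?case using NG_val_generators(1)[OF K] by (auto simp: acts_as_def)
next
  case (Suc i)
  then show ?case using acts_as_mult[OF K Suc p] by simp
qed

section \<open>The dihedral Artin group\<close>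

lemma alt_word_add:
  "alt_word (n + k) x y = alt_word n x y @ (if even n then alt_word k x y else alt_word k y x)"
  by (induction n arbitrary: x y) simp_all

lemma alt_word_even_Suc:
  "alt_word (2 * Suc k) x y = alt_word (2 * k) x y @ [(x, True), (y, True)]"
proof -
  have "alt_word 2 x y = [(x, True), (y, True)]" by (simp add: numeral_2_eq_2)
  moreover have "2 * Suc k = 2 * k + 2" by simp
  ultimately show ?thesis using alt_word_add[of "2 * k" 2 x y] by (simp only:) simp
qed

text \<open>With \<open>r = m div 2\<close> these are \<open>a = y^-r x\<close> and \<open>b = a^-1 y\<close>, both of degree \<open>1\<close>.\<close>

definition gen_val :: "artin_gen \<Rightarrow> elt" where
  "gen_val g = (case g of gen_a \<Rightarrow> ([Suc (m div 2), 0], 1, False) | gen_b \<Rightarrow> ([0, Suc (m div 2)], 1, False))"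

definition artin_val :: "artin_gen word \<Rightarrow> elt" where
  "artin_val w = foldr (\<lambda>(g, s). emul (if s then gen_val g else einv (gen_val g))) w ([], 0, False)"

lemma m_split: "m = Suc (2 * (m div 2))" "Suc (m div 2) < m" "0 < m div 2"
  using odd_m m_ge by (auto elim: oddE)

lemma gen_val_closed: "gen_val g \<in> carrier NG"
proof -
  define r where "r = m div 2"
  have m: "m = Suc (2 * r)" "Suc r < m" unfolding r_def by (rule m_split(1), rule m_split(2))
  have "(1 :: int) - (int m + 2 * int (Suc r)) = 2 * int m * (- 1)" by (simp add: m(1))
  then have "2 * int m dvd 1 - (int m + 2 * int (Suc r))" by (metis dvd_triv_left)
  then show ?thesis using m(2)
    by (cases g) (simp_all add: gen_val_def reduced_Cons algebra_simps flip: r_def)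
qed

lemma letter_closed: "(if s then gen_val g else einv (gen_val g)) \<in> carrier NG"
  using gen_val_closed einv_NG by simp

lemma artin_val_simps [simp]:
  "artin_val [] = ([], 0, False)"
  "artin_val ((g, s) # w) = emul (if s then gen_val g else einv (gen_val g)) (artin_val w)"
  by (simp_all add: artin_val_def)

lemma artin_val_closed: "artin_val w \<in> carrier NG"
proof (induction w)
  case (Cons a w)
  obtain g s where "a = (g, s)" by (cases a)
  then show ?case using NG.m_closed[OF letter_closed Cons] by simp
qed (use NG.one_closed in simp)

lemma artin_val_append: "artin_val (u @ v) = emul (artin_val u) (artin_val v)"
proof (induction u)
  case (Cons a u)
  obtain g s where a: "a = (g, s)" by (cases a)
  show ?case
    using Cons NG.m_assoc[OF letter_closed[of s g] artin_val_closed[of u] artin_val_closed[of v]]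
    by (simp add: a)
qed simp

lemma artin_val_ab: "artin_val [(gen_a, True), (gen_b, True)] = yN"
proof -
  have "(Suc (m div 2) + Suc (m div 2)) mod m = 1"
    using m_split(1) m_pos(3) by (metis add_Suc_right add_Suc_shift mod_add_self1 mod_less mult_2 add.commute plus_1_eq_Suc)
  then show ?thesis by (simp add: gen_val_def emul_NG push_Cons yN_def)
qed

lemma artin_val_ba: "artin_val [(gen_b, True), (gen_a, True)] = ([0, 1, 0], 2, False)"
proof -
  have "(Suc (m div 2) + Suc (m div 2)) mod m = 1"
    using m_split(1) m_pos(3) by (metis add_Suc_right add_Suc_shift mod_add_self1 mod_less mult_2 add.commute plus_1_eq_Suc)
  then show ?thesis by (simp add: gen_val_def emul_NG push_Cons)
qed

text \<open>Among the odd lengths up to \<open>m\<close>, the two alternating words agree exactly for length \<open>m\<close>,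
  where both are \<open>x\<close>; this is why the defining relation holds in \<open>N\<close>.\<close>

lemma artin_val_alternating:
  assumes "k \<le> m div 2"
  shows "artin_val (alt_word (Suc (2 * k)) gen_a gen_b) =
      (if k = m div 2 then ([0], int m, False) else ([Suc (m div 2) + k, 0], 1 + 2 * int k, False)) \<and>
    artin_val (alt_word (Suc (2 * k)) gen_b gen_a) =
      (if k = m div 2 then ([0], int m, False) else ([0, Suc (m div 2) + k], 1 + 2 * int k, False))"
  using assms
proof (induction k)
  case 0
  then show ?case using m_split(3) by (simp add: gen_val_def emul_NG push_Cons)
next
  case (Suc k)
  define r where "r = m div 2"
  have m: "m = Suc (2 * r)" unfolding r_def by (rule m_split(1))
  have k: "k < r" using Suc.prems unfolding r_def by simp
  have im: "int m = 1 + 2 * int r" by (simp add: m)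
  have step: "artin_val (alt_word (Suc (2 * Suc k)) x y) =
      emul (artin_val [(x, True), (y, True)]) (artin_val (alt_word (Suc (2 * k)) x y))" for x y
    using artin_val_append[of "[(x, True), (y, True)]" "alt_word (Suc (2 * k)) x y"]
    by (simp del: artin_val_simps)
  have IH: "artin_val (alt_word (Suc (2 * k)) gen_a gen_b) = ([Suc r + k, 0], 1 + 2 * int k, False)"
      "artin_val (alt_word (Suc (2 * k)) gen_b gen_a) = ([0, Suc r + k], 1 + 2 * int k, False)"
    using Suc.IH k unfolding r_def by auto
  have md: "Suc (Suc (r + k)) mod m = (if Suc k = r then 0 else Suc (Suc (r + k)))"
  proof (cases "Suc k = r")
    case True
    then have "Suc (Suc (r + k)) = m" using m by linarith
    then show ?thesis using True by simp
  next
    case False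
    then have "Suc (Suc (r + k)) < m" using m k by linarith
    then show ?thesis using False by simp
  qed
  have d: "int m = 3 + 2 * int k" if "Suc k = r" using that im by simp
  have "artin_val (alt_word (Suc (2 * Suc k)) gen_a gen_b) = (if Suc k = m div 2 then ([0], int m, False)
      else ([Suc (m div 2) + Suc k, 0], 1 + 2 * int (Suc k), False))"
    unfolding step artin_val_ab IH using md d
    by (auto simp: yN_def emul_NG push_Cons simp flip: r_def)
  moreover have "artin_val (alt_word (Suc (2 * Suc k)) gen_b gen_a) = (if Suc k = m div 2 then ([0], int m, False)
      else ([0, Suc (m div 2) + Suc k], 1 + 2 * int (Suc k), False))"
    unfolding step artin_val_ba IH using md d
    by (auto simp: emul_NG push_Cons simp flip: r_def)
  ultimately show ?case by blast
qed

lemma artin_val_alt_word: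
  "artin_val (alt_word m gen_a gen_b) = xN" "artin_val (alt_word m gen_b gen_a) = xN"
  using artin_val_alternating[of "m div 2"] m_split(1) by (simp_all add: xN_def)

abbreviation "artin_rel \<equiv> {(alt_word m gen_a gen_b, alt_word m gen_b gen_a)}"

lemma artin_val_respects: "pres_eq artin_rel u v \<Longrightarrow> artin_val u = artin_val v"
proof (induction rule: pres_eq.induct)
  case (cancel u x s v)
  have "gen_val x \<in> carrier EG" using gen_val_closed[of x] by simp
  then have "artin_val [(x, s), (x, \<not> s)] = ([], 0, False)"
    by (auto simp: einv_closed)
  then show ?case unfolding artin_val_append by (simp only: emul_one)
next
  case (rel l r u v)
  then show ?case by (auto simp: artin_val_append artin_val_alt_word)
qed auto

lemma artin_val_inv_word: "artin_val (inv_word u) = einv (artin_val u)"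
proof -
  have "emul (artin_val (inv_word u)) (artin_val u) = ([], 0, False)"
    using artin_val_respects[OF pres_eq_inv_word] artin_val_append by simp
  then show ?thesis
    using NG.inv_equality[OF _ artin_val_closed artin_val_closed, of "inv_word u" u]
      inv_NG[OF artin_val_closed[of u]] by simp
qed

lemma artin_val_surj: "n \<in> carrier NG \<Longrightarrow> \<exists>w. n = artin_val w"
proof (induction rule: NG_induct)
  case one
  show ?case by (rule exI[of _ "[]"]) simp
next
  case (x n)
  then show ?case by (metis artin_val_append artin_val_alt_word(1))
next
  case (inv_x n)
  then show ?case by (metis artin_val_append artin_val_alt_word(1) artin_val_inv_word)
next
  case (y n)
  then show ?case by (metis artin_val_append artin_val_ab)
qed

text \<open>Evaluation of normal forms in the presented group is inverse to evaluation of words in \<open>N\<close>.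
  The equation \<open>x x = y^m\<close> for the classes of \<open>aba\<dots>a\<close> and \<open>ab\<close> comes from replacing the second of two
  consecutive words \<open>aba\<dots>a\<close> by \<open>bab\<dots>b\<close>.\<close>

theorem dihedral_artin_iso_NG: "dihedral_artin m \<cong> NG"
proof -
  define K where "K = dihedral_artin m"
  define cl where "cl = pres_class artin_rel"
  define x where "x = cl (alt_word m gen_a gen_b)"
  define y where "y = cl [(gen_a, True), (gen_b, True)]"
  have K_def': "K = presented_group artin_rel" by (simp add: K_def dihedral_artin_def)
  have K: "group K" unfolding K_def' by (rule group_presented_group)
  interpret K: group K by (rule K)
  have carr: "carrier K = range cl" by (simp add: K_def' carrier_presented_group cl_def)
  have mult: "cl u \<otimes>\<^bsub>K\<^esub> cl v = cl (u @ v)" for u v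
    by (simp add: K_def' mult_presented_group cl_def)
  have one: "\<one>\<^bsub>K\<^esub> = cl []" by (simp add: K_def' one_presented_group cl_def)
  have cl [simp]: "cl u \<in> carrier K" for u by (simp add: carr)
  have inv_cl: "inv\<^bsub>K\<^esub> (cl u) = cl (inv_word u)" for u
  proof (rule K.inv_equality)
    show "cl (inv_word u) \<otimes>\<^bsub>K\<^esub> cl u = \<one>\<^bsub>K\<^esub>"
      unfolding mult one unfolding cl_def pres_class_eq_iff by (rule pres_eq_inv_word)
  qed simp_all
  have y_pow: "y [^]\<^bsub>K\<^esub> k = cl (alt_word (2 * k) gen_a gen_b)" for k :: nat
  proof (induction k)
    case (Suc k)
    then show ?case using mult by (simp add: y_def alt_word_even_Suc del: mult_Suc_right)
  qed (simp add: one)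
  have "cl (alt_word m gen_a gen_b) = cl (alt_word m gen_b gen_a)"
    unfolding cl_def pres_class_eq_iff
    using pres_eq.rel[of "alt_word m gen_a gen_b" "alt_word m gen_b gen_a" artin_rel "[]" "[]"] by simp
  then have "x \<otimes>\<^bsub>K\<^esub> x = cl (alt_word m gen_a gen_b @ alt_word m gen_b gen_a)"
    using mult by (metis x_def)
  also have "\<dots> = y [^]\<^bsub>K\<^esub> m"
    unfolding y_pow using alt_word_add[of m m gen_a gen_b] odd_m by (simp add: mult_2)
  finally have rel: "x \<otimes>\<^bsub>K\<^esub> x = y [^]\<^bsub>K\<^esub> m" .
  have xy: "x \<in> carrier K" "y \<in> carrier K" by (simp_all add: x_def y_def)
  note KK = K xy rel
  have acts_x: "acts_as K x y xN x" and acts_y: "acts_as K x y yN y"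
    using NG_val_generators(2,3)[OF KK] xy xN_closed yN_closed by (simp_all add: acts_as_def)
  define r where "r = m div 2"
  have m: "m = Suc (2 * r)" "Suc r < m" unfolding r_def by (rule m_split(1), rule m_split(2))
  have y_pow_r: "emul (yN [^]\<^bsub>NG\<^esub> r) (gen_val gen_a) = xN"
  proof -
    have "artin_val (alt_word (2 * k) gen_a gen_b) = yN [^]\<^bsub>NG\<^esub> k" for k :: nat
    proof (induction k)
      case (Suc k)
      then show ?case using artin_val_append artin_val_ab by (simp add: alt_word_even_Suc del: mult_Suc_right)
    qed simp
    moreover have "alt_word m gen_a gen_b = alt_word (2 * r) gen_a gen_b @ [(gen_a, True)]"
      using alt_word_add[of "2 * r" 1 gen_a gen_b] m(1) by simp
    ultimately show ?thesis
      using artin_val_append[of "alt_word (2 * r) gen_a gen_b" "[(gen_a, True)]"] artin_val_alt_word(1)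
        gen_val_closed[of gen_a] by simp
  qed
  have aE: "gen_val gen_a \<in> carrier EG" "gen_val gen_b \<in> carrier EG"
    using gen_val_closed[of gen_a] gen_val_closed[of gen_b] by simp_all
  have yr: "yN [^]\<^bsub>NG\<^esub> r \<in> carrier NG" using yN_closed by (rule NG.nat_pow_closed)
  have acts_a: "acts_as K x y (gen_val gen_a) (cl [(gen_a, True)])"
  proof -
    have "acts_as K x y (emul (einv (yN [^]\<^bsub>NG\<^esub> r)) xN) (inv\<^bsub>K\<^esub> (y [^]\<^bsub>K\<^esub> r) \<otimes>\<^bsub>K\<^esub> x)"
      by (rule acts_as_mult[OF KK acts_as_inv[OF KK acts_as_pow[OF KK acts_y]] acts_x])
    moreover have "emul (einv (yN [^]\<^bsub>NG\<^esub> r)) xN = gen_val gen_a"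
      unfolding y_pow_r[symmetric] using aE yr by simp
    moreover have "y [^]\<^bsub>K\<^esub> r \<otimes>\<^bsub>K\<^esub> cl [(gen_a, True)] = x"
      unfolding y_pow mult x_def using alt_word_add[of "2 * r" 1 gen_a gen_b] m(1) by simp
    then have "inv\<^bsub>K\<^esub> (y [^]\<^bsub>K\<^esub> r) \<otimes>\<^bsub>K\<^esub> x = cl [(gen_a, True)]"
      using xy by (metis K.inv_solve_left K.nat_pow_closed cl)
    ultimately show ?thesis by simp
  qed
  have acts_b: "acts_as K x y (gen_val gen_b) (cl [(gen_b, True)])"
  proof -
    have "acts_as K x y (emul (einv (gen_val gen_a)) yN) (inv\<^bsub>K\<^esub> (cl [(gen_a, True)]) \<otimes>\<^bsub>K\<^esub> y)"
      by (rule acts_as_mult[OF KK acts_as_inv[OF KK acts_a] acts_y])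
    moreover have "emul (einv (gen_val gen_a)) yN = gen_val gen_b"
      unfolding artin_val_ab[symmetric] using aE by simp
    moreover have "cl [(gen_a, True)] \<otimes>\<^bsub>K\<^esub> cl [(gen_b, True)] = y" by (simp add: mult y_def)
    then have "inv\<^bsub>K\<^esub> (cl [(gen_a, True)]) \<otimes>\<^bsub>K\<^esub> y = cl [(gen_b, True)]"
      using xy by (metis K.inv_solve_left cl)
    ultimately show ?thesis by simp
  qed
  have acts_gen: "acts_as K x y (gen_val g) (cl [(g, True)])" for g
    using acts_a acts_b by (cases g) auto
  have acts: "acts_as K x y (artin_val w) (cl w)" for w
  proof (induction w)
    case Nil
    show ?case using acts_as_pow[OF KK acts_x, of 0] by (simp add: one)
  next
    case (Cons c w)
    obtain g s where c: "c = (g, s)" by (cases c)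
    have "acts_as K x y (if s then gen_val g else einv (gen_val g)) (cl [(g, s)])"
      using acts_gen acts_as_inv[OF KK acts_gen[of g]] inv_cl[of "[(g, True)]"] by (cases s) auto
    from acts_as_mult[OF KK this Cons] show ?case by (simp add: c mult)
  qed
  have val: "NG_val K x y (artin_val w) = cl w" for w
  proof -
    have "NG_val K x y (emul (artin_val w) ([], 0, False)) = cl w \<otimes>\<^bsub>K\<^esub> NG_val K x y ([], 0, False)"
      using acts[of w] NG.one_closed unfolding acts_as_def NG_simps(3) by blast
    then show ?thesis using artin_val_closed[of w] by (simp add: NG_val_def)
  qed
  have "NG_val K x y \<in> iso NG K"
  proof (rule isoI)
    show "NG_val K x y \<in> hom NG K"
    proof (rule homI)
      fix p q assume "p \<in> carrier NG" "q \<in> carrier NG"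
      then obtain u v where "p = artin_val u" "q = artin_val v" using artin_val_surj by metis
      then show "NG_val K x y (p \<otimes>\<^bsub>NG\<^esub> q) = NG_val K x y p \<otimes>\<^bsub>K\<^esub> NG_val K x y q"
        using val[of "u @ v"] by (simp add: artin_val_append val mult)
    qed (use NG_val_generators(1)[OF KK] in auto)
    show "bij_betw (NG_val K x y) (carrier NG) (carrier K)"
    proof (rule bij_betw_imageI)
      show "inj_on (NG_val K x y) (carrier NG)"
      proof (rule inj_onI)
        fix p q assume "p \<in> carrier NG" "q \<in> carrier NG" and eq: "NG_val K x y p = NG_val K x y q"
        then obtain u v where uv: "p = artin_val u" "q = artin_val v" using artin_val_surj by metis
        then have "pres_eq artin_rel u v" using eq val by (simp add: cl_def pres_class_eq_iff)
        then show "p = q" using artin_val_respects uv by simp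
      qed
      show "NG_val K x y ` carrier NG = carrier K"
      proof (intro equalityI subsetI)
        fix k assume "k \<in> NG_val K x y ` carrier NG"
        then obtain n where "n \<in> carrier NG" "k = NG_val K x y n" by (rule imageE)
        then show "k \<in> carrier K" using artin_val_surj[of n] val by auto
      next
        fix k assume "k \<in> carrier K"
        then obtain w where "k = cl w" unfolding carr by (rule rangeE)
        then have "k = NG_val K x y (artin_val w)" by (simp add: val)
        then show "k \<in> NG_val K x y ` carrier NG" using artin_val_closed by (rule image_eqI)
      qed
    qed
  qed
  then have "NG \<cong> K" unfolding is_iso_def by blast
  then show ?thesis using NG.iso_sym by (simp add: K_def)
qed

end

section \<open>Conjugacy criteria in the semidirect product\<close>

locale semidirect = K: group K + H: group H
  for K :: "('k, 'p) monoid_scheme" and H :: "('h, 'r) monoid_scheme" (structure) +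
  fixes \<phi> :: "'h \<Rightarrow> 'k \<Rightarrow> 'k"
  assumes action: "\<phi> \<in> hom H (AutoGroup K)"
begin

abbreviation "G \<equiv> semidirect_product K H \<phi>"

lemma semidirect_simps [simp]:
  "carrier G = carrier K \<times> carrier H" "\<one>\<^bsub>G\<^esub> = (\<one>\<^bsub>K\<^esub>, \<one>)"
  "p \<otimes>\<^bsub>G\<^esub> q = (fst p \<otimes>\<^bsub>K\<^esub> \<phi> (snd p) (fst q), snd p \<otimes> snd q)"
  by (simp_all add: semidirect_product_def split: prod.split)

lemma action_auto: "h \<in> carrier H \<Longrightarrow> \<phi> h \<in> hom K K" "h \<in> carrier H \<Longrightarrow> bij_betw (\<phi> h) (carrier K) (carrier K)"
  using hom_in_carrier[OF action, of h] by (auto simp: AutoGroup_def auto_def Bij_def)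

lemma action_iso: "h \<in> carrier H \<Longrightarrow> \<phi> h \<in> iso K K"
  using action_auto by (simp add: iso_def)

lemma action_closed [simp]: "h \<in> carrier H \<Longrightarrow> n \<in> carrier K \<Longrightarrow> \<phi> h n \<in> carrier K"
  using action_auto(1) by (rule hom_in_carrier)

lemma action_mult [simp]: "h \<in> carrier H \<Longrightarrow> n \<in> carrier K \<Longrightarrow> n' \<in> carrier K \<Longrightarrow>
    \<phi> h (n \<otimes>\<^bsub>K\<^esub> n') = \<phi> h n \<otimes>\<^bsub>K\<^esub> \<phi> h n'"
  using action_auto(1) by (rule hom_mult)

lemma action_comp [simp]:
  assumes "h \<in> carrier H" "h' \<in> carrier H" "n \<in> carrier K"
  shows "\<phi> (h \<otimes> h') n = \<phi> h (\<phi> h' n)"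
proof -
  have "\<phi> h \<in> Bij (carrier K)" "\<phi> h' \<in> Bij (carrier K)"
    using hom_in_carrier[OF action] assms by (auto simp: AutoGroup_def auto_def)
  then show ?thesis using hom_mult[OF action assms(1,2)] assms(3)
    by (simp add: AutoGroup_def BijGroup_def compose_def)
qed

lemma action_one [simp]:
  assumes "n \<in> carrier K"
  shows "\<phi> \<one> n = n"
proof -
  have "\<phi> \<one> (\<phi> \<one> n) = \<phi> \<one> n"
    using action_comp[of "\<one>" "\<one>" n] assms by simp
  then show ?thesis
    using action_auto(2)[of "\<one>"] assms by (auto simp: bij_betw_def dest: inj_onD)
qed

lemma action_of_one [simp]: "h \<in> carrier H \<Longrightarrow> \<phi> h \<one>\<^bsub>K\<^esub> = \<one>\<^bsub>K\<^esub>"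
  using hom_one[OF action_auto(1) K.is_group K.is_group] .

lemma group_semidirect: "group G"
proof (rule groupI)
  fix p assume "p \<in> carrier G"
  then have "(\<phi> (inv (snd p)) (inv\<^bsub>K\<^esub> (fst p)), inv (snd p)) \<otimes>\<^bsub>G\<^esub> p = \<one>\<^bsub>G\<^esub>"
    by (auto simp flip: action_mult)
  then show "\<exists>q\<in>carrier G. q \<otimes>\<^bsub>G\<^esub> p = \<one>\<^bsub>G\<^esub>"
    using \<open>p \<in> carrier G\<close> by (intro bexI[of _ "(\<phi> (inv (snd p)) (inv\<^bsub>K\<^esub> (fst p)), inv (snd p))"]) auto
qed (auto simp: K.m_assoc H.m_assoc)

end

lemma (in group) conjugate_in_iff:
  assumes "x \<in> carrier G" "y \<in> carrier G"
  shows "conjugate_in G x y \<longleftrightarrow> (\<exists>g\<in>carrier G. g \<otimes> x = y \<otimes> g)"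
  using assms unfolding conjugate_in_def by (metis inv_solve_right m_closed)

locale artin_extension = odd_dihedral m + semidirect "dihedral_artin m" H \<phi>
  for m :: nat and H :: "('h, 'r) monoid_scheme" (structure) and \<phi> +
  fixes \<Theta> :: "artin_gen word set \<Rightarrow> elt"
  assumes \<Theta>: "\<Theta> \<in> iso (dihedral_artin m) NG"
begin

abbreviation "A \<equiv> dihedral_artin m"

lemma \<Theta>_hom: "\<Theta> \<in> hom A NG" and \<Theta>_bij: "bij_betw \<Theta> (carrier A) (carrier NG)"
  using \<Theta> by (simp_all add: iso_def)

lemma \<Theta>_closed [simp]: "a \<in> carrier A \<Longrightarrow> \<Theta> a \<in> carrier NG"
  using \<Theta>_hom by (rule hom_in_carrier)

lemma \<Theta>_EG: "a \<in> carrier A \<Longrightarrow> \<Theta> a \<in> carrier EG"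
  using \<Theta>_closed by simp

lemma \<Theta>_mult: "a \<in> carrier A \<Longrightarrow> b \<in> carrier A \<Longrightarrow> \<Theta> (a \<otimes>\<^bsub>A\<^esub> b) = emul (\<Theta> a) (\<Theta> b)"
  using hom_mult[OF \<Theta>_hom] by simp

lemma \<Theta>_one: "\<Theta> \<one>\<^bsub>A\<^esub> = ([], 0, False)"
  using hom_one[OF \<Theta>_hom K.is_group NG.is_group] by simp

lemma \<Theta>_inject: "a \<in> carrier A \<Longrightarrow> b \<in> carrier A \<Longrightarrow> \<Theta> a = \<Theta> b \<longleftrightarrow> a = b"
  using \<Theta>_bij by (auto simp: bij_betw_def dest: inj_onD)

lemma \<Theta>_surj: "p \<in> carrier NG \<Longrightarrow> \<exists>a\<in>carrier A. p = \<Theta> a"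
  using \<Theta>_bij unfolding bij_betw_def by blast

text \<open>Such an \<open>e\<close> exists for every \<open>h\<close>, but it is unique only up to the centre. Programs use one choice
  for each letter and multiply along words; hence the same \<open>h\<close> can be accompanied by different \<open>e\<close>.\<close>

definition induces :: "elt \<Rightarrow> 'h \<Rightarrow> bool" where
  "induces e h \<longleftrightarrow> e \<in> carrier EG \<and> h \<in> carrier H \<and> (\<forall>a\<in>carrier A. \<Theta> (\<phi> h a) = conj_by e (\<Theta> a))"

lemma induces_one: "induces ([], 0, False) \<one>"
  using \<Theta>_EG by (auto simp: induces_def simp del: EG_simps(1)) (use EG.one_closed in simp)

lemma induces_mult: "induces e h \<Longrightarrow> induces e' h' \<Longrightarrow> induces (emul e e') (h \<otimes> h')"
  using \<Theta>_EG by (simp add: induces_def conj_by_mult emul_closed)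

lemma ex_induces:
  assumes "h \<in> carrier H"
  shows "\<exists>e. induces e h"
proof -
  have "inv_into (carrier A) \<Theta> \<in> iso NG A" using \<Theta> by (rule K.iso_set_sym)
  from iso_set_trans[OF iso_set_trans[OF this action_iso[OF assms]] \<Theta>]
  have "\<Theta> \<circ> (\<phi> h \<circ> inv_into (carrier A) \<Theta>) \<in> iso NG NG" .
  then obtain e where e: "e \<in> carrier EG"
      "\<And>n. n \<in> carrier NG \<Longrightarrow> (\<Theta> \<circ> (\<phi> h \<circ> inv_into (carrier A) \<Theta>)) n = conj_by e n"
    by (rule iso_NG_is_conjugation) blast
  have "\<Theta> (\<phi> h a) = conj_by e (\<Theta> a)" if "a \<in> carrier A" for a
    using e(2)[OF \<Theta>_closed[OF that]] \<Theta>_bij that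
    by (simp add: bij_betw_def inv_into_f_f)
  then show ?thesis using e(1) assms unfolding induces_def by blast
qed

text \<open>The element \<open>p\<close> stands for \<open>g = (a, h)\<close> with \<open>h\<close> replaced by \<open>e\<close>. Unlike the first component of a
  product, the product of representing elements involves no action; the first component of \<open>g\<close> is
  recovered as \<open>p e^-1\<close>.\<close>

definition represents :: "elt \<Rightarrow> elt \<Rightarrow> artin_gen word set \<times> 'h \<Rightarrow> bool" where
  "represents p e g \<longleftrightarrow> g \<in> carrier G \<and> induces e (snd g) \<and> p = emul (\<Theta> (fst g)) e"

lemma represents_one: "represents ([], 0, False) ([], 0, False) \<one>\<^bsub>G\<^esub>"
  using induces_one by (simp add: represents_def \<Theta>_one)

lemma represents_mult:
  assumes "represents p e g" "represents p' e' g'"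
  shows "represents (emul p p') (emul e e') (g \<otimes>\<^bsub>G\<^esub> g')"
proof -
  obtain a h a' h' where g: "g = (a, h)" "g' = (a', h')" by (cases g; cases g') auto
  have *: "a \<in> carrier A" "a' \<in> carrier A" "h \<in> carrier H" "h' \<in> carrier H" "e \<in> carrier EG"
     "e' \<in> carrier EG" "induces e h" "induces e' h'" and p: "p = emul (\<Theta> a) e" "p' = emul (\<Theta> a') e'"
    using assms unfolding represents_def induces_def g by auto
  have "emul (\<Theta> (a \<otimes>\<^bsub>A\<^esub> \<phi> h a')) (emul e e') = emul p p'"
    using * \<Theta>_EG[of a] \<Theta>_EG[of a'] unfolding p
    by (simp add: \<Theta>_mult induces_def conj_by_def emul_assoc emul_closed einv_closed)
  then show ?thesis using * induces_mult unfolding represents_def g by simp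
qed

lemma emul_right_cancel:
  assumes "p \<in> carrier EG" "q \<in> carrier EG" "r \<in> carrier EG"
  shows "emul p r = emul q r \<longleftrightarrow> p = q"
proof
  assume "emul p r = emul q r"
  then have "emul (emul p r) (einv r) = emul (emul q r) (einv r)" by simp
  then show "p = q" using assms by (simp add: emul_assoc einv_closed)
qed simp

text \<open>The first components of the equation \<open>(k, l) (a, h) = (a', h') (k, l)\<close> are \<open>k \<phi>_l(a)\<close> and
  \<open>a' \<phi>_h'(k)\<close>. Multiplying by \<open>e'\<close> on the right turns the twisted \<open>\<phi>_h'(k)\<close> into \<open>k\<close> on the right
  of \<open>a' e'\<close>, which is \<open>p'\<close>.\<close>

lemma conjugator_iff:
  assumes rep: "represents p e g" "represents p' e' g'" and l: "induces f l"
  shows "(\<exists>k\<in>carrier A. (k, l) \<otimes>\<^bsub>G\<^esub> g = g' \<otimes>\<^bsub>G\<^esub> (k, l)) \<longleftrightarrow>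
    l \<otimes> snd g = snd g' \<otimes> l \<and> NG_conjugate (emul (conj_by f (emul p (einv e))) e') p'"
proof -
  obtain a h a' h' where g: "g = (a, h)" "g' = (a', h')" by (cases g; cases g') auto
  have *: "a \<in> carrier A" "a' \<in> carrier A" "h \<in> carrier H" "h' \<in> carrier H" "e \<in> carrier EG"
     "e' \<in> carrier EG" "induces e h" "induces e' h'" and p: "p = emul (\<Theta> a) e" "p' = emul (\<Theta> a') e'"
    using rep unfolding represents_def induces_def g by auto
  have f: "f \<in> carrier EG" "l \<in> carrier H" using l by (simp_all add: induces_def)
  note E = \<Theta>_EG[OF *(1)] \<Theta>_EG[OF *(2)] *(5,6) f
  have pe: "emul p (einv e) = \<Theta> a" using E by (simp add: p emul_assoc einv_closed)
  have *: "k \<otimes>\<^bsub>A\<^esub> \<phi> l a = a' \<otimes>\<^bsub>A\<^esub> \<phi> h' k \<longleftrightarrow> p' = conj_by (\<Theta> k) (emul (conj_by f (\<Theta> a)) e')"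
    if k: "k \<in> carrier A" for k
  proof -
    have kE: "\<Theta> k \<in> carrier EG" using k by (rule \<Theta>_EG)
    let ?q = "emul (conj_by f (\<Theta> a)) e'"
    have q: "?q \<in> carrier EG" using E by (simp add: emul_closed conj_by_closed)
    have "k \<otimes>\<^bsub>A\<^esub> \<phi> l a = a' \<otimes>\<^bsub>A\<^esub> \<phi> h' k \<longleftrightarrow> \<Theta> (k \<otimes>\<^bsub>A\<^esub> \<phi> l a) = \<Theta> (a' \<otimes>\<^bsub>A\<^esub> \<phi> h' k)"
      using k * f by (simp add: \<Theta>_inject)
    also have "\<dots> \<longleftrightarrow> emul (\<Theta> k) (conj_by f (\<Theta> a)) = emul (\<Theta> a') (conj_by e' (\<Theta> k))"
      using k * f l by (simp add: \<Theta>_mult induces_def)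
    also have "\<dots> \<longleftrightarrow> emul (emul (\<Theta> k) (conj_by f (\<Theta> a))) e' = emul (emul (\<Theta> a') (conj_by e' (\<Theta> k))) e'"
      using E kE by (intro emul_right_cancel[symmetric] emul_closed conj_by_closed)
    also have "\<dots> \<longleftrightarrow> emul (\<Theta> k) ?q = emul p' (\<Theta> k)"
      using E kE by (simp add: emul_closed conj_by_closed emul_assoc p) (simp add: conj_by_def emul_closed emul_assoc einv_closed)
    also have "\<dots> \<longleftrightarrow> p' = conj_by (\<Theta> k) ?q"
      using EG.inv_solve_right[of p' "emul (\<Theta> k) ?q" "\<Theta> k"] E kE q
      by (auto simp: conj_by_def emul_closed p)
    finally show ?thesis .
  qed
  have "(\<exists>k\<in>carrier A. (k, l) \<otimes>\<^bsub>G\<^esub> g = g' \<otimes>\<^bsub>G\<^esub> (k, l)) \<longleftrightarrow>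
      l \<otimes> h = h' \<otimes> l \<and> (\<exists>k\<in>carrier A. p' = conj_by (\<Theta> k) (emul (conj_by f (\<Theta> a)) e'))"
    unfolding g using * by auto
  also have "(\<exists>k\<in>carrier A. p' = conj_by (\<Theta> k) (emul (conj_by f (\<Theta> a)) e')) \<longleftrightarrow>
      NG_conjugate (emul (conj_by f (\<Theta> a)) e') p'"
    unfolding NG_conjugate_def using \<Theta>_surj \<Theta>_closed by metis
  finally show ?thesis by (simp add: g pe)
qed

lemma NG_conjugate_conj_by_left:
  assumes "k \<in> carrier NG" "p \<in> carrier EG"
  shows "NG_conjugate (conj_by k p) q \<longleftrightarrow> NG_conjugate p q"
proof
  assume "NG_conjugate (conj_by k p) q"
  then obtain j where "j \<in> carrier NG" "q = conj_by j (conj_by k p)" unfolding NG_conjugate_def by blast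
  then have "q = conj_by (emul j k) p" "emul j k \<in> carrier NG"
    using assms NG.m_closed[of j k] by (simp_all add: conj_by_mult)
  then show "NG_conjugate p q" unfolding NG_conjugate_def by blast
next
  assume "NG_conjugate p q"
  then obtain j where j: "j \<in> carrier NG" "q = conj_by j p" unfolding NG_conjugate_def by blast
  have "einv k \<in> carrier NG" using assms(1) by (rule einv_NG)
  then have "emul j (einv k) \<in> carrier NG" using NG.m_closed[of j "einv k"] j(1) by simp
  moreover have "q = conj_by (emul j (einv k)) (conj_by k p)"
    using j assms by (simp add: conj_by_mult einv_closed conj_by_closed)
  ultimately show "NG_conjugate (conj_by k p) q" unfolding NG_conjugate_def by blast
qed

definition inverting :: bool where
  "inverting \<longleftrightarrow> (\<exists>e h. induces e h \<and> snd (snd e))"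

text \<open>Over the trivial element of \<open>H\<close> all \<open>l\<close> have to be considered, but only the class of \<open>\<phi> l\<close>
  modulo inner automorphisms matters. Whether the class of \<open>t\<close> occurs is a fixed truth
  value, which a program may contain as a constant.\<close>

lemma conjugate_over_one:
  assumes g: "represents p e g" "represents p' e' g'" and h: "snd g = \<one>" "snd g' = \<one>"
  shows "conjugate_in G g g' \<longleftrightarrow> NG_conjugate (emul p (einv e)) (emul p' (einv e')) \<or>
    inverting \<and> NG_conjugate (conj_by ([], 0, True) (emul p (einv e))) (emul p' (einv e'))"
proof -
  interpret G: group G by (rule group_semidirect)
  define n where "n = emul p (einv e)"
  define n' where "n' = emul p' (einv e')"
  have gG: "g \<in> carrier G" "g' \<in> carrier G" using g unfolding represents_def by blast+
  have eE: "e \<in> carrier EG" "e' \<in> carrier EG" using g unfolding represents_def induces_def by blast+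
  have fst: "fst g \<in> carrier A" "fst g' \<in> carrier A" using gG by auto
  have n: "n = \<Theta> (fst g)" "n' = \<Theta> (fst g')"
    using g \<Theta>_EG fst eE by (simp_all add: n_def n'_def represents_def emul_assoc einv_closed)
  have nE: "n \<in> carrier EG" "n' \<in> carrier EG" using \<Theta>_EG fst n by simp_all
  \<comment> \<open>As \<open>1\<close> induces the action of the trivial element too, it may take the place of \<open>e\<close> and \<open>e'\<close>.\<close>
  have rep: "represents n ([], 0, False) g" "represents n' ([], 0, False) g'"
    using gG induces_one h nE n by (simp_all add: represents_def)
  have one: "einv ([], 0, False) = ([], 0, False)" by (simp add: einv_def)
  have iff: "(\<exists>k\<in>carrier A. (k, l) \<otimes>\<^bsub>G\<^esub> g = g' \<otimes>\<^bsub>G\<^esub> (k, l)) \<longleftrightarrow>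
      NG_conjugate (conj_by ([], 0, snd (snd f)) n) n'" if f: "induces f l" for f l
  proof -
    have fE: "f \<in> carrier EG" "l \<in> carrier H" using f by (simp_all add: induces_def)
    obtain k d c where fk: "f = (k, d, c)" by (cases f)
    have k: "(k, d, False) \<in> carrier NG" "f = emul (k, d, False) ([], 0, c)"
      using fE fk by (auto simp: emul_NG)
    have t: "([], 0, c) \<in> carrier EG" by simp
    have "conj_by f n = conj_by (k, d, False) (conj_by ([], 0, c) n)"
      unfolding k(2) using k(1) t nE by (intro conj_by_mult) auto
    moreover have "emul (conj_by f n) ([], 0, False) = conj_by f n"
      using fE nE conj_by_closed by simp
    ultimately show ?thesis
      using conjugator_iff[OF rep f] NG_conjugate_conj_by_left[OF k(1) conj_by_closed[OF t nE(1)]] h fE nE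
      by (simp add: one fk)
  qed
  have "conjugate_in G g g' \<longleftrightarrow> (\<exists>l\<in>carrier H. \<exists>k\<in>carrier A. (k, l) \<otimes>\<^bsub>G\<^esub> g = g' \<otimes>\<^bsub>G\<^esub> (k, l))"
    unfolding G.conjugate_in_iff[OF gG] by auto
  also have "\<dots> \<longleftrightarrow> (\<exists>f l. induces f l \<and> NG_conjugate (conj_by ([], 0, snd (snd f)) n) n')"
    using iff ex_induces induces_def by meson
  also have "\<dots> \<longleftrightarrow> NG_conjugate n n' \<or> inverting \<and> NG_conjugate (conj_by ([], 0, True) n) n'"
  proof -
    have "conj_by ([], 0, False) n = n" using nE by simp
    then show ?thesis unfolding inverting_def using induces_one by (metis (full_types) snd_conv)
  qed
  finally show ?thesis by (simp add: n_def n'_def)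
qed

text \<open>A power of the second component of \<open>g\<close> lifts to the same power of \<open>g\<close>.\<close>

lemma centralizer_lift:
  assumes g: "g \<in> carrier G" and c: "c \<in> generate H {snd g}"
  shows "\<exists>y\<in>carrier G. snd y = c \<and> y \<otimes>\<^bsub>G\<^esub> g = g \<otimes>\<^bsub>G\<^esub> y"
proof -
  interpret G: group G by (rule group_semidirect)
  show ?thesis
    using c
  proof (induction rule: generate.induct)
    case one
    show ?case using G.one_closed G.l_one[OF g] G.r_one[OF g]
      by (intro bexI[of _ "\<one>\<^bsub>G\<^esub>"]) auto
  next
    case (incl h)
    then show ?case using g by blast
  next
    case (inv h)
    then have h: "h = snd g" by simp
    have "snd (inv\<^bsub>G\<^esub> g) \<otimes> snd g = \<one>"
      using G.l_inv[OF g] by (metis semidirect_simps(2,3) snd_conv)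
    moreover have "snd (inv\<^bsub>G\<^esub> g) \<in> carrier H" using G.inv_closed[OF g] by auto
    ultimately have "snd (inv\<^bsub>G\<^esub> g) = inv h"
      using g h by (metis H.inv_equality mem_Times_iff semidirect_simps(1))
    moreover have "inv\<^bsub>G\<^esub> g \<otimes>\<^bsub>G\<^esub> g = g \<otimes>\<^bsub>G\<^esub> inv\<^bsub>G\<^esub> g"
      using G.l_inv[OF g] G.r_inv[OF g] by simp
    ultimately show ?case using G.inv_closed[OF g] by blast
  next
    case (eng h h')
    then obtain y y' where y: "y \<in> carrier G" "snd y = h" "y \<otimes>\<^bsub>G\<^esub> g = g \<otimes>\<^bsub>G\<^esub> y"
        "y' \<in> carrier G" "snd y' = h'" "y' \<otimes>\<^bsub>G\<^esub> g = g \<otimes>\<^bsub>G\<^esub> y'" by blast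
    have "y \<otimes>\<^bsub>G\<^esub> y' \<otimes>\<^bsub>G\<^esub> g = g \<otimes>\<^bsub>G\<^esub> (y \<otimes>\<^bsub>G\<^esub> y')"
      using y g G.m_assoc by metis
    moreover have "snd (y \<otimes>\<^bsub>G\<^esub> y') = h \<otimes> h'" using y by simp
    ultimately show ?case using G.m_closed[OF y(1,4)] by blast
  qed
qed

text \<open>If \<open>y\<close> conjugates \<open>g\<close> to \<open>g'\<close>, then so does \<open>w^-1 y\<close> for every \<open>w\<close> that commutes with \<open>g'\<close>. Thus the
  factor from \<open>generate H {snd g'}\<close> in the second component of \<open>y\<close> can be removed, and finitely many
  second components remain. The list \<open>cs\<close> may consist of names, such as words, for the
  representatives.\<close>

lemma conjugate_over_nontrivial:
  assumes g: "represents p e g" "represents p' e' g'"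
    and l: "l \<in> carrier H" "l \<otimes> snd g = snd g' \<otimes> l"
    and cs: "coset_representatives H (generate H {snd g'}) (centralizer H (snd g')) (map val cs)"
    and f: "\<And>c. c \<in> set cs \<Longrightarrow> induces (f c) (val c \<otimes> l)"
  shows "conjugate_in G g g' \<longleftrightarrow>
    (\<exists>c\<in>set cs. NG_conjugate (emul (conj_by (f c) (emul p (einv e))) e') p')"
proof -
  interpret G: group G by (rule group_semidirect)
  have gG: "g \<in> carrier G" "g' \<in> carrier G" using g unfolding represents_def by blast+
  have hH: "snd g \<in> carrier H" "snd g' \<in> carrier H" using gG by auto
  define zs where "zs = map val cs"
  have zs: "coset_representatives H (generate H {snd g'}) (centralizer H (snd g')) zs"
    using cs by (simp add: zs_def)
  have zsH: "set zs \<subseteq> carrier H"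
    and C: "centralizer H (snd g') = (\<Union>i<length zs. generate H {snd g'} #> zs ! i)"
    using zs by (simp_all add: coset_representatives_def)
  have zC: "z \<otimes> snd g' = snd g' \<otimes> z" if mem: "z \<in> set zs" for z
  proof -
    obtain i where i: "i < length zs" "z = zs ! i" using mem by (auto simp: in_set_conv_nth)
    have "\<one> \<otimes> z \<in> generate H {snd g'} #> z"
      unfolding r_coset_def using generate.one by blast
    then have "z \<in> generate H {snd g'} #> zs ! i"
      using i(2) H.l_one[OF subsetD[OF zsH mem]] by simp
    then have "z \<in> centralizer H (snd g')" unfolding C using i by blast
    then show ?thesis by (simp add: centralizer_def)
  qed
  have zl: "z \<otimes> l \<otimes> snd g = snd g' \<otimes> (z \<otimes> l)" if "z \<in> set zs" for z
  proof -
    have z: "z \<in> carrier H" using that zsH by blast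
    have "z \<otimes> l \<otimes> snd g = z \<otimes> snd g' \<otimes> l"
      using z l hH by (simp add: H.m_assoc)
    then show ?thesis using zC[OF that] z l hH by (simp add: H.m_assoc)
  qed
  have "conjugate_in G g g' \<longleftrightarrow> (\<exists>z\<in>set zs. \<exists>k\<in>carrier A. (k, z \<otimes> l) \<otimes>\<^bsub>G\<^esub> g = g' \<otimes>\<^bsub>G\<^esub> (k, z \<otimes> l))"
  proof
    assume "conjugate_in G g g'"
    then obtain y where y: "y \<in> carrier G" "y \<otimes>\<^bsub>G\<^esub> g = g' \<otimes>\<^bsub>G\<^esub> y"
      unfolding G.conjugate_in_iff[OF gG] by blast
    define c where "c = snd y \<otimes> inv l"
    have yH: "snd y \<in> carrier H" using y by auto
    have yh: "snd y \<otimes> snd g = snd g' \<otimes> snd y" using arg_cong[OF y(2), of snd] by simp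
    have "inv l \<otimes> snd g' = snd g \<otimes> inv l"
    proof -
      have "inv l \<otimes> snd g' \<otimes> l = inv l \<otimes> (l \<otimes> snd g)"
        using l hH by (simp add: H.m_assoc)
      also have "\<dots> = snd g" using l(1) hH by (simp flip: H.m_assoc)
      finally show ?thesis using l(1) hH by (simp add: H.inv_solve_right)
    qed
    then have "c \<otimes> snd g' = snd y \<otimes> snd g \<otimes> inv l"
      using yH l hH by (simp add: c_def H.m_assoc)
    also have "\<dots> = snd g' \<otimes> c" unfolding yh using yH l hH by (simp add: c_def H.m_assoc)
    finally have "c \<in> centralizer H (snd g')" using yH l by (simp add: c_def centralizer_def)
    then obtain i where i: "i < length zs" "c \<in> generate H {snd g'} #> zs ! i" unfolding C by blast
    define z where "z = zs ! i"
    have z: "z \<in> set zs" "z \<in> carrier H" using i zsH by (auto simp: z_def)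
    obtain c' where c': "c' \<in> generate H {snd g'}" "c = c' \<otimes> z" using i by (auto simp: r_coset_def z_def)
    obtain w where w: "w \<in> carrier G" "snd w = c'" "w \<otimes>\<^bsub>G\<^esub> g' = g' \<otimes>\<^bsub>G\<^esub> w"
      using centralizer_lift[OF gG(2) c'(1)] by blast
    define y' where "y' = inv\<^bsub>G\<^esub> w \<otimes>\<^bsub>G\<^esub> y"
    have wi: "inv\<^bsub>G\<^esub> w \<in> carrier G" using w by (intro G.inv_closed)
    have y': "y' \<in> carrier G" unfolding y'_def using wi y(1) by (rule G.m_closed)
    have wy: "w \<otimes>\<^bsub>G\<^esub> y' = y" unfolding y'_def using w y wi
      by (metis G.l_one G.m_assoc G.r_inv)
    have "w \<otimes>\<^bsub>G\<^esub> (y' \<otimes>\<^bsub>G\<^esub> g) = w \<otimes>\<^bsub>G\<^esub> (g' \<otimes>\<^bsub>G\<^esub> y')"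
      using y(2) w wy y' gG by (metis G.m_assoc)
    then have comm: "y' \<otimes>\<^bsub>G\<^esub> g = g' \<otimes>\<^bsub>G\<^esub> y'"
      using G.l_cancel w(1) y' gG G.m_closed by metis
    have c'H: "c' \<in> carrier H" "snd y' \<in> carrier H" using w y' by auto
    have "c' \<otimes> snd y' = snd y" using arg_cong[OF wy, of snd] w by simp
    also have "\<dots> = c \<otimes> l" using yH l by (simp add: c_def H.m_assoc)
    also have "\<dots> = c' \<otimes> (z \<otimes> l)" using c' c'H z l by (simp add: H.m_assoc)
    finally have "snd y' = z \<otimes> l" using c'H z l by simp
    then have "(fst y', z \<otimes> l) = y'" by (metis prod.collapse)
    moreover have "fst y' \<in> carrier A" using y' by auto
    ultimately show "\<exists>z\<in>set zs. \<exists>k\<in>carrier A. (k, z \<otimes> l) \<otimes>\<^bsub>G\<^esub> g = g' \<otimes>\<^bsub>G\<^esub> (k, z \<otimes> l)"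
      using z(1) comm by metis
  next
    assume "\<exists>z\<in>set zs. \<exists>k\<in>carrier A. (k, z \<otimes> l) \<otimes>\<^bsub>G\<^esub> g = g' \<otimes>\<^bsub>G\<^esub> (k, z \<otimes> l)"
    then obtain z k where "z \<in> set zs" "k \<in> carrier A"
        "(k, z \<otimes> l) \<otimes>\<^bsub>G\<^esub> g = g' \<otimes>\<^bsub>G\<^esub> (k, z \<otimes> l)" by blast
    moreover have "(k, z \<otimes> l) \<in> carrier G" using calculation zsH l by auto
    ultimately show "conjugate_in G g g'" unfolding G.conjugate_in_iff[OF gG] by blast
  qed
  also have "\<dots> \<longleftrightarrow> (\<exists>c\<in>set cs. \<exists>k\<in>carrier A. (k, val c \<otimes> l) \<otimes>\<^bsub>G\<^esub> g = g' \<otimes>\<^bsub>G\<^esub> (k, val c \<otimes> l))"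
    by (simp only: zs_def set_map bex_simps)
  also have "\<dots> \<longleftrightarrow> (\<exists>c\<in>set cs. NG_conjugate (emul (conj_by (f c) (emul p (einv e))) e') p')"
  proof (intro bex_cong HOL.refl)
    fix c assume c: "c \<in> set cs"
    then have "val c \<otimes> l \<otimes> snd g = snd g' \<otimes> (val c \<otimes> l)"
      by (intro zl) (simp add: zs_def)
    then show "(\<exists>k\<in>carrier A. (k, val c \<otimes> l) \<otimes>\<^bsub>G\<^esub> g = g' \<otimes>\<^bsub>G\<^esub> (k, val c \<otimes> l)) \<longleftrightarrow>
        NG_conjugate (emul (conj_by (f c) (emul p (einv e))) e') p'"
      using conjugator_iff[OF g f[OF c]] by simp
  qed
  finally show ?thesis .
qed

end

section \<open>Words as lists of letter codes\<close>

text \<open>Programs work with words as lists of natural numbers. Every number is the code of exactly one letter: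
  \<open>2 i\<close> for the generator with index \<open>i\<close>, and \<open>2 i + 1\<close> for its inverse.\<close>

definition letter_code :: "nat \<times> bool \<Rightarrow> nat" where
  "letter_code a = 2 * fst a + (if snd a then 0 else 1)"

definition decode_word :: "nat list \<Rightarrow> nat word" where
  "decode_word c = map (\<lambda>n. (n div 2, even n)) c"

lemma letter_code_div [simp]: "letter_code a div 2 = fst a" "even (letter_code a) = snd a"
  by (auto simp: letter_code_def)

lemma decode_word_code [simp]: "decode_word (map letter_code w) = w"
  by (induction w) (simp_all add: decode_word_def)

lemma word_code_eq: "word_code w = code (map letter_code w)"
  by (simp add: word_code_def code_list_def code_nat_def comp_def letter_code_def case_prod_unfold)

lemma letter_code_decode [simp]: "map letter_code (decode_word c) = c"
  by (induction c) (auto simp: decode_word_def letter_code_def)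

definition valid :: "nat \<Rightarrow> nat list \<Rightarrow> bool" where
  "valid k c \<longleftrightarrow> (\<forall>n\<in>set c. n < 2 * k)"

lemma decode_words_over: "decode_word c \<in> words_over xs \<longleftrightarrow> valid (length xs) c"
  by (auto simp: words_over_def decode_word_def valid_def in_lists_conv_set)

lemma valid_letter_codes: "w \<in> words_over xs \<Longrightarrow> valid (length xs) (map letter_code w)"
  using decode_words_over[of "map letter_code w" xs] by simp

lemma valid_simps [simp]: "valid k []" "valid k (n # c) \<longleftrightarrow> n < 2 * k \<and> valid k c"
  "valid k (c @ c') \<longleftrightarrow> valid k c \<and> valid k c'"
  by (auto simp: valid_def)

definition letter_val :: "('a, 'b) monoid_scheme \<Rightarrow> 'a list \<Rightarrow> nat \<Rightarrow> 'a" where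
  "letter_val G xs n = (if even n then xs ! (n div 2) else inv\<^bsub>G\<^esub> (xs ! (n div 2)))"

definition code_val :: "('a, 'b) monoid_scheme \<Rightarrow> 'a list \<Rightarrow> nat list \<Rightarrow> 'a" where
  "code_val G xs c = word_val G xs (decode_word c)"

lemma code_val_simps [simp]: "code_val G xs [] = \<one>\<^bsub>G\<^esub>"
  "code_val G xs (n # c) = letter_val G xs n \<otimes>\<^bsub>G\<^esub> code_val G xs c"
  by (simp_all add: code_val_def word_val_def decode_word_def letter_val_def)

lemma word_val_eq: "word_val G xs w = code_val G xs (map letter_code w)"
  by (simp add: code_val_def)

definition inv_code :: "nat list \<Rightarrow> nat list" where
  "inv_code c = rev (map (\<lambda>n. if n mod 2 = 0 then Suc n else n - 1) c)"

lemma valid_inv_code [simp]: "valid k c \<Longrightarrow> valid k (inv_code c)"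
proof -
  have "Suc n < 2 * k" if "even n" "n < 2 * k" for n
    using that by (auto elim!: evenE)
  then show "valid k c \<Longrightarrow> valid k (inv_code c)"
    by (auto simp: valid_def inv_code_def even_iff_mod_2_eq_zero)
qed

context group
begin

lemma letter_val_closed [simp]:
  "set xs \<subseteq> carrier G \<Longrightarrow> n < 2 * length xs \<Longrightarrow> letter_val G xs n \<in> carrier G"
proof -
  assume xs: "set xs \<subseteq> carrier G" and "n < 2 * length xs"
  then have "n div 2 < length xs" by linarith
  then have "xs ! (n div 2) \<in> carrier G" using xs by auto
  then show ?thesis by (simp add: letter_val_def)
qed

lemma code_val_closed [simp]:
  "set xs \<subseteq> carrier G \<Longrightarrow> valid (length xs) c \<Longrightarrow> code_val G xs c \<in> carrier G"
  by (induction c) simp_all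

lemma code_val_append: "set xs \<subseteq> carrier G \<Longrightarrow> valid (length xs) c \<Longrightarrow> valid (length xs) c'
    \<Longrightarrow> code_val G xs (c @ c') = code_val G xs c \<otimes> code_val G xs c'"
  by (induction c) (simp_all add: m_assoc)

lemma letter_val_inv:
  assumes "set xs \<subseteq> carrier G" "n < 2 * length xs"
  shows "letter_val G xs (if n mod 2 = 0 then Suc n else n - 1) = inv (letter_val G xs n)"
proof (cases "even n")
  case True
  then show ?thesis by (simp add: letter_val_def mod2_eq_if)
next
  case False
  then obtain k where k: "n = 2 * k + 1" by (blast elim: oddE)
  then have "xs ! k \<in> carrier G" using assms by auto
  then show ?thesis using k by (simp add: letter_val_def)
qed

lemma code_val_inv:
  "set xs \<subseteq> carrier G \<Longrightarrow> valid (length xs) c \<Longrightarrow> code_val G xs (inv_code c) = inv (code_val G xs c)"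
proof (induction c)
  case (Cons n c)
  let ?n = "if n mod 2 = 0 then Suc n else n - 1"
  have "valid (length xs) (inv_code [n])" using Cons.prems by (intro valid_inv_code) simp
  then have n: "?n < 2 * length xs" by (simp add: inv_code_def)
  have "inv_code (n # c) = inv_code c @ [?n]" by (simp add: inv_code_def)
  then have "code_val G xs (inv_code (n # c)) = code_val G xs (inv_code c) \<otimes> letter_val G xs ?n"
    using Cons.prems n by (simp only: code_val_append valid_inv_code valid_simps) simp
  then show ?case
    unfolding letter_val_inv[OF Cons.prems(1) conjunct1[OF Cons.prems(2)[unfolded valid_simps]]]
    using Cons by (simp add: inv_mult_group)
qed (simp add: inv_code_def)

lemma ex_code_val:
  assumes xs: "generating_tuple G xs" and g: "g \<in> carrier G"
  shows "\<exists>c. valid (length xs) c \<and> code_val G xs c = g"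
proof -
  have sub: "set xs \<subseteq> carrier G" and "g \<in> generate G (set xs)"
    using xs g by (simp_all add: generating_tuple_def)
  from this(2) show ?thesis
  proof (induction rule: generate.induct)
    case one
    show ?case by (rule exI[of _ "[]"]) simp
  next
    case (incl h)
    then obtain i where i: "i < length xs" "h = xs ! i" by (auto simp: in_set_conv_nth)
    then have "xs ! i \<in> carrier G" using sub nth_mem[OF i(1)] by blast
    then show ?case using i by (intro exI[of _ "[2 * i]"]) (simp add: letter_val_def)
  next
    case (inv h)
    then obtain i where i: "i < length xs" "h = xs ! i" by (auto simp: in_set_conv_nth)
    then have "xs ! i \<in> carrier G" using sub nth_mem[OF i(1)] by blast
    then show ?case using i by (intro exI[of _ "[2 * i + 1]"]) (simp add: letter_val_def)
  next
    case (eng h h')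
    then obtain c c' where "valid (length xs) c" "code_val G xs c = h"
        "valid (length xs) c'" "code_val G xs c' = h'" by blast
    then show ?case using code_val_append[OF sub] by (intro exI[of _ "c @ c'"]) simp
  qed
qed

end

text \<open>The default value only serves to make the lookup total; valid words do not reach it.\<close>

definition lookup :: "'a list \<Rightarrow> 'a \<Rightarrow> nat \<Rightarrow> 'a" where
  "lookup t d n = (if n < length t then t ! n else d)"

lemma computable_lookup: "computable_on B f \<Longrightarrow> computable_on B (\<lambda>x. lookup t d (f x))"
  unfolding lookup_def by (rule computable_on_compose[OF computable_table]) auto

lemma computable_valid: "computable f \<Longrightarrow> computable (\<lambda>x. valid k (f x))"
  unfolding valid_def by (intro computable_intros)

lemma computable_inv_code: "computable f \<Longrightarrow> computable (\<lambda>x. inv_code (f x))"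
  unfolding inv_code_def by (intro computable_intros)

section \<open>Programs for the given decision procedures\<close>

text \<open>The given programs have to work for words over the generators only. Validity is part of the
  predicate in order that it is computable on all lists.\<close>

definition conj_codes :: "('a, 'b) monoid_scheme \<Rightarrow> 'a list \<Rightarrow> nat list \<Rightarrow> nat list \<Rightarrow> bool" where
  "conj_codes H xs c c' \<longleftrightarrow> valid (length xs) c \<and> valid (length xs) c' \<and>
     conjugate_in H (code_val H xs c) (code_val H xs c')"

lemma computable_conj_codes:
  assumes "conjugacy_problem_decidable_wrt H xs" "computable f" "computable g"
  shows "computable (\<lambda>x. conj_codes H xs (f x) (g x))"
proof -
  let ?V = "valid (length xs)"
  let ?conj = "\<lambda>p. conjugate_in H (code_val H xs (fst p)) (code_val H xs (snd p))"
  obtain r where r: "\<And>u v. u \<in> words_over xs \<Longrightarrow> v \<in> words_over xs \<Longrightarrow>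
      rec_eval r [word_code u, word_code v] =
        Some (if conjugate_in H (word_val H xs u) (word_val H xs v) then 1 else 0)"
    using assms(1) unfolding conjugacy_problem_decidable_wrt_def by blast
  have "computable_on {p. ?V (fst p) \<and> ?V (snd p)} ?conj"
  proof (rule computable_onI[of _ "Comp r [fst_prog, snd_prog]"])
    fix p :: "nat list \<times> nat list"
    assume "p \<in> {p. ?V (fst p) \<and> ?V (snd p)}"
    moreover obtain c c' where p: "p = (c, c')" by (cases p)
    ultimately have "decode_word c \<in> words_over xs" "decode_word c' \<in> words_over xs"
      by (simp_all add: decode_words_over)
    from r[OF this] show "rec_eval (Comp r [fst_prog, snd_prog]) [code p] = Some (code (?conj p))"
      by (simp add: p word_code_eq code_val_def)
  qed
  then have "computable (\<lambda>p. if ?V (fst p) \<and> ?V (snd p) then ?conj p else False)"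
    by (intro computable_if computable_intros computable_valid) (auto elim: computable_on_subset)
  then have "computable (\<lambda>p. conj_codes H xs (fst p) (snd p))"
    by (rule computable_on_cong) (auto simp: conj_codes_def)
  then show ?thesis using assms(2,3) by (rule computable_apply2)
qed

text \<open>The given program may fail to halt on words for the identity. It is called under a guard,
  which is decidable since an element is trivial if and only if it is conjugate to the empty word.\<close>

lemma computable_coset_representatives:
  assumes H: "group H" "generating_tuple H xs" "conjugacy_problem_decidable_wrt H xs"
    and cosets: "centralizer_cosets_computable_wrt H xs"
  obtains reps :: "nat list \<Rightarrow> nat list list" where "computable reps"
    "\<And>c. valid (length xs) c \<Longrightarrow> code_val H xs c \<noteq> \<one>\<^bsub>H\<^esub> \<Longrightarrow> (\<forall>z\<in>set (reps c). valid (length xs) z) \<and>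
       coset_representatives H (generate H {code_val H xs c}) (centralizer H (code_val H xs c))
         (map (code_val H xs) (reps c))"
proof -
  interpret group H by (rule H(1))
  have xs: "set xs \<subseteq> carrier H" using H(2) by (simp add: generating_tuple_def)
  let ?ok = "\<lambda>c. valid (length xs) c \<and> code_val H xs c \<noteq> \<one>\<^bsub>H\<^esub>"
  obtain r where r: "\<And>w. w \<in> words_over xs \<Longrightarrow> word_val H xs w \<noteq> \<one>\<^bsub>H\<^esub> \<Longrightarrow>
        (\<exists>ws. set ws \<subseteq> words_over xs \<and>
              rec_eval r [word_code w] = Some (list_encode (map word_code ws)) \<and>
              coset_representatives H (generate H {word_val H xs w})
                (centralizer H (word_val H xs w)) (map (word_val H xs) ws))"
    using cosets unfolding centralizer_cosets_computable_wrt_def by blast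
  have "\<exists>zs. (\<forall>z\<in>set zs. valid (length xs) z) \<and> rec_eval r [code c] = Some (code zs) \<and>
      coset_representatives H (generate H {code_val H xs c}) (centralizer H (code_val H xs c))
         (map (code_val H xs) zs)" if c: "?ok c" for c
  proof -
    have "decode_word c \<in> words_over xs" "word_val H xs (decode_word c) \<noteq> \<one>\<^bsub>H\<^esub>"
      using c by (simp_all add: decode_words_over code_val_def)
    from r[OF this] obtain ws where ws: "set ws \<subseteq> words_over xs"
      "rec_eval r [word_code (decode_word c)] = Some (list_encode (map word_code ws))"
      "coset_representatives H (generate H {code_val H xs c})
         (centralizer H (code_val H xs c)) (map (word_val H xs) ws)"
      unfolding code_val_def by blast
    have "map word_code ws = map code (map (map letter_code) ws)"
      by (simp add: word_code_eq)
    then have "list_encode (map word_code ws) = code (map (map letter_code) ws)"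
      by (simp only: code_list_def)
    moreover have "map (code_val H xs) (map (map letter_code) ws) = map (word_val H xs) ws"
      by (simp add: word_val_eq)
    moreover have "word_code (decode_word c) = code c" by (simp add: word_code_eq)
    moreover have "\<forall>z\<in>set (map (map letter_code) ws). valid (length xs) z"
      using ws(1) valid_letter_codes by auto
    ultimately show ?thesis using ws(2,3) by metis
  qed
  then obtain zs where zs: "\<And>c. ?ok c \<Longrightarrow> (\<forall>z\<in>set (zs c). valid (length xs) z) \<and>
      rec_eval r [code c] = Some (code (zs c)) \<and>
      coset_representatives H (generate H {code_val H xs c}) (centralizer H (code_val H xs c))
         (map (code_val H xs) (zs c))"
    by metis
  define reps where "reps c = (if ?ok c then zs c else [])" for c
  have trivial: "code_val H xs c = \<one>\<^bsub>H\<^esub> \<longleftrightarrow> conj_codes H xs c []" if "valid (length xs) c" for c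
    using that xs by (auto simp: conj_codes_def conjugate_in_iff)
  have "computable (\<lambda>c. valid (length xs) c \<and> \<not> conj_codes H xs c [])"
    by (intro computable_intros computable_valid computable_conj_codes H)
  then have ok: "computable ?ok" by (rule computable_on_cong) (use trivial in auto)
  have "computable_on {c \<in> UNIV. ?ok c} zs"
    using zs by (intro computable_onI[of _ r]) blast
  then have "computable reps" unfolding reps_def by (intro computable_if ok computable_const)
  moreover have "(\<forall>z\<in>set (reps c). valid (length xs) z) \<and>
       coset_representatives H (generate H {code_val H xs c}) (centralizer H (code_val H xs c))
         (map (code_val H xs) (reps c))" if "valid (length xs) c" "code_val H xs c \<noteq> \<one>\<^bsub>H\<^esub>" for c
  proof -
    have "reps c = zs c" using that by (simp add: reps_def)
    then show ?thesis using zs[OF conjI[OF that]] by simp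
  qed
  ultimately show thesis by (rule that)
qed

section \<open>Deciding conjugacy in the semidirect product\<close>

context artin_extension
begin

text \<open>In the proof \<open>E\<close> translates a word over \<open>xs\<close> into an element that induces the action of its value,
  \<open>h\<close> translates a word over \<open>ys\<close> into a word over \<open>xs\<close> for its second component, and \<open>R\<close> into a
  representing element. All three multiply the entries of a finite table, one for each letter and each
  inverse letter. Then \<open>N\<close> is the first component, transported to the central extension.\<close>

lemma conjugacy_decidable_wrt:
  assumes xs: "generating_tuple H xs" and conj: "conjugacy_problem_decidable_wrt H xs"
    and cosets: "centralizer_cosets_computable_wrt H xs" and ys: "generating_tuple G ys"
  shows "conjugacy_problem_decidable_wrt G ys"
proof -
  interpret G: group G by (rule group_semidirect)
  let ?V = "valid (length xs)" and ?W = "valid (length ys)"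
  have xsH: "set xs \<subseteq> carrier H" and ysG: "set ys \<subseteq> carrier G"
    using xs ys by (simp_all add: generating_tuple_def)
  obtain reps where reps: "computable reps"
    "\<And>c. ?V c \<Longrightarrow> code_val H xs c \<noteq> \<one> \<Longrightarrow> (\<forall>z\<in>set (reps c). ?V z) \<and>
       coset_representatives H (generate H {code_val H xs c}) (centralizer H (code_val H xs c))
         (map (code_val H xs) (reps c))"
    using computable_coset_representatives[OF H.is_group xs conj cosets] by blast
  define one where "one = ([] :: nat list, 0 :: int, False)"

  define e where "e n = (SOME e. induces e (letter_val H xs n))" for n
  have e: "induces (e n) (letter_val H xs n)" if "n < 2 * length xs" for n
    unfolding e_def by (rule someI_ex[OF ex_induces[OF H.letter_val_closed[OF xsH that]]])
  define et where "et = lookup (map e [0..<2 * length xs]) one"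
  define E where "E c = foldr (\<lambda>n p. emul (et n) p) c one" for c
  have E_Cons: "E (n # c) = emul (et n) (E c)" and E_Nil: "E [] = one" for n c
    by (simp_all add: E_def)
  have E: "induces (E c) (code_val H xs c)" if "?V c" for c
    using that
  proof (induction c)
    case (Cons n c)
    then have "et n = e n" by (simp add: et_def lookup_def)
    then show ?case using Cons e by (simp add: E_Cons induces_mult)
  qed (simp add: E_Nil one_def induces_one)
  have E_closed: "E c \<in> carrier EG" if "?V c" for c
    using E[OF that] by (simp add: induces_def)
  have E_append: "E (c @ c') = emul (E c) (E c')" if "?V c" "?V c'" for c c'
    using that
  proof (induction c)
    case (Cons n c)
    then have "et n \<in> carrier EG" using e by (simp add: et_def lookup_def induces_def)
    then show ?case using Cons E_closed by (simp add: E_Cons emul_assoc)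
  qed (simp add: E_Nil one_def)

  define w where "w n = (SOME c. ?V c \<and> code_val H xs c = snd (letter_val G ys n))" for n
  have w: "?V (w n) \<and> code_val H xs (w n) = snd (letter_val G ys n)" if "n < 2 * length ys" for n
  proof -
    have "snd (letter_val G ys n) \<in> carrier H" using G.letter_val_closed[OF ysG that] by auto
    then show ?thesis unfolding w_def by (rule someI_ex[OF H.ex_code_val[OF xs]])
  qed
  define ht where "ht = lookup (map w [0..<2 * length ys]) []"
  define h where "h c = foldr (\<lambda>n c'. ht n @ c') c []" for c
  define rt where "rt = lookup (map (\<lambda>n. emul (\<Theta> (fst (letter_val G ys n))) (E (w n))) [0..<2 * length ys]) one"
  define R where "R c = foldr (\<lambda>n p. emul (rt n) p) c one" for c
  have rep: "?V (h c) \<and> code_val H xs (h c) = snd (code_val G ys c) \<and>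
      represents (R c) (E (h c)) (code_val G ys c)" if "?W c" for c
    using that
  proof (induction c)
    case Nil
    show ?case using represents_one by (simp add: h_def R_def E_Nil one_def)
  next
    case (Cons n c)
    have n: "n < 2 * length ys" and c: "?W c" using Cons.prems by simp_all
    have tab: "ht n = w n" "rt n = emul (\<Theta> (fst (letter_val G ys n))) (E (w n))"
      using n by (simp_all add: ht_def rt_def lookup_def)
    have hn: "h (n # c) = w n @ h c" "R (n # c) = emul (rt n) (R c)" by (simp_all add: h_def R_def tab)
    have "represents (rt n) (E (w n)) (letter_val G ys n)"
      unfolding represents_def tab using G.letter_val_closed[OF ysG n] E w[OF n] by metis
    from represents_mult[OF this] Cons.IH[OF c]
    have "represents (R (n # c)) (E (h (n # c))) (code_val G ys (n # c))"
      using w[OF n] by (simp add: hn E_append del: semidirect_simps)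
    moreover have "code_val H xs (h (n # c)) = snd (code_val G ys (n # c))"
      using w[OF n] Cons.IH[OF c] xsH by (simp add: hn H.code_val_append)
    ultimately show ?case using w[OF n] Cons.IH[OF c] by (simp add: hn)
  qed

  define conjH where "conjH = conj_codes H xs"
  define N where "N c = emul (R c) (einv (E (h c)))" for c
  \<comment> \<open>The first alternative makes the search for \<open>l\<close> terminate on all inputs, as computability of a
  minimization requires.\<close>
  define found where "found u v k \<longleftrightarrow>
     \<not> conjH (h u) (h v) \<or> ?V (list_decode k) \<and>
       conjH (list_decode k @ h u @ inv_code (list_decode k) @ inv_code (h v)) []" for u v k
  define l where "l u v = list_decode (LEAST k. found u v k)" for u v
  \<comment> \<open>The three cases: second components not conjugate, trivial, and conjugate but nontrivial.\<close>
  define decide where "decide u v \<longleftrightarrow> conjH (h u) (h v) \<and>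
     (if conjH (h u) []
      then NG_conjugate_test (N u) (N v) \<or>
        inverting \<and> NG_conjugate_test (emul (emul ([], 0, True) (N u)) (einv ([], 0, True))) (N v)
      else \<exists>z\<in>set (reps (h v)). NG_conjugate_test
        (emul (emul (emul (emul (E z) (E (l u v))) (N u)) (einv (emul (E z) (E (l u v))))) (E (h v))) (R v))"
    for u v

  have comp_E: "computable (\<lambda>x. E (f x))" if "computable f" for f :: "'x::coded \<Rightarrow> nat list"
    unfolding E_def et_def by (intro computable_intros computable_emul computable_lookup that)
  have comp_h: "computable (\<lambda>x. h (f x))" if "computable f" for f :: "'x::coded \<Rightarrow> nat list"
    unfolding h_def ht_def by (intro computable_intros computable_lookup that)
  have comp_R: "computable (\<lambda>x. R (f x))" if "computable f" for f :: "'x::coded \<Rightarrow> nat list"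
    unfolding R_def rt_def by (intro computable_intros computable_emul computable_lookup that)
  have comp_N: "computable (\<lambda>x. N (f x))" if "computable f" for f :: "'x::coded \<Rightarrow> nat list"
    unfolding N_def by (intro computable_emul computable_einv comp_R comp_E comp_h that)
  have comp_conjH: "computable (\<lambda>x. conjH (f x) (g x))" if "computable f" "computable g"
    for f g :: "'x::coded \<Rightarrow> nat list"
    unfolding conjH_def by (intro computable_conj_codes conj that)
  have comp_reps: "computable (\<lambda>x. reps (f x))" if "computable f" for f :: "'x::coded \<Rightarrow> nat list"
    using reps(1) that by (rule computable_apply)

  have codeH: "conjH c c' \<longleftrightarrow> conjugate_in H (code_val H xs c) (code_val H xs c')" if "?V c" "?V c'" for c c'
    using that by (simp add: conjH_def conj_codes_def)
  have trivial: "conjH c [] \<longleftrightarrow> code_val H xs c = \<one>" if "?V c" for c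
    using that xsH by (auto simp: codeH H.conjugate_in_iff)
  have found_iff: "?V (list_decode k) \<and> conjH (list_decode k @ h u @ inv_code (list_decode k) @ inv_code (h v)) [] \<longleftrightarrow>
      ?V (list_decode k) \<and> code_val H xs (list_decode k) \<otimes> code_val H xs (h u) =
        code_val H xs (h v) \<otimes> code_val H xs (list_decode k)" if "?V (h u)" "?V (h v)" for u v k
  proof (cases "?V (list_decode k)")
    case True
    define a b c where abc: "a = code_val H xs (list_decode k)" "b = code_val H xs (h u)" "c = code_val H xs (h v)"
    have C: "a \<in> carrier H" "b \<in> carrier H" "c \<in> carrier H" using True that xsH by (simp_all add: abc)
    have "code_val H xs (list_decode k @ h u @ inv_code (list_decode k) @ inv_code (h v)) =
        a \<otimes> b \<otimes> inv a \<otimes> inv c"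
      using True that xsH by (simp add: H.code_val_append H.code_val_inv abc H.m_assoc)
    also have "\<dots> = \<one> \<longleftrightarrow> a \<otimes> b = c \<otimes> a"
      using C H.inv_solve_right[of "\<one>" "a \<otimes> b \<otimes> inv a" c]
        H.inv_solve_right[of c "a \<otimes> b" a] by auto
    finally show ?thesis using True that by (simp add: trivial abc)
  qed simp

  have total: "\<exists>k. found u v k" for u v
  proof (cases "conjH (h u) (h v)")
    case True
    then have V: "?V (h u)" "?V (h v)" and "conjugate_in H (code_val H xs (h u)) (code_val H xs (h v))"
      by (simp_all add: conjH_def conj_codes_def)
    then obtain a where a: "a \<in> carrier H" "a \<otimes> code_val H xs (h u) = code_val H xs (h v) \<otimes> a"
      using xsH by (auto simp: H.conjugate_in_iff)
    obtain c where c: "?V c" "code_val H xs c = a" using H.ex_code_val[OF xs a(1)] by blast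
    have "found u v (list_encode c)"
      unfolding found_def found_iff[OF V] using a c by simp
    then show ?thesis by blast
  qed (simp add: found_def)
  have comp_l: "computable (\<lambda>x. l (f x) (g x))" if "computable f" "computable g"
    for f g :: "'x::coded \<Rightarrow> nat list"
  proof -
    have "computable (\<lambda>p. l (fst p) (snd p))"
      unfolding l_def
    proof (intro computable_list_decode computable_Least total)
      show "computable (\<lambda>p. found (fst (snd p)) (snd (snd p)) (fst p))"
        unfolding found_def
        by (intro computable_intros comp_conjH comp_h computable_valid computable_inv_code)
    qed
    then show ?thesis using that by (rule computable_apply2)
  qed
  have "computable (\<lambda>p. decide (fst p) (snd p))"
    unfolding decide_def
    by (intro computable_intros computable_emul computable_einv computable_NG_conjugate_test
        comp_E comp_h comp_R comp_N comp_l comp_conjH comp_reps)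
  then obtain r where r: "\<And>p. rec_eval r [code p] = Some (code (decide (fst p) (snd p)))"
    unfolding computable_on_def by blast

  have correct: "decide u v \<longleftrightarrow> conjugate_in G (code_val G ys u) (code_val G ys v)"
    if u: "?W u" and v: "?W v" for u v
  proof -
    define g where "g = code_val G ys u"
    define g' where "g' = code_val G ys v"
    have gG: "g \<in> carrier G" "g' \<in> carrier G" using u v ysG by (simp_all only: g_def g'_def G.code_val_closed)
    have V: "?V (h u)" "?V (h v)" and val: "code_val H xs (h u) = snd g" "code_val H xs (h v) = snd g'"
      and rep': "represents (R u) (E (h u)) g" "represents (R v) (E (h v)) g'"
      using rep[OF u] rep[OF v] by (simp_all add: g_def g'_def)
    have hE: "E (h u) \<in> carrier EG" "E (h v) \<in> carrier EG" using E_closed V by blast+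
    have RE: "R u \<in> carrier EG" "R v \<in> carrier EG"
      using rep' gG hE \<Theta>_EG by (auto simp: represents_def intro!: emul_closed)
    have NE: "N u \<in> carrier EG" "N v \<in> carrier EG"
      using RE hE by (simp_all add: N_def emul_closed einv_closed)
    have hH: "snd g \<in> carrier H" "snd g' \<in> carrier H" using gG by auto
    show ?thesis
    proof (cases "conjH (h u) (h v)")
      case False
      have "conjugate_in H (snd g) (snd g')" if conj_g: "conjugate_in G g g'"
      proof -
        from conj_g obtain y where y: "y \<in> carrier G" "y \<otimes>\<^bsub>G\<^esub> g = g' \<otimes>\<^bsub>G\<^esub> y"
          unfolding G.conjugate_in_iff[OF gG] by blast
        have "snd y \<otimes> snd g = snd g' \<otimes> snd y" using arg_cong[OF y(2), of snd] by simp
        moreover have "snd y \<in> carrier H" using y(1) by auto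
        ultimately show ?thesis unfolding H.conjugate_in_iff[OF hH] by blast
      qed
      then show ?thesis using False V val by (auto simp: decide_def codeH g_def g'_def)
    next
      case conj_h: True
      show ?thesis
      proof (cases "conjH (h u) []")
        case True
        then have one_u: "snd g = \<one>" using V val by (simp add: trivial)
        then have one_v: "snd g' = \<one>"
          using conj_h V val hH by (auto simp: codeH H.conjugate_in_iff)
        have t: "([], 0, True) \<in> carrier EG" by simp
        have "emul (emul ([], 0, True) (N u)) (einv ([], 0, True)) \<in> carrier EG"
          using t NE by (intro emul_closed einv_closed)
        then show ?thesis
          using conjugate_over_one[OF rep' one_u one_v] True conj_h NE NG_conjugate_test
          by (simp add: decide_def conj_by_def flip: N_def g_def g'_def)
      next
        case False
        then have "snd g \<noteq> \<one>" using V val by (simp add: trivial)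
        then have nontriv: "code_val H xs (h v) \<noteq> \<one>"
          using conj_h V val hH by (auto simp: codeH H.conjugate_in_iff)
        have "found u v (LEAST k. found u v k)" using total by (rule LeastI_ex)
        then have luv: "?V (l u v)" "code_val H xs (l u v) \<otimes> snd g = snd g' \<otimes> code_val H xs (l u v)"
          using conj_h found_iff[OF V] unfolding found_def l_def val by blast+
        define a where "a = code_val H xs (l u v)"
        have a: "a \<in> carrier H" using luv(1) xsH by (simp add: a_def)
        define zs where "zs = reps (h v)"
        have zsV: "\<forall>z\<in>set zs. ?V z" and
          cos: "coset_representatives H (generate H {snd g'}) (centralizer H (snd g')) (map (code_val H xs) zs)"
          using reps(2)[OF V(2) nontriv] by (simp_all add: zs_def val)
        define f where "f z = emul (E z) (E (l u v))" for z
        have fE: "f z \<in> carrier EG" if "z \<in> set zs" for z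
          using zsV that luv(1) E_closed by (simp add: f_def emul_closed)
        have find: "induces (f z) (code_val H xs z \<otimes> a)" if "z \<in> set zs" for z
          using zsV that luv(1) E by (simp add: f_def a_def induces_mult)
        let ?test = "\<lambda>f. NG_conjugate (emul (conj_by f (N u)) (E (h v))) (R v)"
        have "a \<otimes> snd g = snd g' \<otimes> a" using luv(2) by (simp add: a_def)
        from conjugate_over_nontrivial[OF rep' a this cos find]
        have "conjugate_in G g g' \<longleftrightarrow> (\<exists>z\<in>set zs. ?test (f z))" unfolding N_def .
        also have "\<dots> \<longleftrightarrow> decide u v"
        proof -
          have "NG_conjugate_test (emul (conj_by (f z) (N u)) (E (h v))) (R v) \<longleftrightarrow> ?test (f z)"
            if "z \<in> set zs" for z
            using that fE NE hE RE by (intro NG_conjugate_test emul_closed conj_by_closed)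
          then show ?thesis using conj_h False by (simp add: decide_def conj_by_def f_def flip: zs_def)
        qed
        finally show ?thesis by (simp add: g_def g'_def)
      qed
    qed
  qed

  show ?thesis
    unfolding conjugacy_problem_decidable_wrt_def
  proof (intro exI[of _ "Comp r [pair_prog]"] ballI)
    fix u v assume "u \<in> words_over ys" "v \<in> words_over ys"
    then have "?W (map letter_code u)" "?W (map letter_code v)" by (simp_all add: valid_letter_codes)
    from correct[OF this] r[of "(map letter_code u, map letter_code v)"]
    show "rec_eval (Comp r [pair_prog]) [word_code u, word_code v] =
        Some (if conjugate_in G (word_val G ys u) (word_val G ys v) then 1 else 0)"
      by (simp add: word_code_eq word_val_eq code_bool_def)
  qed
qed

lemma ex_generating_tuple:
  assumes xs: "generating_tuple H xs"
  shows "\<exists>ys. generating_tuple G ys"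
proof -
  interpret G: group G by (rule group_semidirect)
  let ?R = "{(alt_word m gen_a gen_b, alt_word m gen_b gen_a)}"
  define cl where "cl = pres_class ?R"
  have A_def': "A = presented_group ?R" by (simp add: dihedral_artin_def)
  have carr: "carrier A = range cl" unfolding A_def' by (simp add: carrier_presented_group cl_def)
  have mult: "cl u \<otimes>\<^bsub>A\<^esub> cl v = cl (u @ v)" for u v
    unfolding A_def' by (simp add: mult_presented_group cl_def)
  have one: "\<one>\<^bsub>A\<^esub> = cl []" unfolding A_def' by (simp add: one_presented_group cl_def)
  have cl: "cl u \<in> carrier A" for u by (simp add: carr)
  have xsH: "set xs \<subseteq> carrier H" and gen: "generate H (set xs) = carrier H"
    using xs by (simp_all add: generating_tuple_def)
  define ys where "ys = (cl [(gen_a, True)], \<one>) # (cl [(gen_b, True)], \<one>) # map (\<lambda>h. (\<one>\<^bsub>A\<^esub>, h)) xs"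
  define S where "S = generate G (set ys)"
  have ysG: "set ys \<subseteq> carrier G" using cl xsH by (auto simp: ys_def)
  interpret S: subgroup S G unfolding S_def using ysG by (rule G.generate_is_subgroup)
  have lift_inv: "inv\<^bsub>G\<^esub> (a, \<one>) = (inv\<^bsub>A\<^esub> a, \<one>)" if "a \<in> carrier A" for a
    using that by (intro G.inv_equality) auto
  have lift_inv': "inv\<^bsub>G\<^esub> (\<one>\<^bsub>A\<^esub>, h) = (\<one>\<^bsub>A\<^esub>, inv h)" if "h \<in> carrier H" for h
    using that by (intro G.inv_equality) auto
  have "(cl [(g, True)], \<one>) \<in> S" for g
    unfolding S_def by (cases g) (auto simp: ys_def intro: generate.incl)
  moreover have "inv\<^bsub>A\<^esub> (cl [(g, True)]) = cl [(g, False)]" for g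
  proof (rule K.inv_equality[OF _ cl cl])
    have "cl ([(g, False)] @ [(g, True)]) = cl []"
      unfolding cl_def pres_class_eq_iff using pres_eq.cancel[of ?R "[]" g False "[]"] by simp
    then show "cl [(g, False)] \<otimes>\<^bsub>A\<^esub> cl [(g, True)] = \<one>\<^bsub>A\<^esub>" by (simp only: mult one)
  qed
  ultimately have letter: "(cl [(g, s)], \<one>) \<in> S" for g s
    using S.m_inv_closed lift_inv[OF cl] by (cases s) metis+
  have word: "(cl w, \<one>) \<in> S" for w
  proof (induction w)
    case Nil
    show ?case using S.one_closed by (simp add: one)
  next
    case (Cons a w)
    from S.m_closed[OF letter[of "fst a" "snd a"] Cons] show ?case using cl by (simp add: mult)
  qed
  have H: "(\<one>\<^bsub>A\<^esub>, h) \<in> S" if "h \<in> carrier H" for h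
  proof -
    have "h \<in> generate H (set xs)" using that gen by simp
    then show ?thesis
    proof (induction rule: generate.induct)
      case one
      show ?case using S.one_closed by simp
    next
      case (incl h)
      then show ?case unfolding S_def by (intro generate.incl) (auto simp: ys_def)
    next
      case (inv h)
      then have "(\<one>\<^bsub>A\<^esub>, h) \<in> S" unfolding S_def by (intro generate.incl) (auto simp: ys_def)
      then show ?case using S.m_inv_closed lift_inv' inv xsH by (metis subsetD)
    next
      case (eng h h')
      have "h \<in> carrier H" "h' \<in> carrier H"
        using eng.hyps gen by blast+
      then show ?case using S.m_closed[OF eng.IH] by simp
    qed
  qed
  have "g \<in> S" if g: "g \<in> carrier G" for g
  proof -
    obtain w h where "g = (cl w, h)" "h \<in> carrier H" using g carr by auto
    then show ?thesis using S.m_closed[OF word[of w] H[of h]] cl[of w] by simp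
  qed
  then have "S = carrier G" using S.subset by blast
  then show ?thesis using ysG unfolding generating_tuple_def S_def by blast
qed

end

theorem theorem5p4:
  fixes m :: nat
    and H :: "('h, 'r) monoid_scheme"
    and xs :: "'h list"
    and \<phi> :: "'h \<Rightarrow> artin_gen word set \<Rightarrow> artin_gen word set"
  assumes "m \<ge> 3" and "odd m"
    and "group H" and "generating_tuple H xs"
    and "\<phi> \<in> hom H (AutoGroup (dihedral_artin m))"
    and "conjugacy_problem_decidable_wrt H xs"
    and "\<And>h. h \<in> carrier H \<Longrightarrow> h \<noteq> \<one>\<^bsub>H\<^esub> \<Longrightarrow>
           finite (rcosets\<^bsub>H\<lparr>carrier := centralizer H h\<rparr>\<^esub> (generate H {h}))"
    and "centralizer_cosets_computable_wrt H xs"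
  shows "conjugacy_problem_decidable (semidirect_product (dihedral_artin m) H \<phi>)"
proof -
  have odd: "odd_dihedral m" using assms by unfold_locales
  have K: "group (dihedral_artin m)" unfolding dihedral_artin_def by (rule group_presented_group)
  obtain \<Theta> where \<Theta>: "\<Theta> \<in> iso (dihedral_artin m) (odd_dihedral.NG m)"
    using odd_dihedral.dihedral_artin_iso_NG[OF odd] unfolding is_iso_def by blast
  interpret artin_extension m H \<phi> \<Theta>
    by (intro artin_extension.intro semidirect.intro semidirect_axioms.intro
        artin_extension_axioms.intro odd K assms \<Theta>)
  show ?thesis
    unfolding conjugacy_problem_decidable_def
    using ex_generating_tuple conjugacy_decidable_wrt assms by blast
qed

end
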